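(* Assume $E X_1^2<\infty$, $E V_1^q<\infty$ for every $q>0$, and the CDF $F$ of $V_1$ is continuous. Assume $\rho:=EV_1/EX_1=1$ and the number of servers of the $s$-th system is $C_s=s+b\sqrt s$ with $b>0$. Then there is $b_0$ such that for every $b\ge b_0$ and every $\delta>0$, $$\log E_\pi^s|\tau|=o(s^\delta)\quad\text{as } s\to\infty.$$
   Context: Let $(X_n)_{n\ge1}$ be i.i.d. strictly positive interarrival times with mean $\mu\in(0,\infty)$ and $(V_n)_{n\ge1}$ i.i.d. nonnegative service times with CDF $F$, independent of $(X_n)$. For $s\in\{1,2,\dots\}$ the $s$-th system is the time-stationary GI/GI/$\infty$ queue on $\mathbb R$ whose arrivals form a time-stationary renewal process with interarrival times distributed as $X_1/s$, each customer receiving a service time distributed as $V_1$ (not scaled), beginning service immediately upon arrival. For $t\in\mathbb R$, $y\ge0$, let $Q(t,y)$ be the number of customers present at time $t$ with residual service time strictly greater than $y$ (arrivals at $t$ counted, departures at $t$ not), and $R(t)$ the maximum residual service time among customers present at time $t$ ($0$ if none). Given a number of servers $C_s$, define $$\tau=\sup\{t<0:\ R(t)<|t| \ \text{and}\ Q(u,0)\le C_s \text{ for all } u\in[t,t+R(t)]\}.$$ $E_\pi^s$ denotes expectation for the stationary $s$-th system. *)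

theory Defs
  imports "HOL-Probability.Probability" "HOL-Library.Landau_Symbols"
begin

text \<open>A sample path of the queue: customers are indexed by integers; customer n
arrives at time T n and has service time S n.\<close>

definition Qcount :: "(int \<Rightarrow> real) \<Rightarrow> (int \<Rightarrow> real) \<Rightarrow> real \<Rightarrow> real \<Rightarrow> enat" where
  "Qcount T S t y =
     (let A = {n. T n \<le> t \<and> T n + S n - t > y} in
      if finite A then enat (card A) else \<infinity>)"

definition Rmax :: "(int \<Rightarrow> real) \<Rightarrow> (int \<Rightarrow> real) \<Rightarrow> real \<Rightarrow> ereal" where
  "Rmax T S t = Sup (insert 0 {ereal (T n + S n - t) | n. T n \<le> t \<and> t < T n + S n})"

text \<open>tau (supremum in the extended reals; Sup of the empty set is -infinity).\<close>
definition tau :: "real \<Rightarrow> (int \<Rightarrow> real) \<Rightarrow> (int \<Rightarrow> real) \<Rightarrow> ereal" where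
  "tau C T S = Sup (ereal ` {t. t < 0 \<and> Rmax T S t < ereal \<bar>t\<bar> \<and>
       (\<forall>u. t \<le> u \<and> ereal u \<le> ereal t + Rmax T S t \<longrightarrow>
            ereal_of_enat (Qcount T S u 0) \<le> ereal C)})"

datatype ren_idx = Gap int | Serv int | Len | Pos

text \<open>The time-stationary GI/GI/infinity system with arrival rate scaled by s:
arrival times T n (T 0 \<le> 0 < T 1, strictly increasing), service times S n.
Time-stationarity of the renewal arrival process is expressed by its standard
explicit description: the gaps T (n+1) - T n, n \<noteq> 0, are i.i.d. ~ X/s; the
interval (T 0, T 1] straddling 0 has the length-biased law of X/s; the relative
position of 0 in it is uniform on [0,1]; all these and the i.i.d. service times
(~ V) are independent.\<close>
definition stationary_GG_inf ::
  "'a measure \<Rightarrow> (int \<Rightarrow> 'a \<Rightarrow> real) \<Rightarrow> (int \<Rightarrow> 'a \<Rightarrow> real) \<Rightarrow> real \<Rightarrow> real measure \<Rightarrow> real measure \<Rightarrow> bool"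
where
  "stationary_GG_inf M T S s DX DV \<longleftrightarrow>
     prob_space M \<and>
     (\<forall>\<omega>\<in>space M. T 0 \<omega> \<le> 0 \<and> 0 < T 1 \<omega> \<and> (\<forall>n. T n \<omega> < T (n + 1) \<omega>)) \<and>
     (let W = (\<lambda>i \<omega>. case i of
                  Gap n \<Rightarrow> T (n + 1) \<omega> - T n \<omega>
                | Serv n \<Rightarrow> S n \<omega>
                | Len \<Rightarrow> T 1 \<omega> - T 0 \<omega>
                | Pos \<Rightarrow> (0 - T 0 \<omega>) / (T 1 \<omega> - T 0 \<omega>));
          DXs = distr DX borel (\<lambda>x. x / s);
          m = integral\<^sup>L DXs (\<lambda>x. x)
      in prob_space.indep_vars M (\<lambda>_. borel) W
           ({Gap n | n. n \<noteq> 0} \<union> range Serv \<union> {Len, Pos}) \<and>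
         (\<forall>n. n \<noteq> 0 \<longrightarrow> distr M borel (W (Gap n)) = DXs) \<and>
         (\<forall>n. distr M borel (W (Serv n)) = DV) \<and>
         distr M borel (W Len) = density DXs (\<lambda>x. ennreal (x / m)) \<and>
         distr M borel (W Pos) = uniform_measure lborel {0..1})"

end

theory Submission
  imports Defs "HOL-Real_Asymp.Real_Asymp"
begin

text \<open>
  Split the customers of a window into about \<open>s powr (2 * \<kappa>)\<close> blocks of about
  \<open>s powr (1 - \<kappa>)\<close> consecutive customers. The events "the arrivals in the window are nowhere
  faster than a linear tube of width of order \<open>1 / sqrt s\<close> allows", "the number of customers
  present never exceeds the capacity", and "old customers have left" are all increasing in the
  interarrival times and decreasing in the service times. Each of them is an intersection of
  events belonging to a block, or to a pair of block boundaries, which have probability at least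
  1/2 by exponential moment bounds once the slack \<open>b * sqrt s\<close> is large enough. By Harris'
  inequality the whole window is therefore good with probability at least
  \<open>exp (- c * s powr (4 * \<kappa>))\<close>, although the pieces are far from independent.

  Windows with disjoint sets of customers are independent. Among r windows at mutual distance of
  order r, the long-range interaction through service times longer than r customers costs only a
  power \<open>r powr (-10)\<close>, since all service moments are finite. So the probability that none
  of r windows provides an admissible time is \<open>O(r powr (-8))\<close> with a constant of order
  \<open>exp (c * s powr (4 * \<kappa>))\<close>, and summing over r bounds the mean of \<open>\<bar>\<tau>\<bar>\<close>. In the
  other direction, the customer arriving at time T 0 alone forces \<open>\<bar>\<tau>\<bar>\<close> to be of order at
  least 1/s.
\<close>

subsection \<open>Harris' inequality\<close>

text \<open>The slack \<open>b * sqrt s\<close> has the order of the natural fluctuations of the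
  queue, so no probability near 1 is claimed for a window, and its constraints share gaps and
  services, so their probabilities do not factorise. Taking b at least \<open>b0\<close> only
  secures 1/2 for each piece. The price is therefore the number of pieces, which is why the grid is
  coarse: with a of order \<open>s powr \<kappa>\<close> there are about a^4 pieces, however many
  customers the window has. Inside a block only about \<open>s powr (1 - \<kappa>)\<close> customers
  matter, their fluctuations are well below the slack, and a union bound is affordable.

  The window must outlast the services in it. It lasts a multiple of \<open>a * \<mu>\<close>, and
  polynomial tails at that scale have to beat fixed powers of s, which takes moments of order about
  \<open>13 / \<kappa>\<close>. Since \<open>4 * \<kappa>\<close> has to be below \<delta>, moments
  of every order enter.

  A lower bound on the mean is needed because the logarithm is estimated in absolute value: the mean
  must not tend to 0 too fast either.\<close>

lemma chebyshev_association:
  fixes f g :: "real \<Rightarrow> real"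
  assumes "prob_space M" and sets: "sets M = sets borel"
    and meas: "f \<in> borel_measurable M" "g \<in> borel_measurable M"
    and mono: "mono f" "mono g"
    and bounds: "\<And>x. 0 \<le> f x \<and> f x \<le> 1" "\<And>x. 0 \<le> g x \<and> g x \<le> 1"
  shows "(\<integral>x. f x \<partial>M) * (\<integral>x. g x \<partial>M) \<le> (\<integral>x. f x * g x \<partial>M)"
proof -
  interpret prob_space M by fact
  note [measurable] = meas
  have int: "integrable M f" "integrable M g" "integrable M (\<lambda>x. f x * g x)"
    using bounds by (auto intro!: integrable_const_bound[where B=1] simp: abs_mult mult_le_one)
  define m where "m = (\<integral>x. g x \<partial>M)"
  \<comment> \<open>A level of f separating the points where g is below its mean from the others.\<close>
  obtain u where u: "\<And>x. (f x - u) * (g x - m) \<ge> 0"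
  proof (cases "\<exists>x. g x < m")
    case True
    define U where "U = f ` {x. g x < m}"
    have U: "U \<noteq> {}" "bdd_above U"
      using True bounds by (auto simp: U_def intro!: bdd_aboveI[of _ 1])
    have "(f x - Sup U) * (g x - m) \<ge> 0" for x
    proof (cases "g x < m")
      case True
      then have "f x \<le> Sup U"
        using U by (intro cSup_upper) (auto simp: U_def)
      with True show ?thesis
        by (simp add: mult_nonpos_nonpos)
    next
      case False
      have "Sup U \<le> f x"
      proof (rule cSup_least[OF U(1)])
        fix v assume "v \<in> U"
        then obtain z where "v = f z" "g z < m" by (auto simp: U_def)
        with False have "\<not> x \<le> z"
          using monoD[OF mono(2), of x z] by force
        with \<open>v = f z\<close> show "v \<le> f x"
          using monoD[OF mono(1), of z x] by simp
      qed
      with False show ?thesis by simp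
    qed
    then show ?thesis by (rule that)
  next
    case False
    show ?thesis
      by (rule that[of 0]) (use False bounds in \<open>auto simp: not_less\<close>)
  qed
  have "0 \<le> (\<integral>x. (f x - u) * (g x - m) \<partial>M)"
    using u by (rule Bochner_Integration.integral_nonneg)
  also have "\<dots> = (\<integral>x. f x * g x - m * f x - u * g x + u * m \<partial>M)"
    by (simp add: algebra_simps)
  also have "\<dots> = (\<integral>x. f x * g x \<partial>M) - m * (\<integral>x. f x \<partial>M)"
    using int by (simp add: m_def prob_space)
  finally show ?thesis by (simp add: m_def mult.commute)
qed

text \<open>Induction on the coordinates. Averaging out the new coordinate \<open>i\<close> leaves
  functions increasing in the others, to which the induction hypothesis applies. The one-dimensional
  inequality, with the other coordinates fixed, bounds the product of the two averages by the
  average of the product.\<close>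

lemma harris_PiM:
  fixes f g :: "('i \<Rightarrow> real) \<Rightarrow> real"
  assumes "finite I"
    and D: "\<And>i. prob_space (D i)" "\<And>i. sets (D i) = sets borel"
    and "f \<in> borel_measurable (PiM I D)" "g \<in> borel_measurable (PiM I D)"
    and "\<And>x y. x \<in> extensional I \<Longrightarrow> y \<in> extensional I \<Longrightarrow> (\<forall>i\<in>I. x i \<le> y i) \<Longrightarrow> f x \<le> f y"
    and "\<And>x y. x \<in> extensional I \<Longrightarrow> y \<in> extensional I \<Longrightarrow> (\<forall>i\<in>I. x i \<le> y i) \<Longrightarrow> g x \<le> g y"
    and "\<And>x. 0 \<le> f x \<and> f x \<le> 1" "\<And>x. 0 \<le> g x \<and> g x \<le> 1"
  shows "(\<integral>x. f x \<partial>PiM I D) * (\<integral>x. g x \<partial>PiM I D) \<le> (\<integral>x. f x * g x \<partial>PiM I D)"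
  using assms(1,4-)
proof (induction I arbitrary: f g)
  case empty
  show ?case by (simp add: PiM_empty lebesgue_integral_count_space_finite)
next
  case (insert i I)
  interpret Di: prob_space "D i" by (rule D)
  interpret PS: product_prob_space D UNIV
    by (intro product_prob_spaceI D)
  interpret PI: prob_space "PiM I D" by (intro prob_space_PiM D)
  interpret PII: prob_space "PiM (insert i I) D" by (intro prob_space_PiM D)
  note [measurable] = insert.prems(1,2)
  have sp: "space (D j) = UNIV" for j
    using sets_eq_imp_space_eq[OF D(2)] by simp
  then have spI: "space (PiM I D) = extensional I" for I :: "'i set"
    by (simp add: space_PiM PiE_UNIV_domain PiE_def)
  have upd: "(\<lambda>(x, y). h (x(i := y))) \<in> borel_measurable (PiM I D \<Otimes>\<^sub>M D i)"
    if [measurable]: "h \<in> borel_measurable (PiM (insert i I) D)" for h :: "_ \<Rightarrow> real"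
    using measurable_compose[OF measurable_add_dim that] by (simp add: split_beta')
  have inner: "(\<lambda>y. h (x(i := y))) \<in> borel_measurable (D i)"
    if "h \<in> borel_measurable (PiM (insert i I) D)" "x \<in> extensional I" for h :: "_ \<Rightarrow> real" and x
    using measurable_Pair2[OF upd[OF that(1)]] that(2) spI by simp
  have outer: "(\<lambda>x. \<integral>y. h (x(i := y)) \<partial>D i) \<in> borel_measurable (PiM I D)"
    if "h \<in> borel_measurable (PiM (insert i I) D)" for h :: "_ \<Rightarrow> real"
    using Di.borel_measurable_lebesgue_integral[OF upd[OF that]] by simp
  have bnd: "integrable (D i) (\<lambda>y. h (x(i := y)))" "0 \<le> (\<integral>y. h (x(i := y)) \<partial>D i)"
    "(\<integral>y. h (x(i := y)) \<partial>D i) \<le> 1"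
    if h: "h \<in> borel_measurable (PiM (insert i I) D)" "\<And>x. 0 \<le> h x \<and> h x \<le> 1"
      and x: "x \<in> extensional I" for h :: "_ \<Rightarrow> real" and x
  proof -
    show int: "integrable (D i) (\<lambda>y. h (x(i := y)))"
      using h(2) inner[OF h(1) x] by (intro Di.integrable_const_bound[where B=1]) auto
    show "0 \<le> (\<integral>y. h (x(i := y)) \<partial>D i)"
      using h(2) by (intro Bochner_Integration.integral_nonneg) auto
    show "(\<integral>y. h (x(i := y)) \<partial>D i) \<le> 1"
      using h(2) by (intro Di.integral_le_const int) auto
  qed
  have upd_ext: "x(i := y) \<in> extensional (insert i I)" if "x \<in> extensional I" for x y
    using that by (auto simp: extensional_def)
  \<comment> \<open>The section of \<open>h\<close> at \<open>x\<close> is known to be measurable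
    only for points of the product space. The value 0 elsewhere yields the bounds at every
    \<open>x\<close>, as the induction hypothesis asks.\<close>
  define F where "F h x = (if x \<in> extensional I then \<integral>y. h (x(i := y)) \<partial>D i else 0)"
    for h :: "('i \<Rightarrow> real) \<Rightarrow> real" and x
  have F_meas: "F h \<in> borel_measurable (PiM I D)"
    if "h \<in> borel_measurable (PiM (insert i I) D)" for h
    using outer[OF that] by (rule measurable_cong[THEN iffD1, rotated]) (simp add: F_def spI)
  have F_mono: "F h x \<le> F h y"
    if h: "h \<in> borel_measurable (PiM (insert i I) D)" "\<And>x. 0 \<le> h x \<and> h x \<le> 1"
      and m: "\<And>x y. x \<in> extensional (insert i I) \<Longrightarrow> y \<in> extensional (insert i I) \<Longrightarrow>
                (\<forall>j\<in>insert i I. x j \<le> y j) \<Longrightarrow> h x \<le> h y"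
      and xy: "x \<in> extensional I" "y \<in> extensional I" "\<forall>j\<in>I. x j \<le> y j" for h x y
    using xy unfolding F_def
    by (simp, intro integral_mono bnd(1) h m upd_ext) auto
  have F_bounds: "0 \<le> F h x \<and> F h x \<le> 1"
    if h: "h \<in> borel_measurable (PiM (insert i I) D)" "\<And>x. 0 \<le> h x \<and> h x \<le> 1" for h x
    using bnd[OF h] by (auto simp: F_def)
  have F_int: "(\<integral>x. h x \<partial>PiM (insert i I) D) = (\<integral>x. F h x \<partial>PiM I D)"
    if h: "h \<in> borel_measurable (PiM (insert i I) D)" "\<And>x. 0 \<le> h x \<and> h x \<le> 1" for h
  proof -
    have "integrable (PiM (insert i I) D) h"
      using h by (intro PII.integrable_const_bound[where B=1]) auto
    from PS.product_integral_insert[OF insert.hyps(1,2) this]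
    have "(\<integral>x. h x \<partial>PiM (insert i I) D) = (\<integral>x. \<integral>y. h (x(i := y)) \<partial>D i \<partial>PiM I D)" .
    also have "\<dots> = (\<integral>x. F h x \<partial>PiM I D)"
      by (rule Bochner_Integration.integral_cong) (simp_all add: F_def spI)
    finally show ?thesis .
  qed
  have fg: "(\<lambda>x. f x * g x) \<in> borel_measurable (PiM (insert i I) D)"
    "\<And>x. 0 \<le> f x * g x \<and> f x * g x \<le> 1"
    using insert.prems(5,6) by (auto intro: mult_le_one)
  have "(\<integral>x. F f x \<partial>PiM I D) * (\<integral>x. F g x \<partial>PiM I D) \<le> (\<integral>x. F f x * F g x \<partial>PiM I D)"
    by (intro insert.IH F_meas F_mono F_bounds insert.prems) auto
  also have "\<dots> \<le> (\<integral>x. F (\<lambda>x. f x * g x) x \<partial>PiM I D)"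
  proof (rule integral_mono)
    have "F f x * F g x \<le> 1 \<and> 0 \<le> F f x * F g x" for x
      using F_bounds[OF insert.prems(1,5)] F_bounds[OF insert.prems(2,6)]
      by (auto intro: mult_le_one)
    then show "integrable (PiM I D) (\<lambda>x. F f x * F g x)"
      using F_meas[OF insert.prems(1)] F_meas[OF insert.prems(2)]
      by (intro PI.integrable_const_bound[where B=1]) auto
    show "integrable (PiM I D) (F (\<lambda>x. f x * g x))"
      using F_meas[OF fg(1)] F_bounds[OF fg]
      by (intro PI.integrable_const_bound[where B=1]) auto
    fix x assume "x \<in> space (PiM I D)"
    then have x: "x \<in> extensional I" by (simp add: spI)
    have "mono (\<lambda>y. f (x(i := y)))" "mono (\<lambda>y. g (x(i := y)))"
      using x by (auto intro!: monoI insert.prems(3,4) upd_ext)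
    from chebyshev_association[OF D(1,2) inner[OF insert.prems(1) x] inner[OF insert.prems(2) x] this]
    show "F f x * F g x \<le> F (\<lambda>x. f x * g x) x"
      using x insert.prems(5,6) unfolding F_def by simp
  qed
  finally show ?case
    using F_int[OF insert.prems(1,5)] F_int[OF insert.prems(2,6)] F_int[OF fg] by simp
qed

text \<open>Monotonicity ranges over all functions but compares them on \<open>I\<close> only.
  Functions that agree on \<open>I\<close> are comparable both ways, so the predicate depends on the
  coordinates in \<open>I\<close> alone and may be evaluated at the whole vector
  \<open>Y\<close>.\<close>

definition increasing_event :: "'i set \<Rightarrow> (('i \<Rightarrow> real) \<Rightarrow> bool) \<Rightarrow> bool" where
  "increasing_event I P \<longleftrightarrow>
     {y \<in> space (PiM I (\<lambda>_. borel)). P y} \<in> sets (PiM I (\<lambda>_. borel)) \<and>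
     (\<forall>x y. P x \<longrightarrow> (\<forall>i\<in>I. x i \<le> y i) \<longrightarrow> P y)"

lemma increasing_event_restrict:
  assumes "increasing_event I P"
  shows "P (restrict x I) \<longleftrightarrow> P x"
proof -
  have "\<forall>i\<in>I. restrict x I i \<le> x i" "\<forall>i\<in>I. x i \<le> restrict x I i"
    by simp_all
  with assms show ?thesis
    unfolding increasing_event_def by blast
qed

lemma increasing_event_conj:
  assumes "increasing_event I P" "increasing_event I Q"
  shows "increasing_event I (\<lambda>y. P y \<and> Q y)"
  unfolding increasing_event_def
proof (intro conjI)
  show "{y \<in> space (PiM I (\<lambda>_. borel)). P y \<and> Q y} \<in> sets (PiM I (\<lambda>_. borel))"
    by (intro sets.sets_Collect_conj) (use assms in \<open>auto simp: increasing_event_def\<close>)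
qed (use assms in \<open>unfold increasing_event_def, blast\<close>)

lemma increasing_event_ball:
  assumes "finite K" "\<And>k. k \<in> K \<Longrightarrow> increasing_event I (P k)"
  shows "increasing_event I (\<lambda>y. \<forall>k\<in>K. P k y)"
  unfolding increasing_event_def
proof (intro conjI)
  show "{y \<in> space (PiM I (\<lambda>_. borel)). \<forall>k\<in>K. P k y} \<in> sets (PiM I (\<lambda>_. borel))"
    by (intro sets.sets_Collect_finite_All) (use assms in \<open>auto simp: increasing_event_def\<close>)
qed (use assms in \<open>unfold increasing_event_def, blast\<close>)

context prob_space
begin

lemma increasing_event_measurable:
  assumes "increasing_event I P" "indep_vars (\<lambda>_. borel) Y I"
  shows "{\<omega> \<in> space M. P (\<lambda>i. Y i \<omega>)} \<in> events"
proof -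
  have "(\<lambda>\<omega>. \<lambda>i\<in>I. Y i \<omega>) \<in> M \<rightarrow>\<^sub>M PiM I (\<lambda>_. borel)"
    using assms(2) by (intro measurable_restrict) (auto simp: indep_vars_def)
  from measurable_sets[OF this, of "{y \<in> space (PiM I (\<lambda>_. borel)). P y}"]
  have "(\<lambda>\<omega>. \<lambda>i\<in>I. Y i \<omega>) -` {y \<in> space (PiM I (\<lambda>_. borel)). P y} \<inter> space M \<in> events"
    using assms(1) by (simp add: increasing_event_def)
  also have "(\<lambda>\<omega>. \<lambda>i\<in>I. Y i \<omega>) -` {y \<in> space (PiM I (\<lambda>_. borel)). P y} \<inter> space M
      = {\<omega> \<in> space M. P (\<lambda>i. Y i \<omega>)}"
    by (auto simp: space_PiM increasing_event_restrict[OF assms(1)])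
  finally show ?thesis .
qed

text \<open>By independence the joint law of the coordinates is a product measure, and the product
  inequality applies to the two indicators. The events themselves may share every
  coordinate.\<close>

lemma harris_inequality:
  assumes "finite I" and indep: "indep_vars (\<lambda>_. borel) Y I"
    and P: "increasing_event I P" and Q: "increasing_event I Q"
  shows "prob {\<omega> \<in> space M. P (\<lambda>i. Y i \<omega>)} * prob {\<omega> \<in> space M. Q (\<lambda>i. Y i \<omega>)}
           \<le> prob {\<omega> \<in> space M. P (\<lambda>i. Y i \<omega>) \<and> Q (\<lambda>i. Y i \<omega>)}"
proof (cases "I = {}")
  \<comment> \<open>The product form of the joint law is invoked for nonempty \<open>I\<close>. Over
    the empty index set an increasing predicate is constant.\<close>
  case True
  have "P x \<longleftrightarrow> P undefined" "Q x \<longleftrightarrow> Q undefined" for x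
    using P Q unfolding increasing_event_def True by blast+
  then show ?thesis
    by (cases "P undefined"; cases "Q undefined") (simp_all add: prob_space)
next
  case False
  have rv: "\<And>i. i \<in> I \<Longrightarrow> random_variable borel (Y i)"
    using indep by (auto simp: indep_vars_def)
  \<comment> \<open>The point mass at 0 outside \<open>I\<close> is a filler: the product inequality
    wants a probability measure at every index.\<close>
  define D where "D i = (if i \<in> I then distr M borel (Y i) else return borel (0::real))" for i
  have D: "prob_space (D i)" "sets (D i) = sets borel" for i
    by (auto simp: D_def intro!: prob_space_distr rv prob_space_return)
  let ?B = "PiM I (\<lambda>_. borel :: real measure)"
  let ?Y = "\<lambda>\<omega>. \<lambda>i\<in>I. Y i \<omega>"
  have Y: "?Y \<in> M \<rightarrow>\<^sub>M ?B" using rv by (rule measurable_restrict)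
  have "PiM I D = PiM I (\<lambda>i. distr M borel (Y i))"
    by (rule PiM_cong) (auto simp: D_def)
  then have distr: "distr M ?B ?Y = PiM I D"
    using indep indep_vars_iff_distr_eq_PiM'[OF False rv] by simp
  have sets: "sets (PiM I D) = sets ?B"
    by (rule sets_PiM_cong) (auto simp: D)
  have sp: "space ?B = extensional I" by (auto simp: space_PiM PiE_def)
  have int: "(\<integral>y. indicator {y \<in> extensional I. R y} y \<partial>PiM I D) = prob {\<omega> \<in> space M. R (\<lambda>i. Y i \<omega>)}"
    and meas: "indicator {y \<in> extensional I. R y} \<in> borel_measurable (PiM I D)"
    if R: "increasing_event I R" for R
  proof -
    have m: "{y \<in> extensional I. R y} \<in> sets ?B"
      using R by (simp add: increasing_event_def sp)
    then show "indicator {y \<in> extensional I. R y} \<in> borel_measurable (PiM I D)"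
      by (intro borel_measurable_indicator) (simp add: sets)
    have "(\<integral>y. indicator {y \<in> extensional I. R y} y \<partial>PiM I D)
        = measure (PiM I D) {y \<in> extensional I. R y}"
      using m sets.sets_into_space[OF m] sets_eq_imp_space_eq[OF sets]
      by (simp add: Int_absorb2 sets)
    also have "\<dots> = prob (?Y -` {y \<in> extensional I. R y} \<inter> space M)"
      unfolding distr[symmetric] by (rule measure_distr[OF Y m])
    also have "?Y -` {y \<in> extensional I. R y} \<inter> space M = {\<omega> \<in> space M. R (\<lambda>i. Y i \<omega>)}"
      by (auto simp: increasing_event_restrict[OF R])
    finally show "(\<integral>y. indicator {y \<in> extensional I. R y} y \<partial>PiM I D) = prob {\<omega> \<in> space M. R (\<lambda>i. Y i \<omega>)}" .
  qed
  have mono: "indicator {y \<in> extensional I. R y} x \<le> (indicator {y \<in> extensional I. R y} y :: real)"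
    if "increasing_event I R" "x \<in> extensional I" "y \<in> extensional I" "\<forall>i\<in>I. x i \<le> y i" for R x y
    using that unfolding increasing_event_def by (auto simp: indicator_def)
  have "(\<integral>y. indicat_real {y \<in> extensional I. P y} y \<partial>PiM I D) * (\<integral>y. indicator {y \<in> extensional I. Q y} y \<partial>PiM I D)
     \<le> (\<integral>y. indicator {y \<in> extensional I. P y} y * indicator {y \<in> extensional I. Q y} y \<partial>PiM I D)"
    by (rule harris_PiM[where f="indicator {y \<in> extensional I. P y}" and g="indicator {y \<in> extensional I. Q y}"])
      (use assms(1) D meas P Q mono in \<open>auto split: split_indicator\<close>)
  also have "(\<lambda>y. indicator {y \<in> extensional I. P y} y * indicator {y \<in> extensional I. Q y} y :: real)
      = indicator {y \<in> extensional I. P y \<and> Q y}"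
    by (auto simp: fun_eq_iff split: split_indicator)
  finally show ?thesis
    unfolding int[OF P] int[OF Q] int[OF increasing_event_conj[OF P Q]] .
qed

lemma harris_inequality_finite:
  assumes "finite I" "indep_vars (\<lambda>_. borel) Y I" "finite K"
    and P: "\<And>k. k \<in> K \<Longrightarrow> increasing_event I (P k)"
    and p: "\<And>k. k \<in> K \<Longrightarrow> prob {\<omega> \<in> space M. P k (\<lambda>i. Y i \<omega>)} \<ge> p" and "0 \<le> p"
  shows "prob {\<omega> \<in> space M. \<forall>k\<in>K. P k (\<lambda>i. Y i \<omega>)} \<ge> p ^ card K"
  using assms(3) P p
proof (induction K)
  case empty
  then show ?case by (simp add: prob_space)
next
  case (insert k K)
  have "p ^ card (insert k K) = p * p ^ card K"
    using insert.hyps by simp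
  also have "\<dots> \<le> prob {\<omega> \<in> space M. P k (\<lambda>i. Y i \<omega>)} * prob {\<omega> \<in> space M. \<forall>k\<in>K. P k (\<lambda>i. Y i \<omega>)}"
    using insert assms(6) by (intro mult_mono) auto
  also have "\<dots> \<le> prob {\<omega> \<in> space M. P k (\<lambda>i. Y i \<omega>) \<and> (\<forall>k\<in>K. P k (\<lambda>i. Y i \<omega>))}"
    using assms(1,2) insert.hyps insert.prems(1)
    by (intro harris_inequality increasing_event_ball) auto
  finally show ?case by simp
qed

text \<open>Every elementary piece of a window gets the lower bound 1/2, so the exponent simply
  counts pieces.\<close>

lemma harris_half_power:
  assumes "finite I" "indep_vars (\<lambda>_. borel) Y I" "increasing_event I P" "increasing_event I Q"
    and "prob {\<omega> \<in> space M. P (\<lambda>i. Y i \<omega>)} \<ge> (1 / 2) ^ m" "prob {\<omega> \<in> space M. Q (\<lambda>i. Y i \<omega>)} \<ge> (1 / 2) ^ n"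
  shows "prob {\<omega> \<in> space M. P (\<lambda>i. Y i \<omega>) \<and> Q (\<lambda>i. Y i \<omega>)} \<ge> (1 / 2) ^ (m + n)"
proof -
  have "(1 / 2) ^ (m + n) \<le> prob {\<omega> \<in> space M. P (\<lambda>i. Y i \<omega>)} * prob {\<omega> \<in> space M. Q (\<lambda>i. Y i \<omega>)}"
    unfolding power_add using assms by (intro mult_mono) auto
  also have "\<dots> \<le> prob {\<omega> \<in> space M. P (\<lambda>i. Y i \<omega>) \<and> Q (\<lambda>i. Y i \<omega>)}"
    by (rule harris_inequality[OF assms(1-4)])
  finally show ?thesis .
qed

lemma prob_Ball_ge:
  fixes P :: "'i \<Rightarrow> 'a \<Rightarrow> bool"
  assumes "finite K" and ev: "\<And>k. k \<in> K \<Longrightarrow> {\<omega> \<in> space M. \<not> P k \<omega>} \<in> events"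
    and le: "\<And>k. k \<in> K \<Longrightarrow> prob {\<omega> \<in> space M. \<not> P k \<omega>} \<le> c k"
  shows "prob {\<omega> \<in> space M. \<forall>k\<in>K. P k \<omega>} \<ge> 1 - (\<Sum>k\<in>K. c k)"
proof -
  have U: "(\<Union>k\<in>K. {\<omega> \<in> space M. \<not> P k \<omega>}) \<in> events"
    using assms by (intro sets.finite_UN) auto
  have "prob (\<Union>k\<in>K. {\<omega> \<in> space M. \<not> P k \<omega>}) \<le> (\<Sum>k\<in>K. prob {\<omega> \<in> space M. \<not> P k \<omega>})"
    using assms by (intro finite_measure_subadditive_finite) auto
  also have "\<dots> \<le> (\<Sum>k\<in>K. c k)" using le by (rule sum_mono)
  finally have "1 - (\<Sum>k\<in>K. c k) \<le> prob (space M - (\<Union>k\<in>K. {\<omega> \<in> space M. \<not> P k \<omega>}))"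
    using prob_compl[OF U] by simp
  also have "space M - (\<Union>k\<in>K. {\<omega> \<in> space M. \<not> P k \<omega>}) = {\<omega> \<in> space M. \<forall>k\<in>K. P k \<omega>}"
    by auto
  finally show ?thesis .
qed

lemma prob_ge_half_if_compl:
  assumes "{\<omega> \<in> space M. \<not> P \<omega>} \<in> events" "prob {\<omega> \<in> space M. \<not> P \<omega>} \<le> 1 / 2"
  shows "prob {\<omega> \<in> space M. P \<omega>} \<ge> 1 / 2"
  using prob_Ball_ge[of "{()}" "\<lambda>_. P" "\<lambda>_. 1 / 2"] assms by simp

subsection \<open>Exponential moment bounds\<close>

text \<open>Markov's inequality for the exponential of the sum, whose mean factorises by
  independence. With nonnegative integrals a bound on an exponential moment also contains its
  finiteness.\<close>

lemma indep_vars_exp_sum_nn_integral: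
  fixes X :: "'i \<Rightarrow> 'a \<Rightarrow> real"
  assumes "finite I" and indep: "indep_vars (\<lambda>_. borel) X I"
    and mgf: "\<And>i. i \<in> I \<Longrightarrow> (\<integral>\<^sup>+\<omega>. ennreal (exp (X i \<omega>)) \<partial>M) \<le> ennreal (exp (c i))"
  shows "prob {\<omega> \<in> space M. (\<Sum>i\<in>I. X i \<omega>) \<ge> x} \<le> exp ((\<Sum>i\<in>I. c i) - x)"
proof -
  have [measurable]: "\<And>i. i \<in> I \<Longrightarrow> random_variable borel (X i)"
    using indep by (auto simp: indep_vars_def)
  have "(\<integral>\<^sup>+\<omega>. ennreal (exp (\<Sum>i\<in>I. X i \<omega>)) \<partial>M) = (\<integral>\<^sup>+\<omega>. (\<Prod>i\<in>I. ennreal (exp (X i \<omega>))) \<partial>M)"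
    using assms(1) by (simp add: exp_sum prod_ennreal)
  also have "\<dots> = (\<Prod>i\<in>I. \<integral>\<^sup>+\<omega>. ennreal (exp (X i \<omega>)) \<partial>M)"
    using assms(1) by (rule indep_vars_nn_integral)
      (auto intro!: indep_vars_compose2[OF indep])
  also have "\<dots> \<le> (\<Prod>i\<in>I. ennreal (exp (c i)))"
    using mgf by (intro prod_mono_ennreal) auto
  also have "\<dots> = ennreal (exp (\<Sum>i\<in>I. c i))"
    using assms(1) by (simp add: exp_sum prod_ennreal)
  finally have le: "(\<integral>\<^sup>+\<omega>. ennreal (exp (\<Sum>i\<in>I. X i \<omega>)) \<partial>M) \<le> ennreal (exp (\<Sum>i\<in>I. c i))" .
  have "emeasure M {\<omega> \<in> space M. (\<Sum>i\<in>I. X i \<omega>) \<ge> x}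
      = emeasure M {\<omega> \<in> space M. 1 \<le> ennreal (exp (- x)) * ennreal (exp (\<Sum>i\<in>I. X i \<omega>))}"
    by (intro arg_cong[where f="emeasure M"] Collect_cong conj_cong refl)
      (simp add: ennreal_mult'[symmetric] exp_add[symmetric] flip: ennreal_1)
  also have "\<dots> \<le> ennreal (exp (- x)) * (\<integral>\<^sup>+\<omega>. ennreal (exp (\<Sum>i\<in>I. X i \<omega>)) * indicator (space M) \<omega> \<partial>M)"
    by (intro nn_integral_Markov_inequality) auto
  also have "\<dots> \<le> ennreal (exp (- x)) * ennreal (exp (\<Sum>i\<in>I. c i))"
    using le by (intro mult_left_mono) (auto simp: nn_integral_indicator cong: nn_integral_cong)
  also have "\<dots> = ennreal (exp ((\<Sum>i\<in>I. c i) - x))"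
    by (simp add: ennreal_mult'[symmetric] exp_add[symmetric] algebra_simps)
  finally show ?thesis
    by (simp add: emeasure_eq_measure)
qed

text \<open>For nonnegative \<open>y\<close>, \<open>exp (- y)\<close> lies below its second order
  Taylor polynomial. Hence sums of nonnegative variables have a Gaussian lower tail, with raw second
  moments in place of variances. This is how a second moment of the interarrival time gives
  exponential bounds: only arrivals that come too fast are harmful.\<close>

lemma sum_lower_tail:
  fixes X :: "'i \<Rightarrow> 'a \<Rightarrow> real"
  assumes "finite I" and indep: "indep_vars (\<lambda>_. borel) X I"
    and nonneg: "\<And>i \<omega>. i \<in> I \<Longrightarrow> \<omega> \<in> space M \<Longrightarrow> 0 \<le> X i \<omega>"
    and sq: "\<And>i. i \<in> I \<Longrightarrow> integrable M (\<lambda>\<omega>. (X i \<omega>)\<^sup>2)"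
    and v: "(\<Sum>i\<in>I. expectation (\<lambda>\<omega>. (X i \<omega>)\<^sup>2)) \<le> v" "0 < v" and x: "0 \<le> x"
  shows "prob {\<omega> \<in> space M. (\<Sum>i\<in>I. X i \<omega>) \<le> (\<Sum>i\<in>I. expectation (X i)) - x} \<le> exp (- x\<^sup>2 / (2 * v))"
proof -
  have rv[measurable]: "\<And>i. i \<in> I \<Longrightarrow> random_variable borel (X i)"
    using indep by (auto simp: indep_vars_def)
  \<comment> \<open>The minimiser of \<open>- t * x + t^2 * v / 2\<close>.\<close>
  define t where "t = x / v"
  have t: "t \<ge> 0" using v x by (simp add: t_def)
  define c where "c i = - t * expectation (X i) + t\<^sup>2 / 2 * expectation (\<lambda>\<omega>. (X i \<omega>)\<^sup>2)" for i
  have "prob {\<omega> \<in> space M. (\<Sum>i\<in>I. - t * X i \<omega>) \<ge> - t * ((\<Sum>i\<in>I. expectation (X i)) - x)}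
    \<le> exp ((\<Sum>i\<in>I. c i) - (- t * ((\<Sum>i\<in>I. expectation (X i)) - x)))"
  proof (rule indep_vars_exp_sum_nn_integral)
    show "indep_vars (\<lambda>_. borel) (\<lambda>i \<omega>. - t * X i \<omega>) I"
      by (rule indep_vars_compose2[OF indep]) auto
    fix i assume i: "i \<in> I"
    note [measurable] = rv[OF i]
    have int: "integrable M (X i)"
      by (rule square_integrable_imp_integrable[OF rv[OF i] sq[OF i]])
    have "exp (- t * X i \<omega>) \<le> 1 - t * X i \<omega> + t\<^sup>2 / 2 * (X i \<omega>)\<^sup>2" if "\<omega> \<in> space M" for \<omega>
    proof -
      have y: "0 \<le> t * X i \<omega>" using t nonneg[OF i that] by simp
      have "exp (- y) \<le> 1 - y + y\<^sup>2 / 2" if "0 \<le> y" for y :: real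
      proof -
        \<comment> \<open>Mean value theorem for the difference of the two sides, whose derivative
          is nonnegative since \<open>exp (- z)\<close> is at least \<open>1 - z\<close>.\<close>
        have "\<exists>z. 0 \<le> z \<and> z \<le> y \<and> (1 - y + y\<^sup>2 / 2 - exp (- y)) - (1 - 0 + 0\<^sup>2 / 2 - exp (- 0)) = (y - 0) * (- 1 + z + exp (- z))"
          if "0 < y"
        proof -
          have "((\<lambda>y. 1 - y + y\<^sup>2 / 2 - exp (- y)) has_real_derivative - 1 + z + exp (- z)) (at z)" for z :: real
            by (auto intro!: derivative_eq_intros)
          from MVT2[OF that this] show ?thesis
            by (metis less_eq_real_def)
        qed
        moreover have "- 1 + z + exp (- z) \<ge> 0" for z :: real
          using exp_ge_add_one_self[of "- z"] by simp
        ultimately show ?thesis using that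
          by (cases "y = 0") (auto, smt (verit, ccfv_SIG) mult_nonneg_nonneg)
      qed
      from this[OF y] show ?thesis by (simp add: power_mult_distrib)
    qed
    then have "(\<integral>\<^sup>+\<omega>. ennreal (exp (- t * X i \<omega>)) \<partial>M) \<le> (\<integral>\<^sup>+\<omega>. ennreal (1 - t * X i \<omega> + t\<^sup>2 / 2 * (X i \<omega>)\<^sup>2) \<partial>M)"
      by (intro nn_integral_mono) (auto intro!: ennreal_leI)
    also have "\<dots> = ennreal (\<integral>\<omega>. 1 - t * X i \<omega> + t\<^sup>2 / 2 * (X i \<omega>)\<^sup>2 \<partial>M)"
    proof (rule nn_integral_eq_integral)
      show "AE \<omega> in M. 0 \<le> 1 - t * X i \<omega> + t\<^sup>2 / 2 * (X i \<omega>)\<^sup>2"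
      proof (rule AE_I2)
        fix \<omega>
        have "0 \<le> (1 - t * X i \<omega>)\<^sup>2" by simp
        then show "0 \<le> 1 - t * X i \<omega> + t\<^sup>2 / 2 * (X i \<omega>)\<^sup>2"
          by (simp add: power2_eq_square algebra_simps)
      qed
    qed (use int sq[OF i] in auto)
    also have "(\<integral>\<omega>. 1 - t * X i \<omega> + t\<^sup>2 / 2 * (X i \<omega>)\<^sup>2 \<partial>M) = 1 + c i"
      using int sq[OF i] by (simp add: c_def prob_space)
    also have "ennreal (1 + c i) \<le> ennreal (exp (c i))"
      by (intro ennreal_leI exp_ge_add_one_self)
    finally show "(\<integral>\<^sup>+\<omega>. ennreal (exp (- t * X i \<omega>)) \<partial>M) \<le> ennreal (exp (c i))" .
  qed (fact assms(1))
  moreover have "(\<Sum>i\<in>I. c i) - (- t * ((\<Sum>i\<in>I. expectation (X i)) - x)) \<le> - x\<^sup>2 / (2 * v)"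
  proof -
    have "(\<Sum>i\<in>I. c i) = - t * (\<Sum>i\<in>I. expectation (X i)) + t\<^sup>2 / 2 * (\<Sum>i\<in>I. expectation (\<lambda>\<omega>. (X i \<omega>)\<^sup>2))"
      by (simp add: c_def sum.distrib sum_distrib_left sum_negf sum_subtractf)
    also have "\<dots> \<le> - t * (\<Sum>i\<in>I. expectation (X i)) + t\<^sup>2 / 2 * v"
      using v by (intro add_left_mono mult_left_mono) auto
    also have "t\<^sup>2 / 2 * v = x\<^sup>2 / (2 * v)"
      using v by (simp add: t_def field_simps power2_eq_square)
    finally have "(\<Sum>i\<in>I. c i) + t * (\<Sum>i\<in>I. expectation (X i)) \<le> x\<^sup>2 / (2 * v)"
      by simp
    moreover have "t * x = x\<^sup>2 / (2 * v) + x\<^sup>2 / (2 * v)"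
      by (simp add: t_def power2_eq_square)
    ultimately show ?thesis
      by (simp add: right_diff_distrib)
  qed
  moreover
  have "{\<omega> \<in> space M. (\<Sum>i\<in>I. X i \<omega>) \<le> (\<Sum>i\<in>I. expectation (X i)) - x}
     \<subseteq> {\<omega> \<in> space M. (\<Sum>i\<in>I. - t * X i \<omega>) \<ge> - t * ((\<Sum>i\<in>I. expectation (X i)) - x)}"
    using t by (auto simp: sum_distrib_left[symmetric] sum_negf intro: mult_left_mono)
  then have "prob {\<omega> \<in> space M. (\<Sum>i\<in>I. X i \<omega>) \<le> (\<Sum>i\<in>I. expectation (X i)) - x}
     \<le> prob {\<omega> \<in> space M. (\<Sum>i\<in>I. - t * X i \<omega>) \<ge> - t * ((\<Sum>i\<in>I. expectation (X i)) - x)}"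
    by (rule finite_measure_mono) measurable
  ultimately show ?thesis
    by (smt (verit) exp_le_cancel_iff)
qed

text \<open>On the unit interval \<open>exp y\<close> is at most \<open>1 + y + y^2\<close>, and a
  variable with values in it dominates its own square, so that the sum of the means serves as
  variance proxy.\<close>

lemma unit_interval_sum_upper_tail:
  fixes X :: "'i \<Rightarrow> 'a \<Rightarrow> real"
  assumes "finite I" and indep: "indep_vars (\<lambda>_. borel) X I"
    and X: "\<And>i \<omega>. i \<in> I \<Longrightarrow> \<omega> \<in> space M \<Longrightarrow> 0 \<le> X i \<omega> \<and> X i \<omega> \<le> 1"
    and v: "(\<Sum>i\<in>I. expectation (X i)) \<le> v" and t: "0 < t" "t \<le> 1"
  shows "prob {\<omega> \<in> space M. (\<Sum>i\<in>I. X i \<omega>) \<ge> (\<Sum>i\<in>I. expectation (X i)) + x} \<le> exp (t\<^sup>2 * v - t * x)"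
proof -
  define c where "c i = (t + t\<^sup>2) * expectation (X i)" for i
  have "prob {\<omega> \<in> space M. (\<Sum>i\<in>I. t * X i \<omega>) \<ge> t * ((\<Sum>i\<in>I. expectation (X i)) + x)}
    \<le> exp ((\<Sum>i\<in>I. c i) - t * ((\<Sum>i\<in>I. expectation (X i)) + x))"
  proof (rule indep_vars_exp_sum_nn_integral)
    show "indep_vars (\<lambda>_. borel) (\<lambda>i \<omega>. t * X i \<omega>) I"
      by (rule indep_vars_compose2[OF indep]) auto
    fix i assume i: "i \<in> I"
    have [measurable]: "X i \<in> borel_measurable M"
      using indep i by (auto simp: indep_vars_def)
    have int: "integrable M (X i)"
      using X[OF i] by (intro integrable_const_bound[where B=1]) auto
    have "exp (t * X i \<omega>) \<le> 1 + (t + t\<^sup>2) * X i \<omega>" if "\<omega> \<in> space M" for \<omega>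
    proof -
      have "exp (t * X i \<omega>) \<le> 1 + t * X i \<omega> + (t * X i \<omega>)\<^sup>2"
        using X[OF i that] t by (intro exp_bound mult_le_one) auto
      also have "(t * X i \<omega>)\<^sup>2 \<le> t\<^sup>2 * X i \<omega>"
        using X[OF i that] unfolding power_mult_distrib
        by (intro mult_left_mono) (auto simp: power2_eq_square mult_left_le)
      finally show ?thesis by (simp add: algebra_simps)
    qed
    then have "(\<integral>\<^sup>+\<omega>. ennreal (exp (t * X i \<omega>)) \<partial>M) \<le> (\<integral>\<^sup>+\<omega>. ennreal (1 + (t + t\<^sup>2) * X i \<omega>) \<partial>M)"
      by (intro nn_integral_mono) (auto intro!: ennreal_leI)
    also have "\<dots> = ennreal (\<integral>\<omega>. 1 + (t + t\<^sup>2) * X i \<omega> \<partial>M)"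
      using t int X[OF i] by (intro nn_integral_eq_integral AE_I2) auto
    also have "(\<integral>\<omega>. 1 + (t + t\<^sup>2) * X i \<omega> \<partial>M) = 1 + c i"
      using int by (simp add: c_def prob_space)
    also have "ennreal (1 + c i) \<le> ennreal (exp (c i))"
      by (intro ennreal_leI exp_ge_add_one_self)
    finally show "(\<integral>\<^sup>+\<omega>. ennreal (exp (t * X i \<omega>)) \<partial>M) \<le> ennreal (exp (c i))" .
  qed (fact assms(1))
  also have "(\<Sum>i\<in>I. c i) - t * ((\<Sum>i\<in>I. expectation (X i)) + x) \<le> t\<^sup>2 * v - t * x"
    using mult_left_mono[OF v, of "t\<^sup>2"] by (simp add: c_def sum_distrib_left[symmetric]) (simp add: algebra_simps)
  also have "{\<omega> \<in> space M. (\<Sum>i\<in>I. t * X i \<omega>) \<ge> t * ((\<Sum>i\<in>I. expectation (X i)) + x)}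
     = {\<omega> \<in> space M. (\<Sum>i\<in>I. X i \<omega>) \<ge> (\<Sum>i\<in>I. expectation (X i)) + x}"
    using t by (simp add: sum_distrib_left[symmetric])
  finally show ?thesis by simp
qed

lemma indep_vars_reindex_inj:
  assumes "indep_vars M' X (f ` I)" "inj_on f I"
  shows "indep_vars (\<lambda>i. M' (f i)) (\<lambda>i. X (f i)) I"
proof -
  have "indep_vars (\<lambda>i. PiM {f i} M') (\<lambda>i \<omega>. restrict (\<lambda>j. X j \<omega>) {f i}) I"
    using assms by (intro indep_vars_restrict[OF assms(1)]) (auto simp: disjoint_family_on_def inj_on_def)
  from indep_vars_compose2[OF this, of "\<lambda>i y. y (f i)" "\<lambda>i. M' (f i)"]
  show ?thesis by (simp add: measurable_component_singleton)
qed

end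

subsection \<open>Sample paths\<close>

lemma sum_int_telescope:
  fixes t :: "int \<Rightarrow> real"
  assumes "m \<le> n"
  shows "(\<Sum>i\<in>{m..<n}. t (i + 1) - t i) = t n - t m"
  using assms
proof (induction n rule: int_ge_induct)
  case (step i)
  then have "{m..<i + 1} = insert i {m..<i}" by auto
  with step show ?case by simp
qed simp

lemma sum_inverse_squares_le: "(\<Sum>d\<in>{m..n}. 1 / real d ^ 2) \<le> 2 / m" if "m > 0" for m n :: nat
proof (cases "m \<le> n")
  case True
  \<comment> \<open>The extra \<open>- 1 / n\<close> makes the induction telescope.\<close>
  then have "(\<Sum>d\<in>{m..n}. 1 / real d ^ 2) \<le> 2 / m - 1 / n"
    using that
  proof (induction n rule: dec_induct)
    case base
    then show ?case by (simp add: field_simps power2_eq_square)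
  next
    case (step n)
    have "1 / real (Suc n) ^ 2 \<le> 1 / (real n * real (Suc n))"
      using step unfolding power2_eq_square by (intro divide_left_mono mult_right_mono) auto
    also have "\<dots> = 1 / n - 1 / Suc n"
      using step by (simp add: field_simps)
    finally have "1 / real (Suc n) ^ 2 \<le> 1 / n - 1 / Suc n" .
    with step show ?case by simp
  qed
  also have "\<dots> \<le> 2 / m" by simp
  finally show ?thesis .
qed simp

lemma int_step_mono:
  fixes T :: "int \<Rightarrow> real"
  assumes "\<And>n. T n < T (n + 1)" and "m \<le> n"
  shows "T m \<le> T n"
  using assms(2) by (induction n rule: int_ge_induct) (use assms(1) in \<open>auto intro: less_imp_le order_trans\<close>)

lemma int_step_strict_mono:
  fixes T :: "int \<Rightarrow> real"
  assumes "\<And>n. T n < T (n + 1)" and "m < n"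
  shows "T m < T n"
  using assms(1)[of m] int_step_mono[of T "m + 1" n, OF assms(1)] assms(2) by simp

lemma tau_le_0: "tau C T S \<le> 0"
  unfolding tau_def by (rule Sup_least) auto

text \<open>The time \<open>T j\<close> is admissible: whoever is present then has left by
  \<open>T e\<close>, which is negative, so the maximal residual is below
  \<open>\<bar>T j\<bar>\<close>. Between arrivals the number present can only drop, hence the
  counts at the arrivals \<open>j\<close> to \<open>e\<close> control the whole interval. Customers
  before \<open>\<beta>\<close> have left by \<open>T j\<close> and need not be counted.\<close>

lemma tau_ge_arrival:
  fixes T S :: "int \<Rightarrow> real"
  assumes step: "\<And>n. T n < T (n + 1)" and T0: "T 0 \<le> 0"
    and ord: "\<beta> \<le> j" "j \<le> e" "e < 0"
    and old: "\<And>n. n < \<beta> \<Longrightarrow> T n + S n \<le> T j"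
    and mid: "\<And>n. \<beta> \<le> n \<Longrightarrow> n \<le> j \<Longrightarrow> T n + S n \<le> T e"
    and cnt: "\<And>k. j \<le> k \<Longrightarrow> k \<le> e \<Longrightarrow> real (card {n \<in> {\<beta>..k}. T k - T n < S n}) \<le> C"
  shows "ereal (T j) \<le> tau C T S"
  unfolding tau_def
proof (intro Sup_upper imageI CollectI conjI allI impI)
  note mono = int_step_mono[of T, OF step] and strict = int_step_strict_mono[of T, OF step]
  have je: "T j \<le> T e" and e0: "T e < 0"
    using mono[of j e] strict[of e 0] ord T0 by auto
  then show j0: "T j < 0" by simp
  have gone: "T n + S n \<le> T e" if "T n \<le> T j" for n
  proof (cases "n < \<beta>")
    case True then show ?thesis using old je by force
  next
    case False
    moreover have "n \<le> j" using strict[of j n] that by force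
    ultimately show ?thesis using mid by simp
  qed
  have R: "Rmax T S (T j) \<le> ereal (T e - T j)"
    unfolding Rmax_def using je gone by (intro Sup_least) auto
  also have "\<dots> < ereal \<bar>T j\<bar>"
    using j0 e0 by simp
  finally show "Rmax T S (T j) < ereal \<bar>T j\<bar>" .
  fix u assume u: "T j \<le> u \<and> ereal u \<le> ereal (T j) + Rmax T S (T j)"
  have "ereal u \<le> ereal (T j) + ereal (T e - T j)"
    using u add_left_mono[OF R] order_trans by blast
  then have ue: "u \<le> T e" by simp
  \<comment> \<open>The last arrival up to time \<open>u\<close>, searched among \<open>j..e\<close>
    only. If it is \<open>e\<close> itself, the next arrival is still later than \<open>u\<close>
    because \<open>u \<le> T e\<close>.\<close>
  obtain k where k: "j \<le> k" "k \<le> e" "T k \<le> u" "u < T (k + 1)"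
  proof -
    define k where "k = Max {k \<in> {j..e}. T k \<le> u}"
    have fin: "finite {k \<in> {j..e}. T k \<le> u}"
      by (rule finite_subset[of _ "{j..e}"]) auto
    have ne: "{k \<in> {j..e}. T k \<le> u} \<noteq> {}" using u ord by auto
    have k: "k \<in> {j..e}" "T k \<le> u"
      using Max_in[OF fin ne] by (auto simp: k_def)
    have "u < T (k + 1)"
    proof (rule ccontr)
      assume "\<not> u < T (k + 1)"
      moreover have "k + 1 \<le> e"
      proof (rule ccontr)
        assume "\<not> k + 1 \<le> e"
        with k have "k = e" by simp
        with calculation ue step[of e] show False by simp
      qed
      ultimately have "k + 1 \<in> {k \<in> {j..e}. T k \<le> u}" using k by simp
      from Max_ge[OF fin this] show False by (simp add: k_def)
    qed
    with k that show ?thesis by auto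
  qed
  define A where "A = {n. T n \<le> u \<and> T n + S n - u > 0}"
  have sub: "A \<subseteq> {n \<in> {\<beta>..k}. T k - T n < S n}"
  proof
    fix n assume n: "n \<in> A"
    have "n \<le> k"
      using strict[of "k + 1" n] mono[of "k + 1" n] n k by (force simp: A_def)
    moreover have "\<beta> \<le> n"
      using old[of n] n u by (force simp: A_def)
    ultimately show "n \<in> {n \<in> {\<beta>..k}. T k - T n < S n}"
      using n k by (auto simp: A_def)
  qed
  have fin': "finite {n \<in> {\<beta>..k}. T k - T n < S n}"
    by (rule finite_subset[of _ "{\<beta>..k}"]) auto
  with sub have fin: "finite A" by (rule finite_subset)
  have "real (card A) \<le> real (card {n \<in> {\<beta>..k}. T k - T n < S n})"
    using card_mono[OF fin' sub] by simp
  also have "\<dots> \<le> C" using cnt k by simp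
  finally show "ereal_of_enat (Qcount T S u 0) \<le> ereal C"
    using fin unfolding Qcount_def A_def[symmetric] Let_def by simp
qed

text \<open>Customer 0 is still in service at time 0. At a negative time \<open>t\<close> after
  \<open>T 0\<close> its residual service therefore exceeds \<open>\<bar>t\<bar>\<close>, which
  excludes \<open>t\<close>.\<close>

lemma tau_le_arrival_0:
  fixes T S :: "int \<Rightarrow> real"
  assumes "T 0 + S 0 > 0"
  shows "tau C T S \<le> ereal (T 0)"
  unfolding tau_def
proof (rule Sup_least, clarify)
  fix t assume t: "t < 0" "Rmax T S t < ereal \<bar>t\<bar>"
  have "t \<le> T 0"
  proof (rule ccontr)
    assume "\<not> t \<le> T 0"
    then have "ereal (T 0 + S 0 - t) \<le> Rmax T S t"
      unfolding Rmax_def using t assms by (intro Sup_upper) auto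
    also note t(2)
    finally show False using t assms by simp
  qed
  then show "ereal t \<le> ereal (T 0)" by simp
qed

subsection \<open>The stationary queue\<close>

locale GI_data =
  fixes DX DV :: "real measure"
  assumes DX: "sets DX = sets borel" "prob_space DX" "AE x in DX. x > 0" "integrable DX (\<lambda>x. x ^ 2)"
    and DV: "sets DV = sets borel" "prob_space DV" "AE v in DV. v \<ge> 0"
      "\<forall>q>0. integrable DV (\<lambda>v. v powr q)"
    and traffic: "integral\<^sup>L DV (\<lambda>v. v) / integral\<^sup>L DX (\<lambda>x. x) = 1"
begin

sublocale X: prob_space DX by (rule DX)
sublocale V: prob_space DV by (rule DV)

definition \<mu> where "\<mu> = integral\<^sup>L DX (\<lambda>x. x)"
definition m2 where "m2 = integral\<^sup>L DX (\<lambda>x. x\<^sup>2)"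
definition mv where "mv q = integral\<^sup>L DV (\<lambda>v. v ^ q)" for q :: nat

lemma X_measurable[measurable]: "(\<lambda>x. x) \<in> borel_measurable DX"
  using DX(1) by (simp cong: measurable_cong_sets)

lemma V_measurable[measurable]: "(\<lambda>x. x) \<in> borel_measurable DV"
  using DV(1) by (simp cong: measurable_cong_sets)

lemma X_integrable: "integrable DX (\<lambda>x. x)"
  by (rule X.square_integrable_imp_integrable[OF X_measurable DX(4)])

lemma mu_pos: "\<mu> > 0"
proof -
  have "\<mu> \<ge> 0"
    unfolding \<mu>_def using DX(3) by (intro integral_nonneg_AE) auto
  moreover have "\<mu> \<noteq> 0"
    using traffic by (auto simp: \<mu>_def)
  ultimately show ?thesis by simp
qed

lemma V_mean: "integral\<^sup>L DV (\<lambda>v. v) = \<mu>"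
  using traffic mu_pos by (simp add: \<mu>_def)

lemma V_moment: "integrable DV (\<lambda>v. v ^ q)"
proof (cases "q = 0")
  case False
  have int: "integrable DV (\<lambda>v. v powr real q)" using DV(4) False by simp
  have "AE v in DV. v powr real q = v ^ q"
    using DV(3) by eventually_elim (use False in \<open>auto simp: powr_realpow'\<close>)
  then show ?thesis
    by (rule integrable_cong_AE_imp[OF int borel_measurable_power[OF V_measurable]])
qed simp

lemma V_integrable: "integrable DV (\<lambda>v. v)"
  using V_moment[of 1] by simp

lemma mv_nonneg: "mv q \<ge> 0"
  unfolding mv_def
proof (rule integral_nonneg_AE)
  show "AE v in DV. 0 \<le> v ^ q"
    using DV(3) by eventually_elim (rule zero_le_power)
qed

lemma m2_pos: "m2 > 0"
proof -
  have "0 \<le> X.variance (\<lambda>x. x)"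
    by (rule X.variance_positive)
  also have "\<dots> = m2 - \<mu>\<^sup>2"
    unfolding \<mu>_def m2_def by (rule X.variance_eq[OF X_integrable DX(4)])
  finally have "\<mu>\<^sup>2 \<le> m2" by simp
  moreover have "0 < \<mu>\<^sup>2" using mu_pos by simp
  ultimately show ?thesis by linarith
qed

end

locale GI_queue = GI_data +
  fixes M :: "'a measure" and T S :: "int \<Rightarrow> 'a \<Rightarrow> real" and s :: real
  assumes s: "s \<ge> 1" and stationary: "stationary_GG_inf M T S s DX DV"
begin

sublocale prob_space M
  using stationary by (simp add: stationary_GG_inf_def)

lemma T_step: "\<omega> \<in> space M \<Longrightarrow> T n \<omega> < T (n + 1) \<omega>"
  and T_0: "\<omega> \<in> space M \<Longrightarrow> T 0 \<omega> \<le> 0"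
  and T_1: "\<omega> \<in> space M \<Longrightarrow> 0 < T 1 \<omega>"
  using stationary by (auto simp: stationary_GG_inf_def)

lemma T_mono: "\<omega> \<in> space M \<Longrightarrow> m \<le> n \<Longrightarrow> T m \<omega> \<le> T n \<omega>"
  using int_step_mono[of "\<lambda>n. T n \<omega>"] T_step by blast

definition W :: "ren_idx \<Rightarrow> 'a \<Rightarrow> real" where
  "W i \<omega> = (case i of Gap n \<Rightarrow> T (n + 1) \<omega> - T n \<omega> | Serv n \<Rightarrow> S n \<omega>
     | Len \<Rightarrow> T 1 \<omega> - T 0 \<omega> | Pos \<Rightarrow> (0 - T 0 \<omega>) / (T 1 \<omega> - T 0 \<omega>))"

lemma W_indep: "indep_vars (\<lambda>_. borel) W ({Gap n | n. n \<noteq> 0} \<union> range Serv \<union> {Len, Pos})"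
  and gap_distr: "n \<noteq> 0 \<Longrightarrow> distr M borel (\<lambda>\<omega>. T (n + 1) \<omega> - T n \<omega>) = distr DX borel (\<lambda>x. x / s)"
  and serv_distr: "distr M borel (S n) = DV"
  and len_distr: "distr M borel (\<lambda>\<omega>. T 1 \<omega> - T 0 \<omega>)
     = density (distr DX borel (\<lambda>x. x / s)) (\<lambda>x. ennreal (x / (\<mu> / s)))"
  and pos_distr: "distr M borel (\<lambda>\<omega>. (0 - T 0 \<omega>) / (T 1 \<omega> - T 0 \<omega>)) = uniform_measure lborel {0..1}"
proof -
  have W: "W = (\<lambda>i \<omega>. case i of Gap n \<Rightarrow> T (n + 1) \<omega> - T n \<omega> | Serv n \<Rightarrow> S n \<omega>
     | Len \<Rightarrow> T 1 \<omega> - T 0 \<omega> | Pos \<Rightarrow> (0 - T 0 \<omega>) / (T 1 \<omega> - T 0 \<omega>))"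
    by (simp add: fun_eq_iff W_def)
  have mean: "integral\<^sup>L (distr DX borel (\<lambda>x. x / s)) (\<lambda>x. x) = \<mu> / s"
    by (subst integral_distr) (auto simp: \<mu>_def)
  note st = stationary[unfolded stationary_GG_inf_def Let_def mean, folded W]
  show "indep_vars (\<lambda>_. borel) W ({Gap n | n. n \<noteq> 0} \<union> range Serv \<union> {Len, Pos})"
    using st by blast
  show "n \<noteq> 0 \<Longrightarrow> distr M borel (\<lambda>\<omega>. T (n + 1) \<omega> - T n \<omega>) = distr DX borel (\<lambda>x. x / s)"
    using st by (simp add: W)
  show "distr M borel (S n) = DV"
    using st by (simp add: W eta_contract_eq)
  show "distr M borel (\<lambda>\<omega>. T 1 \<omega> - T 0 \<omega>)
     = density (distr DX borel (\<lambda>x. x / s)) (\<lambda>x. ennreal (x / (\<mu> / s)))"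
    using st by (simp add: W)
  show "distr M borel (\<lambda>\<omega>. (0 - T 0 \<omega>) / (T 1 \<omega> - T 0 \<omega>)) = uniform_measure lborel {0..1}"
    using st by (simp add: W)
qed

text \<open>Services are recorded with a minus sign, so that the favourable events are increasing
  in every coordinate.\<close>
definition Y :: "ren_idx \<Rightarrow> 'a \<Rightarrow> real" where
  "Y i \<omega> = (case i of Gap n \<Rightarrow> T (n + 1) \<omega> - T n \<omega> | Serv n \<Rightarrow> - S n \<omega> | _ \<Rightarrow> 0)"

text \<open>Gaps are attached to their left customer, so the last gap index is \<open>n - 1\<close>.
  For \<open>n \<le> 0\<close> the set avoids \<open>Gap 0\<close>, the length-biased interval
  containing time 0: windows live in the i.i.d. past.\<close>

definition coords :: "int \<Rightarrow> int \<Rightarrow> ren_idx set" where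
  "coords m n = Gap ` {m..<n} \<union> Serv ` {m..n}"

lemma W_measurable: "i \<in> {Gap n | n. n \<noteq> 0} \<union> range Serv \<union> {Len, Pos} \<Longrightarrow> W i \<in> borel_measurable M"
  using W_indep unfolding indep_vars_def by (rule conjunct1[THEN bspec])

lemma gap_measurable: "n \<noteq> 0 \<Longrightarrow> (\<lambda>\<omega>. T (n + 1) \<omega> - T n \<omega>) \<in> borel_measurable M"
  using W_measurable[of "Gap n"] by (auto simp: W_def[abs_def])

lemma S_measurable[measurable]: "S n \<in> borel_measurable M"
  using W_measurable[of "Serv n"] by (auto simp: W_def[abs_def] eta_contract_eq)

lemma Len_measurable[measurable]: "(\<lambda>\<omega>. T 1 \<omega> - T 0 \<omega>) \<in> borel_measurable M"
  using W_measurable[of Len] by (auto simp: W_def[abs_def])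

lemma Y_indep:
  assumes "n \<le> 0"
  shows "indep_vars (\<lambda>_. borel) Y (coords m n)"
proof -
  have "indep_vars (\<lambda>_. borel) W (coords m n)"
    by (rule indep_vars_subset[OF W_indep]) (use assms in \<open>auto simp: coords_def\<close>)
  then have "indep_vars (\<lambda>_. borel) (\<lambda>i \<omega>. (case i of Serv n \<Rightarrow> uminus | _ \<Rightarrow> id) (W i \<omega>)) (coords m n)"
    by (rule indep_vars_compose2) (auto split: ren_idx.splits)
  also have "?this \<longleftrightarrow> indep_vars (\<lambda>_. borel) Y (coords m n)"
    by (rule indep_vars_cong) (auto simp: coords_def Y_def W_def fun_eq_iff)
  finally show ?thesis .
qed

lemma gap_moments:
  assumes "n \<noteq> 0"
  shows "integrable M (\<lambda>\<omega>. (T (n + 1) \<omega> - T n \<omega>)\<^sup>2)"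
    and "expectation (\<lambda>\<omega>. (T (n + 1) \<omega> - T n \<omega>)\<^sup>2) = m2 / s\<^sup>2"
    and "expectation (\<lambda>\<omega>. T (n + 1) \<omega> - T n \<omega>) = \<mu> / s"
proof -
  note [measurable] = gap_measurable[OF assms]
  have "integrable (distr M borel (\<lambda>\<omega>. T (n + 1) \<omega> - T n \<omega>)) (\<lambda>x. x\<^sup>2)"
    unfolding gap_distr[OF assms] using DX(4) by (subst integrable_distr_eq) (auto simp: power_divide)
  then show "integrable M (\<lambda>\<omega>. (T (n + 1) \<omega> - T n \<omega>)\<^sup>2)"
    by (subst (asm) integrable_distr_eq) auto
  have "expectation (\<lambda>\<omega>. (T (n + 1) \<omega> - T n \<omega>)\<^sup>2)
      = (\<integral>x. x\<^sup>2 \<partial>distr M borel (\<lambda>\<omega>. T (n + 1) \<omega> - T n \<omega>))"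
    by (subst integral_distr) auto
  also have "\<dots> = m2 / s\<^sup>2"
    unfolding gap_distr[OF assms] by (subst integral_distr) (auto simp: power_divide m2_def)
  finally show "expectation (\<lambda>\<omega>. (T (n + 1) \<omega> - T n \<omega>)\<^sup>2) = m2 / s\<^sup>2" .
  have "expectation (\<lambda>\<omega>. T (n + 1) \<omega> - T n \<omega>)
      = (\<integral>x. x \<partial>distr M borel (\<lambda>\<omega>. T (n + 1) \<omega> - T n \<omega>))"
    by (subst integral_distr) auto
  also have "\<dots> = \<mu> / s"
    unfolding gap_distr[OF assms] by (subst integral_distr) (auto simp: \<mu>_def)
  finally show "expectation (\<lambda>\<omega>. T (n + 1) \<omega> - T n \<omega>) = \<mu> / s" .
qed

lemma T_diff_lower_tail:
  assumes "m < n" "n \<le> 0" "0 \<le> x"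
  shows "prob {\<omega> \<in> space M. T n \<omega> - T m \<omega> \<le> of_int (n - m) * \<mu> / s - x}
           \<le> exp (- (x\<^sup>2 * s\<^sup>2 / (2 * of_int (n - m) * m2)))"
proof -
  have W: "W (Gap i) = (\<lambda>\<omega>. T (i + 1) \<omega> - T i \<omega>)" for i
    by (simp add: fun_eq_iff W_def)
  have sum_Gap: "(\<Sum>i\<in>Gap ` {m..<n}. f i) = (\<Sum>i\<in>{m..<n}. f (Gap i))" for f :: "_ \<Rightarrow> real"
    by (subst sum.reindex) (auto simp: inj_on_def)
  have "prob {\<omega> \<in> space M. (\<Sum>i\<in>Gap ` {m..<n}. W i \<omega>)
        \<le> (\<Sum>i\<in>Gap ` {m..<n}. expectation (W i)) - x}
     \<le> exp (- x\<^sup>2 / (2 * (of_int (n - m) * m2 / s\<^sup>2)))"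
  proof (rule sum_lower_tail)
    show "indep_vars (\<lambda>_. borel) W (Gap ` {m..<n})"
      by (rule indep_vars_subset[OF W_indep]) (use assms in auto)
    show "0 \<le> W i \<omega>" if "i \<in> Gap ` {m..<n}" "\<omega> \<in> space M" for i \<omega>
      using T_step[OF that(2)] that(1) by (auto simp: W less_imp_le)
    show "integrable M (\<lambda>\<omega>. (W i \<omega>)\<^sup>2)" if "i \<in> Gap ` {m..<n}" for i
      using that assms gap_moments(1) by (auto simp: W)
    have "(\<Sum>i\<in>{m..<n}. expectation (\<lambda>\<omega>. (T (i + 1) \<omega> - T i \<omega>)\<^sup>2)) = (\<Sum>i\<in>{m..<n}. m2 / s\<^sup>2)"
      using assms by (intro sum.cong gap_moments(2)) auto
    then show "(\<Sum>i\<in>Gap ` {m..<n}. expectation (\<lambda>\<omega>. (W i \<omega>)\<^sup>2)) \<le> of_int (n - m) * m2 / s\<^sup>2"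
      using assms by (simp add: sum_Gap W)
    show "0 < of_int (n - m) * m2 / s\<^sup>2"
      using assms m2_pos s by simp
  qed (use assms in auto)
  then have "prob {\<omega> \<in> space M. (\<Sum>i\<in>{m..<n}. T (i + 1) \<omega> - T i \<omega>)
        \<le> (\<Sum>i\<in>{m..<n}. expectation (\<lambda>\<omega>. T (i + 1) \<omega> - T i \<omega>)) - x}
     \<le> exp (- x\<^sup>2 / (2 * (of_int (n - m) * m2 / s\<^sup>2)))"
    by (simp only: sum_Gap W)
  also have "(\<Sum>i\<in>{m..<n}. expectation (\<lambda>\<omega>. T (i + 1) \<omega> - T i \<omega>)) = (\<Sum>i\<in>{m..<n}. \<mu> / s)"
    using assms by (intro sum.cong gap_moments(3)) auto
  also have "\<dots> = of_int (n - m) * \<mu> / s"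
    using assms by simp
  finally show ?thesis
    using assms by (simp add: sum_int_telescope[of m n "\<lambda>i. T i _"] mult.assoc del: of_int_diff)
qed

lemma S_prob:
  assumes "A \<in> sets borel"
  shows "prob {\<omega> \<in> space M. S n \<omega> \<in> A} = measure DV A"
proof -
  have "measure DV A = measure (distr M borel (S n)) A"
    by (simp add: serv_distr)
  also have "\<dots> = prob {\<omega> \<in> space M. S n \<omega> \<in> A}"
    using assms by (subst measure_distr) (auto intro!: arg_cong[where f=prob])
  finally show ?thesis by simp
qed

lemma S_tail:
  assumes "0 < x"
  shows "prob {\<omega> \<in> space M. \<not> S n \<omega> \<le> x} \<le> mv q / x ^ q"
proof -
  have "prob {\<omega> \<in> space M. \<not> S n \<omega> \<le> x} = measure DV {x<..}"
    using S_prob[of "{x<..}" n] by (simp add: not_le)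
  also have "\<dots> \<le> measure DV {v \<in> space DV. v ^ q \<ge> x ^ q}"
  proof (rule V.finite_measure_mono)
    show "{v \<in> space DV. v ^ q \<ge> x ^ q} \<in> V.events" by measurable
    show "{x<..} \<subseteq> {v \<in> space DV. v ^ q \<ge> x ^ q}"
      using assms sets_eq_imp_space_eq[OF DV(1)] by (auto intro!: power_mono)
  qed
  also have "\<dots> \<le> mv q / x ^ q"
    unfolding mv_def using V_moment[of q] DV(3) assms
    by (intro integral_Markov_inequality_measure[of _ _ "{}"]) auto
  finally show ?thesis .
qed

end

subsection \<open>Arrival tubes and customer counts\<close>

text \<open>Events are written as predicates of an abstract coordinate vector, the form Harris'
  inequality acts on. At \<open>Y\<close> this functional is \<open>T n - T m\<close>, for
  \<open>m \<le> n\<close>.\<close>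

definition elapsed :: "(ren_idx \<Rightarrow> real) \<Rightarrow> int \<Rightarrow> int \<Rightarrow> real" where
  "elapsed y m n = (\<Sum>i\<in>{m..<n}. y (Gap i))"

lemma increasing_event_const: "increasing_event I (\<lambda>_. P)"
  by (auto simp: increasing_event_def)

lemma increasing_event_imp:
  "(P \<Longrightarrow> increasing_event I Q) \<Longrightarrow> increasing_event I (\<lambda>y. P \<longrightarrow> Q y)"
  by (cases P) (auto simp: increasing_event_const)

lemma increasing_event_elapsed:
  assumes "Gap ` {m..<n} \<subseteq> I"
  shows "increasing_event I (\<lambda>y. c \<le> elapsed y m n)"
  unfolding increasing_event_def
proof (intro conjI allI impI)
  have [measurable]: "(\<lambda>y. elapsed y m n) \<in> borel_measurable (PiM I (\<lambda>_. borel))"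
    unfolding elapsed_def using assms
    by (intro borel_measurable_sum measurable_component_singleton) auto
  show "{y \<in> space (PiM I (\<lambda>_. borel)). c \<le> elapsed y m n} \<in> sets (PiM I (\<lambda>_. borel))"
    by measurable
  fix x y :: "ren_idx \<Rightarrow> real" assume "c \<le> elapsed x m n" "\<forall>i\<in>I. x i \<le> y i"
  then show "c \<le> elapsed y m n"
    unfolding elapsed_def using assms by (elim order_trans) (auto intro!: sum_mono)
qed

lemma increasing_event_serv:
  assumes "Serv n \<in> I"
  shows "increasing_event I (\<lambda>y. - y (Serv n) \<le> c)"
  unfolding increasing_event_def
proof (intro conjI allI impI)
  have [measurable]: "(\<lambda>y. y (Serv n)) \<in> borel_measurable (PiM I (\<lambda>_. borel :: real measure))"
    using assms by (intro measurable_component_singleton)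
  show "{y \<in> space (PiM I (\<lambda>_. borel)). - y (Serv n) \<le> c} \<in> sets (PiM I (\<lambda>_. borel))"
    by measurable
qed (use assms in force)

lemma increasing_event_count:
  fixes c :: "int \<Rightarrow> real"
  assumes "Serv ` A \<subseteq> I"
  shows "increasing_event I (\<lambda>y. (\<Sum>n\<in>A. if c n < - y (Serv n) then 1 else 0 :: real) \<le> C)"
  unfolding increasing_event_def
proof (intro conjI allI impI)
  have [measurable]: "(\<lambda>y. y (Serv n)) \<in> borel_measurable (PiM I (\<lambda>_. borel :: real measure))" if "n \<in> A" for n
    using assms that by (intro measurable_component_singleton) auto
  show "{y \<in> space (PiM I (\<lambda>_. borel)). (\<Sum>n\<in>A. if c n < - y (Serv n) then 1 else 0) \<le> C} \<in> sets (PiM I (\<lambda>_. borel))"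
    by measurable
  fix x y :: "ren_idx \<Rightarrow> real"
  assume "(\<Sum>n\<in>A. if c n < - x (Serv n) then 1 else 0) \<le> C" and le: "\<forall>i\<in>I. x i \<le> y i"
  moreover have "(\<Sum>n\<in>A. if c n < - y (Serv n) then 1 else 0) \<le> (\<Sum>n\<in>A. if c n < - x (Serv n) then 1 else 0 :: real)"
    using le assms by (intro sum_mono) force
  ultimately show "(\<Sum>n\<in>A. if c n < - y (Serv n) then 1 else 0) \<le> C" by simp
qed

text \<open>Cut the stretch from \<open>m\<close> to \<open>n\<close> at the first block boundary
  after \<open>m\<close> and the last one before \<open>n\<close>. The two end pieces lie inside
  blocks and the middle one joins two boundaries; each loses \<open>\<eta>\<close>, which explains
  \<open>3 * \<eta>\<close>. Control of all pairs of customers is thus reduced to pairs of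
  boundaries and pairs within one block.\<close>

lemma block_tube:
  fixes t :: "int \<Rightarrow> real" and L G :: nat and \<beta> :: int
  defines "p \<equiv> \<lambda>k. \<beta> + int (k * L)"
  assumes L: "L > 0" and h: "h \<ge> 0" "0 \<le> \<eta>"
    and A: "\<And>k l. k < l \<Longrightarrow> l \<le> G \<Longrightarrow> t (p l) - t (p k) \<ge> of_int (p l - p k) * h * (1 - \<eta>) - \<eta>"
    and B: "\<And>k m n. k < G \<Longrightarrow> p k \<le> m \<Longrightarrow> m \<le> n \<Longrightarrow> n \<le> p (k + 1) \<Longrightarrow> t n - t m \<ge> of_int (n - m) * h - \<eta>"
    and mn: "\<beta> \<le> m" "m \<le> n" "n \<le> p G"
  shows "t n - t m \<ge> of_int (n - m) * h * (1 - \<eta>) - 3 * \<eta>"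
proof (cases "m = n")
  case True
  then show ?thesis using h by simp
next
  case False
  have p_mono: "p k \<le> p l" if "k \<le> l" for k l
    using that by (auto simp: p_def intro!: mult_right_mono)
  have block: "p (nat ((x - \<beta>) div int L)) \<le> x \<and> x < p (nat ((x - \<beta>) div int L) + 1)" if "\<beta> \<le> x" for x
  proof -
    have q: "int (nat ((x - \<beta>) div int L)) = (x - \<beta>) div int L"
      using that L by (simp add: pos_imp_zdiv_nonneg_iff)
    have "p (nat ((x - \<beta>) div int L)) = x - (x - \<beta>) mod int L"
      "p (nat ((x - \<beta>) div int L) + 1) = x - (x - \<beta>) mod int L + int L"
      unfolding p_def of_nat_mult of_nat_add of_nat_1 q
      by (simp_all add: distrib_right flip: minus_mod_eq_div_mult)
    with pos_mod_bound[of "int L" "x - \<beta>"] pos_mod_sign[of "int L" "x - \<beta>"] L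
    show ?thesis by simp
  qed
  define k where "k = nat ((m - \<beta>) div int L)"
  \<comment> \<open>Using \<open>n - 1\<close> puts \<open>n\<close> into the half-open block with
    its right end included, so that \<open>n = p G\<close> still yields
    \<open>l < G\<close>.\<close>
  define l where "l = nat ((n - 1 - \<beta>) div int L)"
  have km: "p k \<le> m" "m < p (k + 1)"
    using block[of m] mn by (simp_all add: k_def)
  have ln: "p l \<le> n - 1" "n - 1 < p (l + 1)"
    using block[of "n - 1"] mn False by (simp_all add: l_def)
  have kl: "k \<le> l"
    unfolding k_def l_def using False mn L by (intro nat_mono zdiv_mono1) auto
  have "p l < p G" using ln mn by simp
  then have lG: "l < G" using p_mono[of G l] by force
  have shrink: "of_int x * h \<ge> of_int x * h * (1 - \<eta>)" if "0 \<le> x" for x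
    using that h by (simp add: mult_left_le algebra_simps)
  show ?thesis
  proof (cases "k = l")
    case True
    then have "t n - t m \<ge> of_int (n - m) * h - \<eta>"
      using B[of k m n] km ln lG mn by simp
    then show ?thesis using shrink[of "n - m"] mn h by simp
  next
    case False
    with kl have k1: "k + 1 \<le> l" by simp
    have 1: "t (p (k + 1)) - t m \<ge> of_int (p (k + 1) - m) * h * (1 - \<eta>) - \<eta>"
    proof -
      have "t (p (k + 1)) - t m \<ge> of_int (p (k + 1) - m) * h - \<eta>"
        by (rule B) (use km lG kl in auto)
      moreover have "of_int (p (k + 1) - m) * h \<ge> of_int (p (k + 1) - m) * h * (1 - \<eta>)"
        by (rule shrink) (use km in simp)
      ultimately show ?thesis by linarith
    qed
    have 2: "t (p l) - t (p (k + 1)) \<ge> of_int (p l - p (k + 1)) * h * (1 - \<eta>) - \<eta>"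
      using A[of "k + 1" l] k1 lG h by (cases "k + 1 = l") auto
    have 3: "t n - t (p l) \<ge> of_int (n - p l) * h * (1 - \<eta>) - \<eta>"
    proof -
      have "t n - t (p l) \<ge> of_int (n - p l) * h - \<eta>"
        by (rule B) (use ln lG in auto)
      moreover have "of_int (n - p l) * h \<ge> of_int (n - p l) * h * (1 - \<eta>)"
        by (rule shrink) (use ln in simp)
      ultimately show ?thesis by linarith
    qed
    have "of_int (n - m) * h * (1 - \<eta>) = of_int (p (k + 1) - m) * h * (1 - \<eta>)
       + of_int (p l - p (k + 1)) * h * (1 - \<eta>) + of_int (n - p l) * h * (1 - \<eta>)"
      by (simp add: algebra_simps)
    with 1 2 3 show ?thesis by linarith
  qed
qed

context GI_queue
begin

definition h where "h = \<mu> / s"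

lemma h_pos: "h > 0"
  using mu_pos s by (simp add: h_def)

lemma elapsed_Y: "m \<le> n \<Longrightarrow> elapsed (\<lambda>i. Y i \<omega>) m n = T n \<omega> - T m \<omega>"
  using sum_int_telescope[of m n "\<lambda>i. T i \<omega>"] by (simp add: elapsed_def Y_def)

lemma serv_Y: "- Y (Serv n) \<omega> = S n \<omega>"
  by (simp add: Y_def)

lemma T_diff_measurable:
  assumes "m \<le> n" "n \<le> 0"
  shows "(\<lambda>\<omega>. T n \<omega> - T m \<omega>) \<in> borel_measurable M"
proof -
  have "(\<lambda>\<omega>. \<Sum>i\<in>{m..<n}. T (i + 1) \<omega> - T i \<omega>) \<in> borel_measurable M"
    using assms by (intro borel_measurable_sum gap_measurable) auto
  also have "(\<lambda>\<omega>. \<Sum>i\<in>{m..<n}. T (i + 1) \<omega> - T i \<omega>) = (\<lambda>\<omega>. T n \<omega> - T m \<omega>)"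
    by (rule ext) (rule sum_int_telescope[OF assms(1)])
  finally show ?thesis .
qed

text \<open>The two bounds together say that customer \<open>\<beta> - d\<close> leaves no later
  than \<open>2 * z\<close> after \<open>T \<beta>\<close>. The mean time between the arrivals of
  \<open>\<beta> - d\<close> and \<open>\<beta>\<close> is \<open>d * h\<close>; splitting at half
  of it makes either failure a large deviation.\<close>

definition old_gone :: "real \<Rightarrow> int \<Rightarrow> nat \<Rightarrow> (ren_idx \<Rightarrow> real) \<Rightarrow> bool" where
  "old_gone z \<beta> d y \<longleftrightarrow> d * h / 2 - z \<le> elapsed y (\<beta> - int d) \<beta> \<and> - y (Serv (\<beta> - int d)) \<le> d * h / 2 + z"

lemma old_gone_event:
  assumes "\<beta> \<le> 0"
  shows "{\<omega> \<in> space M. \<not> old_gone z \<beta> d (\<lambda>i. Y i \<omega>)} \<in> events"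
proof -
  have [measurable]: "(\<lambda>\<omega>. T \<beta> \<omega> - T (\<beta> - int d) \<omega>) \<in> borel_measurable M"
    using assms by (intro T_diff_measurable) auto
  show ?thesis
    unfolding old_gone_def by (simp add: elapsed_Y serv_Y)
qed

lemma old_gone_prob:
  assumes "\<beta> \<le> 0" "d > 0" "z \<ge> 0"
  shows "prob {\<omega> \<in> space M. \<not> old_gone z \<beta> d (\<lambda>i. Y i \<omega>)}
     \<le> exp (- ((d * h / 2 + z)\<^sup>2 * s\<^sup>2 / (2 * d * m2))) + mv q / (d * h / 2 + z) ^ q"
proof -
  have [measurable]: "(\<lambda>\<omega>. T \<beta> \<omega> - T (\<beta> - int d) \<omega>) \<in> borel_measurable M"
    using assms by (intro T_diff_measurable) auto
  let ?A = "{\<omega> \<in> space M. T \<beta> \<omega> - T (\<beta> - int d) \<omega> \<le> of_int (\<beta> - (\<beta> - int d)) * \<mu> / s - (d * h / 2 + z)}"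
  let ?B = "{\<omega> \<in> space M. \<not> S (\<beta> - int d) \<omega> \<le> d * h / 2 + z}"
  have AB: "?A \<in> events" "?B \<in> events" by measurable
  have "prob {\<omega> \<in> space M. \<not> old_gone z \<beta> d (\<lambda>i. Y i \<omega>)} \<le> prob (?A \<union> ?B)"
    by (rule finite_measure_mono[OF _ sets.Un[OF AB]])
      (auto simp: old_gone_def elapsed_Y serv_Y not_le h_def field_simps)
  also have "\<dots> \<le> prob ?A + prob ?B"
    by (rule measure_Un_le[OF AB])
  also have "\<dots> \<le> exp (- ((d * h / 2 + z)\<^sup>2 * s\<^sup>2 / (2 * of_int (\<beta> - (\<beta> - int d)) * m2))) + mv q / (d * h / 2 + z) ^ q"
    using assms h_pos by (intro add_mono T_diff_lower_tail S_tail add_pos_nonneg) auto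
  finally show ?thesis by simp
qed

text \<open>Exchange sum and integral: for a service of length \<open>v\<close>, the ages at which
  it still exceeds the tube number at most \<open>(v + 3 * \<eta>) / (h * (1 - \<eta>)) + 1\<close>.
  Integrating uses that the mean service is \<open>\<mu>\<close>, by the traffic condition. As
  \<open>h = \<mu> / s\<close>, the leading term is \<open>s\<close>.\<close>

lemma mean_count:
  assumes \<eta>: "0 \<le> \<eta>" "\<eta> < 1"
  shows "(\<Sum>n\<in>{\<beta>..j}. prob {\<omega> \<in> space M. of_int (j - n) * h * (1 - \<eta>) - 3 * \<eta> < S n \<omega>})
     \<le> (\<mu> + 3 * \<eta>) / (h * (1 - \<eta>)) + 1"
proof -
  define g where "g d = of_int d * h * (1 - \<eta>) - 3 * \<eta>" for d :: int
  have h': "h * (1 - \<eta>) > 0" using h_pos \<eta> by simp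
  have "(\<Sum>n\<in>{\<beta>..j}. prob {\<omega> \<in> space M. g (j - n) < S n \<omega>}) = (\<Sum>n\<in>{\<beta>..j}. measure DV {g (j - n)<..})"
    using S_prob[of "{_<..}"] by (intro sum.cong) auto
  also have "\<dots> = (\<Sum>n\<in>{\<beta>..j}. \<integral>v. indicator {g (j - n)<..} v \<partial>DV)"
    using sets_eq_imp_space_eq[OF DV(1)] by (intro sum.cong) auto
  also have "\<dots> = (\<integral>v. (\<Sum>n\<in>{\<beta>..j}. indicator {g (j - n)<..} v) \<partial>DV)"
    using DV(1) by (intro Bochner_Integration.integral_sum[symmetric])
       (auto intro!: integrable_real_indicator simp: less_top[symmetric])
  also have "\<dots> \<le> (\<integral>v. (v + 3 * \<eta>) / (h * (1 - \<eta>)) + 1 \<partial>DV)"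
  proof (rule integral_mono_AE)
    show "integrable DV (\<lambda>v. \<Sum>n\<in>{\<beta>..j}. indicat_real {g (j - n)<..} v)"
      using DV(1) by (intro Bochner_Integration.integrable_sum integrable_real_indicator) (auto simp: less_top[symmetric])
    show "integrable DV (\<lambda>v. (v + 3 * \<eta>) / (h * (1 - \<eta>)) + 1)"
      using V_integrable by simp
    show "AE v in DV. (\<Sum>n\<in>{\<beta>..j}. indicator {g (j - n)<..} v) \<le> (v + 3 * \<eta>) / (h * (1 - \<eta>)) + 1"
      using DV(3)
    proof eventually_elim
      fix v :: real assume v: "0 \<le> v"
      \<comment> \<open>The age, measured in customers, at which the tube reaches the level
        \<open>v\<close>.\<close>
      define y where "y = (v + 3 * \<eta>) / (h * (1 - \<eta>))"
      have y: "0 \<le> y" using v \<eta> h' by (simp add: y_def)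
      have "(\<Sum>n\<in>{\<beta>..j}. indicat_real {g (j - n)<..} v) = real (card ({\<beta>..j} \<inter> {n. g (j - n) < v}))"
        by (simp add: indicator_def sum.If_cases)
      also have "\<dots> \<le> real (card {j - \<lceil>y\<rceil> + 1..j})"
      proof -
        have "n \<in> {j - \<lceil>y\<rceil> + 1..j}" if "n \<in> {\<beta>..j}" "g (j - n) < v" for n
        proof -
          have "of_int (j - n) < y"
            using that(2) h' by (simp add: y_def g_def pos_less_divide_eq mult.assoc)
          then have "j - n < \<lceil>y\<rceil>" by linarith
          with that show ?thesis by simp
        qed
        then show ?thesis by (intro of_nat_mono card_mono) auto
      qed
      also have "\<dots> \<le> y + 1" using y by simp
      finally show "(\<Sum>n\<in>{\<beta>..j}. indicator {g (j - n)<..} v) \<le> (v + 3 * \<eta>) / (h * (1 - \<eta>)) + 1"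
        by (simp add: y_def)
    qed
  qed
  also have "\<dots> = (\<mu> + 3 * \<eta>) / (h * (1 - \<eta>)) + 1"
    using V_integrable by (simp add: V_mean V.prob_space)
  finally show ?thesis by (simp add: g_def)
qed

end

subsection \<open>A favourable window\<close>

text \<open>A window consists of \<open>2 * a\<^sup>2\<close> blocks of L customers; the candidate for \<open>\<tau>\<close> is the arrival in its
  middle. The tube has width \<open>\<eta>\<close>, and C is the number of servers.\<close>
locale window = GI_queue +
  fixes a L q :: nat and \<eta> C :: real
  assumes L_pos: "L > 0" and a_pos: "a > 0" and span: "s \<le> a * L"
    and eta: "0 < \<eta>" "\<eta> \<le> 1 / 2" "12 * \<eta> \<le> a * \<mu>"
    and grid_tube: "exp (- (2 * \<eta>\<^sup>2 * \<mu> * s / m2)) \<le> 1 / 2"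
    and block_tube_prob: "(L + 1)\<^sup>2 * exp (- (\<eta>\<^sup>2 * s\<^sup>2 / (2 * L * m2))) \<le> 1 / 2"
    and block_count_prob: "(L + 1) * exp (- (s / (2 * L))) \<le> 1 / 4"
    and mean_le: "(\<mu> + 3 * \<eta>) / (\<mu> / s * (1 - \<eta>)) + 1 \<le> 2 * s"
    and capacity: "(\<mu> + 3 * \<eta>) / (\<mu> / s * (1 - \<eta>)) + 1 + 5 * sqrt s \<le> C"
    and short: "(2 * a\<^sup>2 * L + 1) * (mv q / (a * \<mu> / 4) ^ q) \<le> 1 / 2"
    and old: "\<And>d. d > 0 \<Longrightarrow> exp (- ((real d * (\<mu> / s) / 2 + a * \<mu> / 8)\<^sup>2 * s\<^sup>2 / (2 * d * m2)))
        + mv q / (d * (\<mu> / s) / 2 + a * \<mu> / 8) ^ q \<le> 1 / (8 * real d ^ 12)"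
begin

definition p :: "int \<Rightarrow> nat \<Rightarrow> int" where "p \<beta> k = \<beta> + int (k * L)"

text \<open>Since \<open>a\<close> blocks hold at least \<open>s\<close> customers, they last at
  least \<open>\<mu>\<close> on average, and \<open>a^2\<close> blocks last at least
  \<open>a * \<mu>\<close>. Of the two halves of the window, the first gives old customers time to
  leave and the second does the same for those of the first.\<close>

abbreviation G :: nat where "G \<equiv> 2 * a\<^sup>2"

text \<open>A lower bound for the time that \<open>d\<close> successive interarrivals take, in the
  form that results from chaining blocks and grid.\<close>

definition tube :: "int \<Rightarrow> real" where "tube d = of_int d * h * (1 - \<eta>) - 3 * \<eta>"

definition grid_ok :: "int \<Rightarrow> nat \<times> nat \<Rightarrow> (ren_idx \<Rightarrow> real) \<Rightarrow> bool" where
  "grid_ok \<beta> kl y \<longleftrightarrow> (case kl of (k, l) \<Rightarrow> k < l \<longrightarrow>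
     of_int (p \<beta> l - p \<beta> k) * h * (1 - \<eta>) - \<eta> \<le> elapsed y (p \<beta> k) (p \<beta> l))"

definition block_ok :: "int \<Rightarrow> nat \<Rightarrow> (ren_idx \<Rightarrow> real) \<Rightarrow> bool" where
  "block_ok \<beta> k y \<longleftrightarrow> (\<forall>(m, n)\<in>{p \<beta> k..p \<beta> (k + 1)} \<times> {p \<beta> k..p \<beta> (k + 1)}.
     m < n \<longrightarrow> of_int (n - m) * h - \<eta> \<le> elapsed y m n)"

text \<open>Services are compared with the tube instead of the true ages, so this depends on
  services only. Where the tube bound holds, it dominates the number of customers from
  \<open>\<beta>\<close> on who are present when \<open>j\<close> arrives.\<close>

definition count :: "int \<Rightarrow> int \<Rightarrow> (ren_idx \<Rightarrow> real) \<Rightarrow> real" where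
  "count \<beta> j y = (\<Sum>n\<in>{\<beta>..j}. if tube (j - n) < - y (Serv n) then 1 else 0)"

definition count_ok :: "int \<Rightarrow> nat \<Rightarrow> (ren_idx \<Rightarrow> real) \<Rightarrow> bool" where
  "count_ok \<beta> k y \<longleftrightarrow> (\<forall>j\<in>{p \<beta> k..p \<beta> (k + 1)}. count \<beta> j y \<le> C)"

definition short_ok :: "int \<Rightarrow> (ren_idx \<Rightarrow> real) \<Rightarrow> bool" where
  "short_ok \<beta> y \<longleftrightarrow> (\<forall>n\<in>{\<beta>..p \<beta> G}. - y (Serv n) \<le> a * \<mu> / 4)"

text \<open>Only \<open>r\<close> old customers are inspected, so that success reads finitely many
  coordinates and distant windows can be independent. Older customers are left to a union
  bound.\<close>

definition old_ok :: "int \<Rightarrow> nat \<Rightarrow> (ren_idx \<Rightarrow> real) \<Rightarrow> bool" where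
  "old_ok \<beta> r y \<longleftrightarrow> (\<forall>d\<in>{1..r}. old_gone (a * \<mu> / 8) \<beta> d y)"

definition success :: "int \<Rightarrow> nat \<Rightarrow> (ren_idx \<Rightarrow> real) \<Rightarrow> bool" where
  "success \<beta> r y \<longleftrightarrow> (\<forall>kl\<in>{..G} \<times> {..G}. grid_ok \<beta> kl y) \<and> (\<forall>k\<in>{..<G}. block_ok \<beta> k y) \<and>
     (\<forall>k\<in>{..<G}. count_ok \<beta> k y) \<and> short_ok \<beta> y \<and> old_ok \<beta> r y"

section \<open>Monotonicity and probability of the window events\<close>

lemma p_mono: "k \<le> l \<Longrightarrow> p \<beta> k \<le> p \<beta> l"
  by (auto simp: p_def intro!: mult_right_mono)

lemma p_ge: "\<beta> \<le> p \<beta> k"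
  by (simp add: p_def)

lemma increasing_grid_ok:
  assumes "k \<le> G" "l \<le> G"
  shows "increasing_event (coords (\<beta> - int r) (p \<beta> G)) (grid_ok \<beta> (k, l))"
  unfolding grid_ok_def prod.case
  by (intro increasing_event_imp increasing_event_elapsed)
    (use p_mono[OF assms(2), of \<beta>] p_ge[of \<beta> k] in \<open>auto simp: coords_def\<close>)

lemma increasing_block_ok:
  assumes "k < G"
  shows "increasing_event (coords (\<beta> - int r) (p \<beta> G)) (block_ok \<beta> k)"
  unfolding block_ok_def split_beta
  by (intro increasing_event_ball increasing_event_imp increasing_event_elapsed)
    (use p_mono[of "k + 1" G \<beta>] p_ge[of \<beta> k] assms in \<open>auto simp: coords_def\<close>)

lemma increasing_count_ok:
  assumes "k < G"
  shows "increasing_event (coords (\<beta> - int r) (p \<beta> G)) (count_ok \<beta> k)"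
  unfolding count_ok_def count_def
  by (intro increasing_event_ball increasing_event_count)
    (use p_mono[of "k + 1" G \<beta>] p_ge[of \<beta> k] assms in \<open>auto simp: coords_def\<close>)

lemma increasing_short_ok: "increasing_event (coords (\<beta> - int r) (p \<beta> G)) (short_ok \<beta>)"
  unfolding short_ok_def
  by (intro increasing_event_ball increasing_event_serv) (auto simp: coords_def)

lemma increasing_old_ok: "increasing_event (coords (\<beta> - int r) (p \<beta> G)) (old_ok \<beta> r)"
  unfolding old_ok_def old_gone_def using p_ge[of \<beta> G]
  by (intro increasing_event_ball increasing_event_conj increasing_event_elapsed increasing_event_serv)
    (auto simp: coords_def)

lemma increasing_success: "increasing_event (coords (\<beta> - int r) (p \<beta> G)) (success \<beta> r)"
  unfolding success_def
  by (intro increasing_event_conj increasing_event_ball increasing_short_ok increasing_old_ok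
    increasing_count_ok increasing_block_ok) (auto intro: increasing_grid_ok)

text \<open>The tolerated loss is \<open>\<eta> * (d * h + 1)\<close>: the relative part serves
  distant boundaries, the absolute part near ones. Because \<open>(d * h + 1)^2\<close> is at least
  \<open>4 * d * h\<close>, the exponent is bounded below independently of the distance
  \<open>d\<close>.\<close>

lemma grid_ok_prob:
  assumes neg: "p \<beta> G \<le> 0" and kl: "kl \<in> {..G} \<times> {..G}"
  shows "prob {\<omega> \<in> space M. grid_ok \<beta> kl (\<lambda>i. Y i \<omega>)} \<ge> 1 / 2"
proof -
  obtain k l where [simp]: "kl = (k, l)" by (cases kl)
  show ?thesis
  proof (cases "k < l")
    case False
    then show ?thesis by (simp add: grid_ok_def prob_space)
  next
    case True
    define d where "d = p \<beta> l - p \<beta> k"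
    have d: "d > 0" using True L_pos by (simp add: d_def p_def)
    have le0: "p \<beta> l \<le> 0" using p_mono[of l G \<beta>] kl neg by simp
    have dm: "p \<beta> k < p \<beta> l" using d by (simp add: d_def)
    have [measurable]: "(\<lambda>\<omega>. T (p \<beta> l) \<omega> - T (p \<beta> k) \<omega>) \<in> borel_measurable M"
      using dm le0 by (intro T_diff_measurable) auto
    define x where "x = \<eta> * (of_int d * h + 1)"
    have x: "x \<ge> 0" using eta h_pos d by (simp add: x_def)
    have bad: "{\<omega> \<in> space M. \<not> grid_ok \<beta> kl (\<lambda>i. Y i \<omega>)}
      \<subseteq> {\<omega> \<in> space M. T (p \<beta> l) \<omega> - T (p \<beta> k) \<omega> \<le> of_int (p \<beta> l - p \<beta> k) * \<mu> / s - x}"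
    proof -
      have "of_int d * h * (1 - \<eta>) - \<eta> = of_int d * h - x"
        by (simp add: x_def algebra_simps)
      also have "\<dots> = of_int d * \<mu> / s - x" by (simp add: h_def)
      finally show ?thesis
        using dm True by (auto simp: grid_ok_def elapsed_Y d_def not_le simp del: of_int_diff)
    qed
    have "4 * (of_int d * h) \<le> (of_int d * h + 1)\<^sup>2"
      using sum_squares_bound[of "of_int d * h" 1] by (simp add: power2_eq_square algebra_simps)
    then have "\<eta>\<^sup>2 * (4 * (of_int d * h)) \<le> x\<^sup>2"
      unfolding x_def power_mult_distrib by (intro mult_left_mono) auto
    then have "\<eta>\<^sup>2 * (4 * (of_int d * h)) * s\<^sup>2 / (2 * of_int d * m2) \<le> x\<^sup>2 * s\<^sup>2 / (2 * of_int d * m2)"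
      using d m2_pos by (intro divide_right_mono mult_right_mono) auto
    also have "\<eta>\<^sup>2 * (4 * (of_int d * h)) * s\<^sup>2 / (2 * of_int d * m2) = 2 * \<eta>\<^sup>2 * \<mu> * s / m2"
      using d s m2_pos by (simp add: h_def field_simps power2_eq_square)
    finally have ex: "2 * \<eta>\<^sup>2 * \<mu> * s / m2 \<le> x\<^sup>2 * s\<^sup>2 / (2 * of_int d * m2)" .
    have "prob {\<omega> \<in> space M. \<not> grid_ok \<beta> kl (\<lambda>i. Y i \<omega>)}
      \<le> prob {\<omega> \<in> space M. T (p \<beta> l) \<omega> - T (p \<beta> k) \<omega> \<le> of_int (p \<beta> l - p \<beta> k) * \<mu> / s - x}"
      by (rule finite_measure_mono[OF bad]) measurable
    also have "\<dots> \<le> exp (- (x\<^sup>2 * s\<^sup>2 / (2 * of_int d * m2)))"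
      unfolding d_def by (rule T_diff_lower_tail[OF dm le0 x])
    also have "\<dots> \<le> exp (- (2 * \<eta>\<^sup>2 * \<mu> * s / m2))"
      using ex by simp
    also have "\<dots> \<le> 1 / 2" by (rule grid_tube)
    finally show ?thesis
      using dm by (intro prob_ge_half_if_compl) (auto simp: grid_ok_def elapsed_Y)
  qed
qed

text \<open>A block has only \<open>L\<close> gaps, so losing \<open>\<eta>\<close> inside it is so
  unlikely that a union bound over all its pairs of indices suffices.\<close>

lemma block_ok_prob:
  assumes neg: "p \<beta> G \<le> 0" and k: "k < G"
  shows "prob {\<omega> \<in> space M. block_ok \<beta> k (\<lambda>i. Y i \<omega>)} \<ge> 1 / 2"
proof -
  let ?K = "{p \<beta> k..p \<beta> (k + 1)} \<times> {p \<beta> k..p \<beta> (k + 1)}"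
  define c where "c = exp (- (\<eta>\<^sup>2 * s\<^sup>2 / (2 * L * m2)))"
  have le0: "p \<beta> (k + 1) \<le> 0" using p_mono[of "k + 1" G \<beta>] k neg by simp
  have len: "p \<beta> (k + 1) - p \<beta> k = int L" by (simp add: p_def algebra_simps)
  have "1 - (\<Sum>mn\<in>?K. c) \<le>
    prob {\<omega> \<in> space M. \<forall>mn\<in>?K. case mn of (m, n) \<Rightarrow> m < n \<longrightarrow> of_int (n - m) * h - \<eta> \<le> T n \<omega> - T m \<omega>}"
  proof (rule prob_Ball_ge)
    fix mn assume mn: "mn \<in> ?K"
    obtain m n where [simp]: "mn = (m, n)" by (cases mn)
    have "{\<omega> \<in> space M. \<not> (case mn of (m, n) \<Rightarrow> m < n \<longrightarrow> of_int (n - m) * h - \<eta> \<le> T n \<omega> - T m \<omega>)} \<in> events \<and>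
       prob {\<omega> \<in> space M. \<not> (case mn of (m, n) \<Rightarrow> m < n \<longrightarrow> of_int (n - m) * h - \<eta> \<le> T n \<omega> - T m \<omega>)} \<le> c"
    proof (cases "m < n")
      case False
      then show ?thesis by (simp add: c_def)
    next
      case True
      have n0: "n \<le> 0" using mn le0 by simp
      have [measurable]: "(\<lambda>\<omega>. T n \<omega> - T m \<omega>) \<in> borel_measurable M"
        using True n0 by (intro T_diff_measurable) auto
      have nm: "of_int (n - m) \<le> real L" using mn len by simp
      have "prob {\<omega> \<in> space M. \<not> (case mn of (m, n) \<Rightarrow> m < n \<longrightarrow> of_int (n - m) * h - \<eta> \<le> T n \<omega> - T m \<omega>)}
        \<le> prob {\<omega> \<in> space M. T n \<omega> - T m \<omega> \<le> of_int (n - m) * \<mu> / s - \<eta>}"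
        by (rule finite_measure_mono) (use True in \<open>auto simp: h_def\<close>)
      also have "\<dots> \<le> exp (- (\<eta>\<^sup>2 * s\<^sup>2 / (2 * of_int (n - m) * m2)))"
        using eta by (intro T_diff_lower_tail True n0) auto
      also have "\<dots> \<le> c"
        unfolding c_def exp_le_cancel_iff neg_le_iff_le
        using nm True m2_pos by (intro divide_left_mono mult_right_mono mult_left_mono mult_pos_pos) auto
      finally show ?thesis using True by simp
    qed
    then show "{\<omega> \<in> space M. \<not> (case mn of (m, n) \<Rightarrow> m < n \<longrightarrow> of_int (n - m) * h - \<eta> \<le> T n \<omega> - T m \<omega>)} \<in> events"
      and "prob {\<omega> \<in> space M. \<not> (case mn of (m, n) \<Rightarrow> m < n \<longrightarrow> of_int (n - m) * h - \<eta> \<le> T n \<omega> - T m \<omega>)} \<le> c"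
      by blast+
  qed simp
  also have "(\<Sum>mn\<in>?K. c) = (L + 1)\<^sup>2 * c"
    using len by (simp add: card_cartesian_product power2_eq_square algebra_simps)
  finally have "1 / 2 \<le> prob {\<omega> \<in> space M. \<forall>mn\<in>?K. case mn of (m, n) \<Rightarrow> m < n \<longrightarrow> of_int (n - m) * h - \<eta> \<le> T n \<omega> - T m \<omega>}"
    using block_tube_prob unfolding c_def by linarith
  also have "{\<omega> \<in> space M. \<forall>mn\<in>?K. case mn of (m, n) \<Rightarrow> m < n \<longrightarrow> of_int (n - m) * h - \<eta> \<le> T n \<omega> - T m \<omega>}
     = {\<omega> \<in> space M. block_ok \<beta> k (\<lambda>i. Y i \<omega>)}"
    by (fastforce simp: block_ok_def elapsed_Y)
  finally show ?thesis .
qed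

lemma S_indep: "indep_vars (\<lambda>_. borel) S UNIV"
proof -
  have "indep_vars (\<lambda>_. borel) W (range Serv)"
    by (rule indep_vars_subset[OF W_indep]) auto
  from indep_vars_reindex_inj[OF this] show ?thesis
    by (simp add: inj_on_def W_def[abs_def] eta_contract_eq)
qed

text \<open>Only the count at the left end of the block meets fluctuations of the full order
  \<open>sqrt s\<close>; four of these cost probability 1/4. A later count differs from it through a
  sum with variance proxy \<open>L\<close>, so an excess of one further \<open>sqrt s\<close> has
  probability at most \<open>exp (- s / (2 * L))\<close>, affordable at all \<open>L + 1\<close>
  indices. Hence the \<open>5 * sqrt s\<close> in the capacity.\<close>

lemma count_ok_prob:
  assumes k: "k < G"
  shows "prob {\<omega> \<in> space M. count_ok \<beta> k (\<lambda>i. Y i \<omega>)} \<ge> 1 / 2"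
proof -
  define mbar where "mbar = (\<mu> + 3 * \<eta>) / (\<mu> / s * (1 - \<eta>)) + 1"
  define B where "B j = (\<lambda>n. {tube (j - n)<..})" for j
  define N where "N j \<omega> = (\<Sum>n\<in>{\<beta>..j}. indicat_real (B j n) (S n \<omega>))" for j \<omega>
  have tube_mono: "tube m \<le> tube n" if "m \<le> n" for m n
    using that h_pos eta by (simp add: tube_def mult_right_mono)
  have B_sets: "B j n \<in> sets borel" for j n by (simp add: B_def)
  have ind_int: "integrable M (\<lambda>\<omega>. indicat_real A (S n \<omega>))" if "A \<in> sets borel" for A n
    using that by (intro integrable_const_bound[where B=1]) auto
  have N_meas[measurable]: "N j \<in> borel_measurable M" for j
    unfolding N_def[abs_def] B_def by measurable
  have N_int: "integrable M (N j)" for j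
    unfolding N_def[abs_def] using B_sets by (intro Bochner_Integration.integrable_sum ind_int)
  have EN: "expectation (N j) = (\<Sum>n\<in>{\<beta>..j}. expectation (\<lambda>\<omega>. indicat_real (B j n) (S n \<omega>)))" for j
    unfolding N_def[abs_def] using B_sets by (intro Bochner_Integration.integral_sum ind_int)
  have E_ind: "expectation (\<lambda>\<omega>. indicat_real A (S n \<omega>)) = prob {\<omega> \<in> space M. S n \<omega> \<in> A}"
    if "A \<in> sets borel" for A n
  proof -
    have "expectation (\<lambda>\<omega>. indicat_real A (S n \<omega>)) = expectation (indicat_real {\<omega> \<in> space M. S n \<omega> \<in> A})"
      by (intro Bochner_Integration.integral_cong) (auto simp: indicator_def)
    also have "\<dots> = prob {\<omega> \<in> space M. S n \<omega> \<in> A}"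
      by (simp add: Collect_conj_eq Int_commute Int_left_commute)
    finally show ?thesis .
  qed
  have EN_le: "expectation (N j) \<le> mbar" for j
    using mean_count[of \<eta> j \<beta>] eta B_sets unfolding EN
    by (simp add: E_ind B_def tube_def mbar_def h_def)
  have EN_mono: "expectation (N i) \<le> expectation (N j)" if "i \<le> j" for i j
  proof -
    have "expectation (N i) = (\<Sum>n\<in>{\<beta>..i}. measure DV {tube (i - n)<..})"
      unfolding EN using B_sets by (simp add: E_ind S_prob) (simp add: B_def)
    \<comment> \<open>Shift the customers by \<open>j - i\<close>: the mean count at
      \<open>i\<close> is the mean count at \<open>j\<close> without the oldest customers.\<close>
    also have "\<dots> = (\<Sum>n\<in>{\<beta> + (j - i)..j}. measure DV {tube (j - n)<..})"
      by (rule sum.reindex_bij_witness[of _ "\<lambda>n. n - (j - i)" "\<lambda>n. n + (j - i)"]) auto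
    also have "\<dots> \<le> (\<Sum>n\<in>{\<beta>..j}. measure DV {tube (j - n)<..})"
      using that by (intro sum_mono2) auto
    also have "\<dots> = expectation (N j)"
      unfolding EN using B_sets by (simp add: E_ind S_prob) (simp add: B_def)
    finally show ?thesis .
  qed
  let ?p = "p \<beta> k"
  \<comment> \<open>The index \<open>?p - 1\<close> is a placeholder for the event at the left end,
    so that a single union bound covers it together with the increments.\<close>
  define P where "P j \<omega> \<longleftrightarrow> (if j < ?p then N ?p \<omega> < expectation (N ?p) + 4 * sqrt s
     else N j \<omega> < N ?p \<omega> - expectation (N ?p) + expectation (N j) + sqrt s)" for j \<omega>
  define c where "c j = (if j < ?p then 1 / 4 else exp (- (s / (2 * L))))" for j
  have sum_c: "(\<Sum>j\<in>{?p - 1..p \<beta> (k + 1)}. c j) \<le> 1 / 2"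
  proof -
    have "{?p - 1..p \<beta> (k + 1)} = insert (?p - 1) {?p..p \<beta> (k + 1)}"
      using p_mono[of k "k + 1" \<beta>] by auto
    then have "(\<Sum>j\<in>{?p - 1..p \<beta> (k + 1)}. c j) = 1 / 4 + (\<Sum>j\<in>{?p..p \<beta> (k + 1)}. exp (- (s / (2 * L))))"
      by (simp add: c_def)
    also have "(\<Sum>j\<in>{?p..p \<beta> (k + 1)}. exp (- (s / (2 * L)))) = (L + 1) * exp (- (s / (2 * L)))"
      by (simp add: p_def algebra_simps)
    finally show ?thesis using block_count_prob by simp
  qed
  have "1 - (\<Sum>j\<in>{?p - 1..p \<beta> (k + 1)}. c j) \<le> prob {\<omega> \<in> space M. \<forall>j\<in>{?p - 1..p \<beta> (k + 1)}. P j \<omega>}"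
  proof (rule prob_Ball_ge)
    fix j assume j: "j \<in> {?p - 1..p \<beta> (k + 1)}"
    show "{\<omega> \<in> space M. \<not> P j \<omega>} \<in> events"
      unfolding P_def by (cases "j < ?p") simp_all
    show "prob {\<omega> \<in> space M. \<not> P j \<omega>} \<le> c j"
    proof (cases "j < ?p")
      case True
      \<comment> \<open>The parameter \<open>t = 1 / sqrt s\<close>, with mean at most
        \<open>2 * s\<close> and excess \<open>4 * sqrt s\<close>, gives the exponent
        \<open>2 - 4\<close>.\<close>
      have "prob {\<omega> \<in> space M. (\<Sum>n\<in>{\<beta>..?p}. indicat_real (B ?p n) (S n \<omega>))
          \<ge> (\<Sum>n\<in>{\<beta>..?p}. expectation (\<lambda>\<omega>. indicat_real (B ?p n) (S n \<omega>))) + 4 * sqrt s}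
          \<le> exp ((1 / sqrt s)\<^sup>2 * (2 * s) - 1 / sqrt s * (4 * sqrt s))"
      proof (rule unit_interval_sum_upper_tail)
        show "indep_vars (\<lambda>_. borel) (\<lambda>n \<omega>. indicat_real (B ?p n) (S n \<omega>)) {\<beta>..?p}"
          using B_sets by (intro indep_vars_compose2[OF indep_vars_subset[OF S_indep]]) auto
        show "(\<Sum>n\<in>{\<beta>..?p}. expectation (\<lambda>\<omega>. indicat_real (B ?p n) (S n \<omega>))) \<le> 2 * s"
          using EN_le[of ?p] mean_le unfolding EN mbar_def by linarith
      qed (use s in \<open>auto simp: indicator_def\<close>)
      also have "(1 / sqrt s)\<^sup>2 * (2 * s) - 1 / sqrt s * (4 * sqrt s) = - 2"
        using s by (simp add: power_divide)
      also have "exp (- 2) \<le> (1 / 4 :: real)"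
      proof -
        have "(2::real) * 2 \<le> exp 1 * exp 1"
          using exp_ge_add_one_self[of "1::real"] by (intro mult_mono) auto
        then have "4 \<le> exp (2 :: real)" by (simp flip: exp_add)
        then show ?thesis by (simp add: exp_minus field_simps)
      qed
      finally show ?thesis
        using True by (simp add: P_def c_def N_def[symmetric] EN[symmetric] not_less)
    next
      case False
      then have pj: "?p \<le> j" by simp
      have "j - ?p \<le> int L"
        using j by (simp add: p_def algebra_simps)
      then have "of_int (j - ?p) \<le> (of_int (int L) :: real)"
        by (simp only: of_int_le_iff)
      then have jL: "of_int (j - ?p) \<le> real L" by simp
      \<comment> \<open>From index p to j the counted customers lose those with indicator A among the old
        ones and gain j - p arrivals, less those with indicator A among the new ones.\<close>
      define A where "A n = (if n \<le> ?p then {tube (?p - n)<..tube (j - n)} else {..tube (j - n)})" for n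
      have A_sets: "A n \<in> sets borel" for n by (simp add: A_def)
      have id: "(\<Sum>n\<in>{\<beta>..j}. indicat_real (A n) (S n \<omega>)) = N ?p \<omega> + of_int (j - ?p) - N j \<omega>" for \<omega>
      proof -
        have split: "(\<Sum>n\<in>{\<beta>..j}. f n) = (\<Sum>n\<in>{\<beta>..?p}. f n) + (\<Sum>n\<in>{?p<..j}. f n)" for f :: "int \<Rightarrow> real"
        proof -
          have "{\<beta>..j} = {\<beta>..?p} \<union> {?p<..j}" using pj p_ge[of \<beta> k] by auto
          then show ?thesis by (simp add: sum.union_disjoint disjoint_iff)
        qed
        have 1: "(\<Sum>n\<in>{\<beta>..?p}. indicat_real (A n) (S n \<omega>)) = N ?p \<omega> - (\<Sum>n\<in>{\<beta>..?p}. indicat_real (B j n) (S n \<omega>))"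
          unfolding N_def sum_subtractf[symmetric]
        proof (rule sum.cong[OF refl])
          fix n assume "n \<in> {\<beta>..?p}"
          then show "indicat_real (A n) (S n \<omega>) = indicat_real (B ?p n) (S n \<omega>) - indicat_real (B j n) (S n \<omega>)"
            using tube_mono[of "?p - n" "j - n"] pj by (auto simp: A_def B_def indicator_def)
        qed
        have 2: "(\<Sum>n\<in>{?p<..j}. indicat_real (A n) (S n \<omega>)) = of_int (j - ?p) - (\<Sum>n\<in>{?p<..j}. indicat_real (B j n) (S n \<omega>))"
        proof -
          have "(\<Sum>n\<in>{?p<..j}. indicat_real (A n) (S n \<omega>)) = (\<Sum>n\<in>{?p<..j}. 1 - indicat_real (B j n) (S n \<omega>))"
            by (rule sum.cong) (auto simp: A_def B_def indicator_def)
          also have "\<dots> = of_int (j - ?p) - (\<Sum>n\<in>{?p<..j}. indicat_real (B j n) (S n \<omega>))"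
            using pj by (simp add: sum_subtractf)
          finally show ?thesis .
        qed
        show ?thesis unfolding split[of "\<lambda>n. indicat_real (A n) (S n \<omega>)"] 1 2
          using split[of "\<lambda>n. indicat_real (B j n) (S n \<omega>)"] by (simp add: N_def)
      qed
      have EA: "(\<Sum>n\<in>{\<beta>..j}. expectation (\<lambda>\<omega>. indicat_real (A n) (S n \<omega>)))
          = expectation (N ?p) + of_int (j - ?p) - expectation (N j)"
      proof -
        have "(\<Sum>n\<in>{\<beta>..j}. expectation (\<lambda>\<omega>. indicat_real (A n) (S n \<omega>)))
            = expectation (\<lambda>\<omega>. \<Sum>n\<in>{\<beta>..j}. indicat_real (A n) (S n \<omega>))"
          using A_sets by (intro Bochner_Integration.integral_sum[symmetric] ind_int)
        also have "\<dots> = expectation (\<lambda>\<omega>. N ?p \<omega> + of_int (j - ?p) - N j \<omega>)"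
          unfolding id ..
        also have "\<dots> = expectation (N ?p) + of_int (j - ?p) - expectation (N j)"
          using N_int by (simp add: prob_space)
        finally show ?thesis .
      qed
      have "prob {\<omega> \<in> space M. (\<Sum>n\<in>{\<beta>..j}. indicat_real (A n) (S n \<omega>))
          \<le> (\<Sum>n\<in>{\<beta>..j}. expectation (\<lambda>\<omega>. indicat_real (A n) (S n \<omega>))) - sqrt s} \<le> exp (- (sqrt s)\<^sup>2 / (2 * real L))"
      proof (rule sum_lower_tail)
        show "indep_vars (\<lambda>_. borel) (\<lambda>n \<omega>. indicat_real (A n) (S n \<omega>)) {\<beta>..j}"
          using A_sets by (intro indep_vars_compose2[OF indep_vars_subset[OF S_indep]]) auto
        have sq: "(indicat_real (A n) (S n \<omega>))\<^sup>2 = indicat_real (A n) (S n \<omega>)" for n \<omega>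
          by (simp add: indicator_def)
        show "integrable M (\<lambda>\<omega>. (indicat_real (A n) (S n \<omega>))\<^sup>2)" for n
          unfolding sq using A_sets by (rule ind_int)
        \<comment> \<open>Indicators equal their squares, so the variance proxy is the mean of the
          sum. As the mean counts increase, it is at most \<open>j - ?p\<close>.\<close>
        show "(\<Sum>n\<in>{\<beta>..j}. expectation (\<lambda>\<omega>. (indicat_real (A n) (S n \<omega>))\<^sup>2)) \<le> real L"
          unfolding sq EA using EN_mono[OF pj] jL by linarith
      qed (use s L_pos in auto)
      also have "\<dots> = c j" using False s by (simp add: c_def)
      also have "{\<omega> \<in> space M. (\<Sum>n\<in>{\<beta>..j}. indicat_real (A n) (S n \<omega>))
          \<le> (\<Sum>n\<in>{\<beta>..j}. expectation (\<lambda>\<omega>. indicat_real (A n) (S n \<omega>))) - sqrt s} = {\<omega> \<in> space M. \<not> P j \<omega>}"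
        unfolding id EA P_def using False by auto
      finally show ?thesis .
    qed
  qed simp
  also have "\<dots> \<le> prob {\<omega> \<in> space M. count_ok \<beta> k (\<lambda>i. Y i \<omega>)}"
  proof (rule finite_measure_mono)
    show "{\<omega> \<in> space M. count_ok \<beta> k (\<lambda>i. Y i \<omega>)} \<in> events"
    proof -
      have "count \<beta> j (\<lambda>i. Y i \<omega>) = N j \<omega>" for j \<omega>
        by (auto simp: count_def N_def serv_Y B_def intro!: sum.cong split: split_indicator)
      then show ?thesis unfolding count_ok_def by simp
    qed
    show "{\<omega> \<in> space M. \<forall>j\<in>{?p - 1..p \<beta> (k + 1)}. P j \<omega>} \<subseteq> {\<omega> \<in> space M. count_ok \<beta> k (\<lambda>i. Y i \<omega>)}"
    proof clarify
      fix \<omega> assume P: "\<forall>j\<in>{?p - 1..p \<beta> (k + 1)}. P j \<omega>"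
      show "count_ok \<beta> k (\<lambda>i. Y i \<omega>)"
        unfolding count_ok_def
      proof
        fix j assume j: "j \<in> {?p..p \<beta> (k + 1)}"
        have "N ?p \<omega> < expectation (N ?p) + 4 * sqrt s"
          using P p_mono[of k "k + 1" \<beta>] by (auto simp: P_def dest!: bspec[where x="?p - 1"])
        moreover have "N j \<omega> < N ?p \<omega> - expectation (N ?p) + expectation (N j) + sqrt s"
          using P j by (auto simp: P_def dest!: bspec[where x=j])
        ultimately have "N j \<omega> \<le> C"
          using EN_le[of j] capacity unfolding mbar_def by linarith
        moreover have "count \<beta> j (\<lambda>i. Y i \<omega>) = N j \<omega>"
          by (auto simp: count_def N_def serv_Y B_def intro!: sum.cong split: split_indicator)
        ultimately show "count \<beta> j (\<lambda>i. Y i \<omega>) \<le> C" by simp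
      qed
    qed
  qed
  finally show ?thesis using sum_c by linarith
qed

lemma short_ok_prob:
  shows "prob {\<omega> \<in> space M. short_ok \<beta> (\<lambda>i. Y i \<omega>)} \<ge> 1 / 2"
proof -
  have "1 - (\<Sum>n\<in>{\<beta>..p \<beta> G}. mv q / (a * \<mu> / 4) ^ q)
    \<le> prob {\<omega> \<in> space M. \<forall>n\<in>{\<beta>..p \<beta> G}. S n \<omega> \<le> a * \<mu> / 4}"
    using a_pos mu_pos by (intro prob_Ball_ge S_tail) auto
  also have "(\<Sum>n\<in>{\<beta>..p \<beta> G}. mv q / (a * \<mu> / 4) ^ q) = (2 * a\<^sup>2 * L + 1) * (mv q / (a * \<mu> / 4) ^ q)"
    by (simp add: p_def)
  finally show ?thesis
    using short unfolding short_ok_def serv_Y by linarith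
qed

lemma old_gone_prob_le:
  assumes "\<beta> \<le> 0" "d > 0"
  shows "prob {\<omega> \<in> space M. \<not> old_gone (a * \<mu> / 8) \<beta> d (\<lambda>i. Y i \<omega>)} \<le> 1 / (8 * real d ^ 12)"
  using old_gone_prob[OF assms, of "a * \<mu> / 8" q] old[OF assms(2)] mu_pos by (simp add: h_def)

lemma old_ok_prob:
  assumes "\<beta> \<le> 0"
  shows "prob {\<omega> \<in> space M. old_ok \<beta> r (\<lambda>i. Y i \<omega>)} \<ge> 1 / 2"
proof -
  have "1 - (\<Sum>d\<in>{1..r}. 1 / 8 * (1 / real d ^ 2)) \<le> prob {\<omega> \<in> space M. old_ok \<beta> r (\<lambda>i. Y i \<omega>)}"
    unfolding old_ok_def
  proof (rule prob_Ball_ge)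
    fix d assume d: "d \<in> {1..r}"
    show "{\<omega> \<in> space M. \<not> old_gone (a * \<mu> / 8) \<beta> d (\<lambda>i. Y i \<omega>)} \<in> events"
      using assms by (rule old_gone_event)
    have "prob {\<omega> \<in> space M. \<not> old_gone (a * \<mu> / 8) \<beta> d (\<lambda>i. Y i \<omega>)} \<le> 1 / (8 * real d ^ 12)"
      using d by (intro old_gone_prob_le assms) auto
    \<comment> \<open>Two powers of \<open>d\<close> suffice for summability here. The full exponent
      is used for the customers older than \<open>r\<close>.\<close>
    also have "\<dots> \<le> 1 / (8 * real d ^ 2)"
      using d by (intro divide_left_mono mult_left_mono power_increasing) auto
    finally show "prob {\<omega> \<in> space M. \<not> old_gone (a * \<mu> / 8) \<beta> d (\<lambda>i. Y i \<omega>)} \<le> 1 / 8 * (1 / real d ^ 2)"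
      by simp
  qed simp
  moreover have "(\<Sum>d\<in>{1..r}. 1 / 8 * (1 / real d ^ 2)) \<le> 1 / 8 * (2 / real 1)"
    unfolding sum_distrib_left[symmetric] using sum_inverse_squares_le[of 1 r] by (intro mult_left_mono) auto
  ultimately show ?thesis by simp
qed

lemma finite_coords: "finite (coords m n)"
  by (simp add: coords_def)

text \<open>The exponent lists the pieces: \<open>(G + 1)^2\<close> pairs of boundaries, a tube and
  a count for each block, short services, old customers. All are increasing in the same independent
  coordinates.\<close>

lemma success_prob:
  assumes neg: "p \<beta> G \<le> 0"
  shows "prob {\<omega> \<in> space M. success \<beta> r (\<lambda>i. Y i \<omega>)} \<ge> (1 / 2) ^ ((G + 1)\<^sup>2 + 2 * G + 2)"
proof -
  let ?I = "coords (\<beta> - int r) (p \<beta> G)"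
  note I = finite_coords Y_indep[OF neg]
  have \<beta>: "\<beta> \<le> 0" using neg p_ge[of \<beta> G] by simp
  define P1 where "P1 y \<longleftrightarrow> (\<forall>kl\<in>{..G} \<times> {..G}. grid_ok \<beta> kl y)" for y
  define P2 where "P2 y \<longleftrightarrow> (\<forall>k\<in>{..<G}. block_ok \<beta> k y)" for y
  define P3 where "P3 y \<longleftrightarrow> (\<forall>k\<in>{..<G}. count_ok \<beta> k y)" for y
  have inc: "increasing_event ?I P1" "increasing_event ?I P2" "increasing_event ?I P3"
    unfolding P1_def[abs_def] P2_def[abs_def] P3_def[abs_def]
    by (intro increasing_event_ball; auto intro: increasing_grid_ok increasing_block_ok
      increasing_count_ok)+
  have 1: "(1 / 2) ^ card ({..G} \<times> {..G}) \<le> prob {\<omega> \<in> space M. P1 (\<lambda>i. Y i \<omega>)}"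
    unfolding P1_def
    by (intro harris_inequality_finite[OF I] grid_ok_prob neg) (auto intro: increasing_grid_ok)
  have 2: "(1 / 2) ^ card {..<G} \<le> prob {\<omega> \<in> space M. P2 (\<lambda>i. Y i \<omega>)}"
    unfolding P2_def
    by (intro harris_inequality_finite[OF I] block_ok_prob neg) (auto intro: increasing_block_ok)
  have 3: "(1 / 2) ^ card {..<G} \<le> prob {\<omega> \<in> space M. P3 (\<lambda>i. Y i \<omega>)}"
    unfolding P3_def
    by (intro harris_inequality_finite[OF I] count_ok_prob) (auto intro: increasing_count_ok)
  have 4: "(1 / 2) ^ 1 \<le> prob {\<omega> \<in> space M. short_ok \<beta> (\<lambda>i. Y i \<omega>)}"
    using short_ok_prob by simp
  have 5: "(1 / 2) ^ 1 \<le> prob {\<omega> \<in> space M. old_ok \<beta> r (\<lambda>i. Y i \<omega>)}"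
    using old_ok_prob[OF \<beta>] by simp
  note inc45 = increasing_event_conj[OF increasing_short_ok increasing_old_ok, of \<beta> r]
  note inc345 = increasing_event_conj[OF inc(3) inc45]
  note inc2345 = increasing_event_conj[OF inc(2) inc345]
  have card: "(G + 1)\<^sup>2 + 2 * G + 2 = card ({..G} \<times> {..G}) + (card {..<G} + (card {..<G} + (1 + 1)))"
    by (simp add: card_cartesian_product power2_eq_square)
  have "(1 / 2) ^ (card ({..G} \<times> {..G}) + (card {..<G} + (card {..<G} + (1 + 1))))
     \<le> prob {\<omega> \<in> space M. P1 (\<lambda>i. Y i \<omega>) \<and> P2 (\<lambda>i. Y i \<omega>) \<and> P3 (\<lambda>i. Y i \<omega>)
         \<and> short_ok \<beta> (\<lambda>i. Y i \<omega>) \<and> old_ok \<beta> r (\<lambda>i. Y i \<omega>)}"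
    apply (rule harris_half_power[OF I inc(1) inc2345 1])
    apply (rule harris_half_power[OF I inc(2) inc345 2])
    apply (rule harris_half_power[OF I inc(3) inc45 3])
    apply (rule harris_half_power[OF I increasing_short_ok increasing_old_ok 4 5])
    done
  then show ?thesis
    unfolding success_def card P1_def P2_def P3_def .
qed

text \<open>The tube bounds true ages from below, so \<open>count\<close> dominates the true
  numbers. Each half of the window lasts at least \<open>a * \<mu> / 4\<close>, which is both the
  bound on its services and twice the offset \<open>a * \<mu> / 8\<close> granted to old
  customers.\<close>

lemma tau_ge_if_success:
  assumes \<omega>: "\<omega> \<in> space M" and neg: "p \<beta> G < 0"
    and succ: "success \<beta> r (\<lambda>i. Y i \<omega>)"
    and far: "\<And>d. d > r \<Longrightarrow> old_gone (a * \<mu> / 8) \<beta> d (\<lambda>i. Y i \<omega>)"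
  shows "ereal (T \<beta> \<omega>) \<le> tau C (\<lambda>n. T n \<omega>) (\<lambda>n. S n \<omega>)"
proof -
  let ?t = "\<lambda>n. T n \<omega>"
  have pp: "\<And>k l. k \<le> l \<Longrightarrow> p \<beta> k \<le> p \<beta> l" by (rule p_mono)
  have tube: "tube (n - m) \<le> ?t n - ?t m" if "\<beta> \<le> m" "m \<le> n" "n \<le> p \<beta> G" for m n
    unfolding tube_def
  proof (rule block_tube[where \<beta>=\<beta> and L=L and G=G, folded p_def, OF L_pos])
    show "of_int (p \<beta> l - p \<beta> k) * h * (1 - \<eta>) - \<eta> \<le> ?t (p \<beta> l) - ?t (p \<beta> k)" if "k < l" "l \<le> G" for k l
    proof -
      have "grid_ok \<beta> (k, l) (\<lambda>i. Y i \<omega>)" using succ that by (simp add: success_def)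
      with that pp[of k l] show ?thesis by (simp add: grid_ok_def elapsed_Y)
    qed
    show "of_int (n - m) * h - \<eta> \<le> ?t n - ?t m" if "k < G" "p \<beta> k \<le> m" "m \<le> n" "n \<le> p \<beta> (k + 1)" for k m n
    proof (cases "m = n")
      case True then show ?thesis using eta by simp
    next
      case False
      have "block_ok \<beta> k (\<lambda>i. Y i \<omega>)" using succ that(1) by (simp add: success_def)
      with that False have "of_int (n - m) * h - \<eta> \<le> elapsed (\<lambda>i. Y i \<omega>) m n"
        unfolding block_ok_def by (elim ballE[where x="(m, n)"]) auto
      with that show ?thesis by (simp add: elapsed_Y)
    qed
  qed (use that h_pos eta in auto)
  let ?j = "p \<beta> (a\<^sup>2)"
  \<comment> \<open>From \<open>\<eta> \<le> 1 / 2\<close> the linear part is at least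
    \<open>a * \<mu> / 2\<close>, and \<open>12 * \<eta> \<le> a * \<mu>\<close> lets
    \<open>3 * \<eta>\<close> consume at most half of that.\<close>
  have half: "a * \<mu> / 4 \<le> tube (int (a\<^sup>2 * L))"
  proof -
    have "\<mu> \<le> a * L * h"
      using mult_right_mono[OF span, of h] h_pos s by (simp add: h_def)
    then have "a * \<mu> \<le> a * (a * L * h)"
      by (intro mult_left_mono) auto
    also have "\<dots> = real (a\<^sup>2 * L) * h" by (simp add: power2_eq_square)
    finally have *: "a * \<mu> \<le> real (a\<^sup>2 * L) * h" .
    have "a * \<mu> * (1 / 2) \<le> real (a\<^sup>2 * L) * h * (1 - \<eta>)"
      by (rule mult_mono[OF *]) (use eta h_pos in auto)
    moreover have "of_int (int (a\<^sup>2 * L)) = real (a\<^sup>2 * L)" by simp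
    ultimately show ?thesis using eta(3) unfolding tube_def by linarith
  qed
  have j1: "a * \<mu> / 4 \<le> ?t ?j - ?t \<beta>"
  proof -
    have "tube (?j - \<beta>) \<le> ?t ?j - ?t \<beta>"
      by (rule tube) (use p_ge pp[of "a\<^sup>2" G] in auto)
    with half show ?thesis by (simp add: p_def)
  qed
  have j2: "a * \<mu> / 4 \<le> ?t (p \<beta> G) - ?t ?j"
  proof -
    have "tube (p \<beta> G - ?j) \<le> ?t (p \<beta> G) - ?t ?j"
      by (rule tube) (use p_ge pp[of "a\<^sup>2" G] in auto)
    moreover have "p \<beta> G - ?j = int (a\<^sup>2 * L)" by (simp add: p_def algebra_simps)
    ultimately show ?thesis using half by simp
  qed
  have "ereal (?t ?j) \<le> tau C ?t (\<lambda>n. S n \<omega>)"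
  proof (rule tau_ge_arrival)
    show "T n \<omega> < T (n + 1) \<omega>" for n using T_step[OF \<omega>] .
    show "T 0 \<omega> \<le> 0" using T_0[OF \<omega>] .
    show "\<beta> \<le> ?j" by (rule p_ge)
    show "?j \<le> p \<beta> G" by (rule pp) simp
    show "p \<beta> G < 0" by (rule neg)
    show "T n \<omega> + S n \<omega> \<le> T ?j \<omega>" if "n < \<beta>" for n
    proof -
      define d where "d = nat (\<beta> - n)"
      have n: "n = \<beta> - int d" and d: "d > 0" using that by (auto simp: d_def)
      have "old_gone (a * \<mu> / 8) \<beta> d (\<lambda>i. Y i \<omega>)"
        using succ far[of d] d by (cases "d \<le> r") (auto simp: success_def old_ok_def)
      then show ?thesis
        using j1 by (simp add: old_gone_def elapsed_Y serv_Y n)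
    qed
    show "T n \<omega> + S n \<omega> \<le> T (p \<beta> G) \<omega>" if "\<beta> \<le> n" "n \<le> ?j" for n
    proof -
      have "short_ok \<beta> (\<lambda>i. Y i \<omega>)" using succ by (simp add: success_def)
      then have "S n \<omega> \<le> a * \<mu> / 4"
        using that pp[of "a\<^sup>2" G] by (auto simp: short_ok_def serv_Y)
      with j2 T_mono[OF \<omega> that(2)] show ?thesis by simp
    qed
    show "real (card {n \<in> {\<beta>..i}. T i \<omega> - T n \<omega> < S n \<omega>}) \<le> C" if i: "?j \<le> i" "i \<le> p \<beta> G" for i
    proof -
      have \<beta>i: "\<beta> \<le> i" using i p_ge[of \<beta> "a\<^sup>2"] by simp
      obtain k where k: "k < G" "p \<beta> k \<le> i" "i \<le> p \<beta> (k + 1)"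
      proof -
        \<comment> \<open>The first boundary not before \<open>i\<close> closes the block sought. If
          it is boundary 0, then \<open>i = \<beta>\<close> and block 0 serves.\<close>
        define K where "K = {k. k \<le> G \<and> i \<le> p \<beta> k}"
        define m where "m = Min K"
        have K: "finite K" "G \<in> K" using i by (auto simp: K_def)
        then have m: "m \<in> K" "\<And>k. k \<in> K \<Longrightarrow> m \<le> k"
          unfolding m_def by (auto intro!: Min_in)
        show ?thesis
        proof (cases m)
          case 0
          then have "i \<le> p \<beta> (0 + 1)" using m(1) pp[of 0 1] by (simp add: K_def)
          then show ?thesis using a_pos \<beta>i by (intro that[of 0]) (auto simp: p_def)
        next
          case (Suc k)
          then have "k \<notin> K" using m(2) by force
          then show ?thesis using m(1) Suc by (intro that[of k]) (auto simp: K_def)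
        qed
      qed
      have "real (card {n \<in> {\<beta>..i}. T i \<omega> - T n \<omega> < S n \<omega>}) \<le> real (card ({\<beta>..i} \<inter> {n. tube (i - n) < S n \<omega>}))"
      proof (intro of_nat_mono card_mono)
        show "{n \<in> {\<beta>..i}. T i \<omega> - T n \<omega> < S n \<omega>} \<subseteq> {\<beta>..i} \<inter> {n. tube (i - n) < S n \<omega>}"
        proof
          fix n assume n: "n \<in> {n \<in> {\<beta>..i}. T i \<omega> - T n \<omega> < S n \<omega>}"
          have "tube (i - n) \<le> T i \<omega> - T n \<omega>" by (rule tube) (use n i in auto)
          with n show "n \<in> {\<beta>..i} \<inter> {n. tube (i - n) < S n \<omega>}" by simp
        qed
      qed simp
      also have "\<dots> = count \<beta> i (\<lambda>i. Y i \<omega>)"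
        by (simp add: count_def serv_Y sum.If_cases)
      also have "\<dots> \<le> C"
        using succ k by (auto simp: success_def count_ok_def)
      finally show ?thesis .
    qed
  qed
  moreover have "?t \<beta> \<le> ?t ?j" by (rule T_mono[OF \<omega> p_ge])
  ultimately show ?thesis by (meson ereal_less_eq(3) order_trans)
qed

subsection \<open>Independent windows\<close>

text \<open>With \<open>G * L \<le> r\<close>, a window and its inspected past reach at most
  \<open>r\<close> customers to either side of the start. Spacing \<open>3 * r\<close> keeps these
  sets disjoint, and starting at \<open>i = 1\<close> keeps them before customer 0.\<close>

definition trial :: "nat \<Rightarrow> nat \<Rightarrow> int" where "trial r i = - (3 * int r * int i)"

definition fails :: "nat \<Rightarrow> 'a set" where
  "fails r = {\<omega> \<in> space M. \<forall>i\<in>{1..r}. \<not> (success (trial r i) r (\<lambda>i. Y i \<omega>)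
     \<and> (\<forall>d. d > r \<longrightarrow> old_gone (a * \<mu> / 8) (trial r i) d (\<lambda>i. Y i \<omega>)))}"

definition p_success :: real where "p_success = (1 / 2) ^ ((G + 1)\<^sup>2 + 2 * G + 2)"

lemma p_success_bounds: "0 < p_success" "p_success \<le> 1"
  unfolding p_success_def by (simp, rule power_le_one) simp_all

lemma trial_neg:
  assumes "G * L \<le> r" "i \<in> {1..r}"
  shows "p (trial r i) G < 0" "trial r i \<le> 0"
proof -
  have "int r * 1 \<le> int r * int i" using assms by (intro mult_left_mono) auto
  moreover have "int (G * L) \<le> int r" using assms(1) by (simp only: of_nat_le_iff)
  moreover have "int r \<ge> 1" using assms by simp
  ultimately show "p (trial r i) G < 0" "trial r i \<le> 0"
    unfolding p_def trial_def by linarith+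
qed

lemma success_event:
  assumes "p \<beta> G \<le> 0"
  shows "{\<omega> \<in> space M. success \<beta> r (\<lambda>i. Y i \<omega>)} \<in> events"
  by (rule increasing_event_measurable[OF increasing_success Y_indep[OF assms]])

lemma far_event:
  assumes "\<beta> \<le> 0"
  shows "{\<omega> \<in> space M. \<exists>d. d > r \<and> \<not> old_gone z \<beta> d (\<lambda>i. Y i \<omega>)} \<in> events"
proof -
  have "{\<omega> \<in> space M. \<exists>d. d > r \<and> \<not> old_gone z \<beta> d (\<lambda>i. Y i \<omega>)}
    = (\<Union>d\<in>{r<..}. {\<omega> \<in> space M. \<not> old_gone z \<beta> d (\<lambda>i. Y i \<omega>)})" by auto
  also have "\<dots> \<in> events"
    using assms by (intro sets.countable_UN'' old_gone_event) auto
  finally show ?thesis .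
qed

text \<open>Of the twelve powers of \<open>d\<close>, ten are bounded by powers of \<open>r\<close>
  and two make the series converge.\<close>

lemma far_prob:
  assumes \<beta>: "\<beta> \<le> 0" and r: "r > 0"
  shows "prob {\<omega> \<in> space M. \<exists>d. d > r \<and> \<not> old_gone (a * \<mu> / 8) \<beta> d (\<lambda>i. Y i \<omega>)} \<le> 1 / (4 * real r ^ 10)"
proof -
  let ?A = "\<lambda>n. {\<omega> \<in> space M. \<not> old_gone (a * \<mu> / 8) \<beta> (r + 1 + n) (\<lambda>i. Y i \<omega>)}"
  have A: "range ?A \<subseteq> events" using old_gone_event[OF \<beta>] by auto
  have le: "(\<Sum>i<n. prob (?A i)) \<le> 1 / (4 * real r ^ 10)" for n
  proof -
    have "(\<Sum>i<n. prob (?A i)) \<le> (\<Sum>i<n. 1 / (8 * real r ^ 10) * (1 / real (r + 1 + i) ^ 2))"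
    proof (rule sum_mono)
      fix i
      have "prob (?A i) \<le> 1 / (8 * real (r + 1 + i) ^ 12)"
        using \<beta> by (rule old_gone_prob_le) simp
      also have "real (r + 1 + i) ^ 12 = real (r + 1 + i) ^ 10 * real (r + 1 + i) ^ 2"
        by (simp flip: power_add)
      also have "1 / (8 * (real (r + 1 + i) ^ 10 * real (r + 1 + i) ^ 2)) \<le> 1 / (8 * (real r ^ 10 * real (r + 1 + i) ^ 2))"
        using r by (intro divide_left_mono mult_left_mono mult_right_mono power_mono mult_pos_pos) auto
      finally show "prob (?A i) \<le> 1 / (8 * real r ^ 10) * (1 / real (r + 1 + i) ^ 2)" by simp
    qed
    also have "\<dots> = 1 / (8 * real r ^ 10) * (\<Sum>d\<in>{r + 1..r + n}. 1 / real d ^ 2)"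
      unfolding sum_distrib_left[symmetric]
      by (intro arg_cong2[where f="(*)"] refl sum.reindex_bij_witness[of _ "\<lambda>d. d - (r + 1)" "\<lambda>i. r + 1 + i"]) auto
    also have "\<dots> \<le> 1 / (8 * real r ^ 10) * (2 / real (r + 1))"
      by (intro mult_left_mono sum_inverse_squares_le) auto
    also have "\<dots> \<le> 1 / (8 * real r ^ 10) * 2"
      by (intro mult_left_mono) (auto simp: field_simps)
    finally show ?thesis by simp
  qed
  have sum: "summable (\<lambda>i. prob (?A i))"
    by (rule summableI_nonneg_bounded[OF _ le]) simp
  have "{\<omega> \<in> space M. \<exists>d. d > r \<and> \<not> old_gone (a * \<mu> / 8) \<beta> d (\<lambda>i. Y i \<omega>)} = (\<Union>n. ?A n)"
  proof -
    have "\<exists>n. d = r + 1 + n" if "d > r" for d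
      using that by (intro exI[of _ "d - (r + 1)"]) simp
    then show ?thesis by fastforce
  qed
  also have "prob \<dots> \<le> (\<Sum>n. prob (?A n))"
    by (rule finite_measure_subadditive_countably[OF A sum])
  also have "\<dots> \<le> 1 / (4 * real r ^ 10)"
    by (rule suminf_le_const[OF sum le])
  finally show ?thesis .
qed

lemma no_success_prob:
  assumes r: "G * L \<le> r" "r > 0"
  shows "prob {\<omega> \<in> space M. \<forall>i\<in>{1..r}. \<not> success (trial r i) r (\<lambda>i. Y i \<omega>)} \<le> (1 - p_success) ^ r"
proof -
  let ?J = "\<lambda>i. coords (trial r i - int r) (p (trial r i) G)"
  define V where "V i \<omega> = (\<lambda>j\<in>?J i. Y j \<omega>)" for i \<omega>
  \<comment> \<open>One index set containing the coordinates of all trials, for which the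
    independence of \<open>Y\<close> is known.\<close>
  let ?I = "coords (- (3 * int r * int r) - int r) 0"
  have sub: "?J i \<subseteq> ?I" if "i \<in> {1..r}" for i
  proof -
    have "int r * int i \<le> int r * int r" using that by (intro mult_left_mono) auto
    then show ?thesis
      using trial_neg[OF r(1) that] by (auto simp: coords_def trial_def)
  qed
  have disj: "disjoint_family_on ?J {1..r}"
  proof -
    have sep: "p (trial r i) G < trial r j - int r" if "j < i" for i j
    proof -
      have "int r * (int j + 1) \<le> int r * int i" using that by (intro mult_left_mono) auto
      moreover have "int (G * L) \<le> int r" using r(1) by (simp only: of_nat_le_iff)
      moreover have "int r \<ge> 1" using r by simp
      ultimately show ?thesis unfolding p_def trial_def by (simp add: algebra_simps)
    qed
    have "?J i \<inter> ?J j = {}" if "i \<noteq> j" for i j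
    proof (cases "i < j")
      case True
      then show ?thesis using sep[of i j] by (auto simp: coords_def)
    next
      case False
      with that have "j < i" by simp
      then show ?thesis using sep[of j i] by (auto simp: coords_def)
    qed
    then show ?thesis by (auto simp: disjoint_family_on_def)
  qed
  have indep: "indep_vars (\<lambda>i. PiM (?J i) (\<lambda>_. borel)) V {1..r}"
    unfolding V_def[abs_def] by (rule indep_vars_restrict[OF Y_indep sub disj]) simp_all
  define A where "A i = {y \<in> space (PiM (?J i) (\<lambda>_. borel)). \<not> success (trial r i) r y}" for i
  have A: "A i \<in> sets (PiM (?J i) (\<lambda>_. borel))" for i
    unfolding A_def using increasing_success[of "trial r i" r]
    by (intro sets.sets_Collect_neg) (simp add: increasing_event_def)
  have VA: "V i -` A i \<inter> space M = {\<omega> \<in> space M. \<not> success (trial r i) r (\<lambda>i. Y i \<omega>)}" for i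
  proof -
    have "success (trial r i) r (V i \<omega>) \<longleftrightarrow> success (trial r i) r (\<lambda>j. Y j \<omega>)" for \<omega>
      unfolding V_def by (rule increasing_event_restrict[OF increasing_success])
    moreover have "V i \<omega> \<in> space (PiM (?J i) (\<lambda>_. borel))" for \<omega>
      by (simp add: V_def space_PiM)
    ultimately show ?thesis by (simp add: A_def vimage_def Int_def conj_commute)
  qed
  have "prob {\<omega> \<in> space M. \<forall>i\<in>{1..r}. \<not> success (trial r i) r (\<lambda>i. Y i \<omega>)} = prob (\<Inter>i\<in>{1..r}. V i -` A i \<inter> space M)"
  proof -
    have "1 \<in> {1..r}" using r by simp
    then show ?thesis
      unfolding VA by (intro arg_cong[where f=prob]) blast
  qed
  also have "\<dots> = (\<Prod>i\<in>{1..r}. prob (V i -` A i \<inter> space M))"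
    using r by (intro indep_varsD[OF indep] A) auto
  also have "\<dots> \<le> (\<Prod>i\<in>{1..r}. 1 - p_success)"
  proof (rule prod_mono, intro conjI)
    fix i assume i: "i \<in> {1..r}"
    have neg: "p (trial r i) G \<le> 0" using trial_neg(1)[OF r(1) i] by simp
    have "V i -` A i \<inter> space M = space M - {\<omega> \<in> space M. success (trial r i) r (\<lambda>i. Y i \<omega>)}"
      unfolding VA by auto
    then have "prob (V i -` A i \<inter> space M) = 1 - prob {\<omega> \<in> space M. success (trial r i) r (\<lambda>i. Y i \<omega>)}"
      using success_event[OF neg] by (simp add: prob_compl)
    also have "\<dots> \<le> 1 - p_success"
      using success_prob[OF neg, of r] by (simp add: p_success_def)
    finally show "prob (V i -` A i \<inter> space M) \<le> 1 - p_success" .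
  qed simp
  finally show ?thesis by simp
qed

lemma fails_event:
  assumes "G * L \<le> r"
  shows "fails r \<in> events"
proof -
  define A where "A i = {\<omega> \<in> space M. success (trial r i) r (\<lambda>i. Y i \<omega>)}" for i
  define B where "B i = {\<omega> \<in> space M. \<exists>d. d > r \<and> \<not> old_gone (a * \<mu> / 8) (trial r i) d (\<lambda>i. Y i \<omega>)}" for i
  have AB: "A i - B i \<in> events" if "i \<in> {1..r}" for i
    unfolding A_def B_def using trial_neg[OF assms that]
    by (intro sets.Diff success_event far_event) simp_all
  have "fails r = space M - (\<Union>i\<in>{1..r}. A i - B i)"
    unfolding fails_def A_def B_def by blast
  moreover have "(\<Union>i\<in>{1..r}. A i - B i) \<in> events"
    by (rule sets.finite_UN[OF finite_atLeastAtMost AB])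
  ultimately show ?thesis by simp
qed

text \<open>Either all trials fail on their own coordinates, or some trial meets a customer older
  than \<open>r\<close> who is still a threat. The first probability is geometric and is weakened to
  the eighth power of \<open>8 / (p_success * r)\<close>, so that \<open>p_success\<close> enters
  the final bound only polynomially.\<close>

lemma fails_prob:
  assumes r: "G * L \<le> r" "r > 0"
  shows "prob (fails r) \<le> (8 ^ 8 / p_success ^ 8 + 1) / real r ^ 8"
proof -
  let ?far = "\<lambda>i. {\<omega> \<in> space M. \<exists>d. d > r \<and> \<not> old_gone (a * \<mu> / 8) (trial r i) d (\<lambda>i. Y i \<omega>)}"
  let ?N = "{\<omega> \<in> space M. \<forall>i\<in>{1..r}. \<not> success (trial r i) r (\<lambda>i. Y i \<omega>)}"
  have N: "?N \<in> events"
  proof (intro sets.sets_Collect_finite_All sets.sets_Collect_neg)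
    fix i assume "i \<in> {1..r}"
    then show "{\<omega> \<in> space M. success (trial r i) r (\<lambda>i. Y i \<omega>)} \<in> events"
      using trial_neg[OF r(1)] by (intro success_event) force
  qed simp
  have far: "?far i \<in> events" if "i \<in> {1..r}" for i
    using trial_neg(2)[OF r(1) that] by (rule far_event)
  have U: "(\<Union>i\<in>{1..r}. ?far i) \<in> events" by (rule sets.finite_UN[OF finite_atLeastAtMost far])
  have "prob (fails r) \<le> prob (?N \<union> (\<Union>i\<in>{1..r}. ?far i))"
  proof (rule finite_measure_mono)
    show "fails r \<subseteq> ?N \<union> (\<Union>i\<in>{1..r}. ?far i)"
      unfolding fails_def by blast
  qed (rule sets.Un[OF N U])
  also have "\<dots> \<le> prob ?N + prob (\<Union>i\<in>{1..r}. ?far i)"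
    by (rule measure_Un_le[OF N U])
  also have "prob (\<Union>i\<in>{1..r}. ?far i) \<le> (\<Sum>i\<in>{1..r}. prob (?far i))"
    by (rule finite_measure_subadditive_finite[OF finite_atLeastAtMost]) (use far in blast)
  also have "\<dots> \<le> (\<Sum>i\<in>{1..r}. 1 / (4 * real r ^ 10))"
    using r trial_neg(2)[OF r(1)] by (intro sum_mono far_prob) auto
  also have "\<dots> \<le> 1 / real r ^ 8"
  proof -
    have "real r ^ 10 = real r ^ 8 * (real r * real r)"
      by (simp flip: power_Suc2 add: eval_nat_numeral mult.assoc)
    then have "real r * (1 / (4 * real r ^ 10)) = 1 / real r ^ 8 * (1 / (4 * real r))"
      using r by simp
    also have "\<dots> \<le> 1 / real r ^ 8 * 1"
      using r by (intro mult_left_mono) auto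
    finally show ?thesis by simp
  qed
  also have "prob ?N \<le> 8 ^ 8 / p_success ^ 8 / real r ^ 8"
  proof -
    have "prob ?N \<le> (1 - p_success) ^ r" by (rule no_success_prob[OF r])
    also have "\<dots> \<le> exp (- p_success) ^ r"
      using p_success_bounds exp_ge_add_one_self[of "- p_success"] by (intro power_mono) auto
    also have "\<dots> = 1 / exp (p_success * r / 8) ^ 8"
      by (simp add: exp_minus field_simps flip: exp_of_nat_mult exp_of_nat2_mult)
    also have "\<dots> \<le> 1 / (p_success * r / 8) ^ 8"
    proof -
      have "p_success * r / 8 \<le> exp (p_success * r / 8)"
        using exp_ge_add_one_self[of "p_success * r / 8"] by linarith
      then have "(p_success * r / 8) ^ 8 \<le> exp (p_success * r / 8) ^ 8"
        using p_success_bounds by (intro power_mono) auto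
      then show ?thesis
        using p_success_bounds r by (intro divide_left_mono) auto
    qed
    also have "\<dots> = 8 ^ 8 / p_success ^ 8 / real r ^ 8"
      by (simp add: power_mult_distrib power_divide)
    finally show ?thesis .
  qed
  finally show ?thesis by (simp add: add_divide_distrib)
qed

section \<open>From failure probabilities to the mean of \<open>\<bar>\<tau>\<bar>\<close>\<close>

lemma tau_ge_unless_fails:
  assumes "G * L \<le> r" "\<omega> \<in> space M" "\<omega> \<notin> fails r"
  shows "ereal (T (- (3 * int r * int r)) \<omega>) \<le> tau C (\<lambda>n. T n \<omega>) (\<lambda>n. S n \<omega>)"
proof -
  obtain i where i: "i \<in> {1..r}" "success (trial r i) r (\<lambda>i. Y i \<omega>)"
    "\<And>d. d > r \<Longrightarrow> old_gone (a * \<mu> / 8) (trial r i) d (\<lambda>i. Y i \<omega>)"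
    using assms by (auto simp: fails_def)
  have "int r * int i \<le> int r * int r" using i(1) by (intro mult_left_mono) auto
  then have "T (- (3 * int r * int r)) \<omega> \<le> T (trial r i) \<omega>"
    using assms(2) by (intro T_mono) (auto simp: trial_def)
  moreover have "ereal (T (trial r i) \<omega>) \<le> tau C (\<lambda>n. T n \<omega>) (\<lambda>n. S n \<omega>)"
    using trial_neg(1)[OF assms(1) i(1)] i(2,3) by (rule tau_ge_if_success[OF assms(2)])
  ultimately show ?thesis by (meson ereal_less_eq(3) order_trans)
qed

text \<open>The trials of level \<open>r\<close> start no earlier than customer
  \<open>- 3 * r^2\<close>. Time is measured back from \<open>T 0\<close>, leaving out the
  length-biased interval, so this is a sum of i.i.d. gaps.\<close>

definition past :: "nat \<Rightarrow> 'a \<Rightarrow> real" where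
  "past r \<omega> = T 0 \<omega> - T (- (3 * int r * int r)) \<omega>"

lemma past_measurable[measurable]: "past r \<in> borel_measurable M"
  unfolding past_def[abs_def] by (intro T_diff_measurable) auto

lemma past_mono: "\<omega> \<in> space M \<Longrightarrow> r \<le> r' \<Longrightarrow> past r \<omega> \<le> past r' \<omega>"
  unfolding past_def by (intro diff_left_mono T_mono) (auto intro!: mult_mono)

lemma past_nonneg: "\<omega> \<in> space M \<Longrightarrow> 0 \<le> past r \<omega>"
  unfolding past_def using T_mono[of \<omega> "- (3 * int r * int r)" 0] by simp

lemma past_1_pos: "\<omega> \<in> space M \<Longrightarrow> 0 < past 1 \<omega>"
  unfolding past_def using int_step_strict_mono[of "\<lambda>n. T n \<omega>" "-3" 0] T_step by simp

lemma past_sum: "past r \<omega> = (\<Sum>i\<in>{- (3 * int r * int r)..<0}. T (i + 1) \<omega> - T i \<omega>)"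
  unfolding past_def using sum_int_telescope[of "- (3 * int r * int r)" 0 "\<lambda>i. T i \<omega>"] by simp

lemma past_mean: "expectation (past r) = 3 * real r ^ 2 * \<mu> / s" "integrable M (past r)"
proof -
  have int: "integrable M (\<lambda>\<omega>. T (i + 1) \<omega> - T i \<omega>)" if "i \<in> {- (3 * int r * int r)..<0}" for i
  proof -
    have i: "i \<noteq> 0" using that by simp
    show ?thesis
      by (rule square_integrable_imp_integrable[OF gap_measurable[OF i] gap_moments(1)[OF i]])
  qed
  then show "integrable M (past r)"
    unfolding past_sum[abs_def] by (intro Bochner_Integration.integrable_sum)
  have "expectation (past r) = (\<Sum>i\<in>{- (3 * int r * int r)..<0}. expectation (\<lambda>\<omega>. T (i + 1) \<omega> - T i \<omega>))"
    unfolding past_sum[abs_def] using int by (rule Bochner_Integration.integral_sum)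
  also have "\<dots> = (\<Sum>i\<in>{- (3 * int r * int r)..<0}. \<mu> / s)"
    by (intro sum.cong gap_moments(3)) auto
  finally show "expectation (past r) = 3 * real r ^ 2 * \<mu> / s"
    by (simp add: power2_eq_square nat_mult_distrib)
qed

lemma past_square: "(\<integral>\<^sup>+\<omega>. ennreal ((past r \<omega>)\<^sup>2) \<partial>M) \<le> ennreal (9 * real r ^ 4 * m2 / s\<^sup>2)"
proof -
  let ?I = "{- (3 * int r * int r)..<0}"
  have card: "real (card ?I) = 3 * real r ^ 2"
    by (simp add: power2_eq_square nat_mult_distrib)
  have sq: "(past r \<omega>)\<^sup>2 \<le> (3 * real r ^ 2) * (\<Sum>i\<in>?I. (T (i + 1) \<omega> - T i \<omega>)\<^sup>2)" for \<omega>
    unfolding past_sum card[symmetric]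
    using sum_squared_le_sum_of_squares[of "\<lambda>i. T (i + 1) \<omega> - T i \<omega>" ?I] by (simp add: mult.commute)
  have int: "integrable M (\<lambda>\<omega>. (T (i + 1) \<omega> - T i \<omega>)\<^sup>2)" if "i \<in> ?I" for i
    using that by (intro gap_moments) auto
  have "(\<integral>\<^sup>+\<omega>. ennreal ((past r \<omega>)\<^sup>2) \<partial>M)
    \<le> (\<integral>\<^sup>+\<omega>. ennreal ((3 * real r ^ 2) * (\<Sum>i\<in>?I. (T (i + 1) \<omega> - T i \<omega>)\<^sup>2)) \<partial>M)"
    by (intro nn_integral_mono ennreal_leI sq)
  also have "\<dots> = ennreal (\<integral>\<omega>. (3 * real r ^ 2) * (\<Sum>i\<in>?I. (T (i + 1) \<omega> - T i \<omega>)\<^sup>2) \<partial>M)"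
    using int by (intro nn_integral_eq_integral integrable_mult_right Bochner_Integration.integrable_sum)
      (auto intro!: AE_I2 mult_nonneg_nonneg sum_nonneg)
  also have "(\<integral>\<omega>. (3 * real r ^ 2) * (\<Sum>i\<in>?I. (T (i + 1) \<omega> - T i \<omega>)\<^sup>2) \<partial>M)
      = (3 * real r ^ 2) * (\<Sum>i\<in>?I. expectation (\<lambda>\<omega>. (T (i + 1) \<omega> - T i \<omega>)\<^sup>2))"
    unfolding integral_mult_right_zero
    by (intro arg_cong2[where f="(*)"] refl Bochner_Integration.integral_sum int)
  also have "(\<Sum>i\<in>?I. expectation (\<lambda>\<omega>. (T (i + 1) \<omega> - T i \<omega>)\<^sup>2)) = (\<Sum>i\<in>?I. m2 / s\<^sup>2)"
    by (intro sum.cong gap_moments(2)) auto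
  also have "\<dots> = 3 * real r ^ 2 * (m2 / s\<^sup>2)"
    using card by simp
  also have "(3 * real r ^ 2) * (3 * real r ^ 2 * (m2 / s\<^sup>2)) = 9 * real r ^ 4 * m2 / s\<^sup>2"
    by (simp flip: power_add)
  finally show ?thesis .
qed

text \<open>Length biasing turns the mean of the straddling interval into a ratio of moments, the
  second moment of the scaled interarrival time over its mean.\<close>

lemma Len_mean: "(\<integral>\<^sup>+\<omega>. ennreal (T 1 \<omega> - T 0 \<omega>) \<partial>M) \<le> ennreal (m2 / (\<mu> * s))"
proof -
  have "(\<integral>\<^sup>+\<omega>. ennreal (T 1 \<omega> - T 0 \<omega>) \<partial>M) = (\<integral>\<^sup>+x. ennreal x \<partial>distr M borel (\<lambda>\<omega>. T 1 \<omega> - T 0 \<omega>))"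
    by (subst nn_integral_distr) auto
  also have "\<dots> = (\<integral>\<^sup>+x. ennreal (x / s / (\<mu> / s)) * ennreal (x / s) \<partial>DX)"
    unfolding len_distr by (subst nn_integral_density) (auto simp: nn_integral_distr)
  also have "\<dots> \<le> (\<integral>\<^sup>+x. ennreal (x\<^sup>2 / (\<mu> * s)) \<partial>DX)"
  proof (rule nn_integral_mono)
    fix x :: real
    show "ennreal (x / s / (\<mu> / s)) * ennreal (x / s) \<le> ennreal (x\<^sup>2 / (\<mu> * s))"
    proof (cases "0 \<le> x")
      case True
      then have "ennreal (x / s / (\<mu> / s)) * ennreal (x / s) = ennreal (x / s / (\<mu> / s) * (x / s))"
        using mu_pos s by (intro ennreal_mult'[symmetric]) auto
      also have "x / s / (\<mu> / s) * (x / s) = x\<^sup>2 / (\<mu> * s)"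
        using mu_pos s by (simp add: field_simps power2_eq_square)
      finally show ?thesis by simp
    next
      case False
      then have "x / s \<le> 0" using s by (simp add: divide_nonpos_pos)
      then show ?thesis by (simp add: ennreal_neg)
    qed
  qed
  also have "\<dots> = ennreal (\<integral>x. x\<^sup>2 / (\<mu> * s) \<partial>DX)"
    using DX(4) mu_pos s by (intro nn_integral_eq_integral) auto
  also have "(\<integral>x. x\<^sup>2 / (\<mu> * s) \<partial>DX) = m2 / (\<mu> * s)"
    by (simp add: m2_def)
  finally show ?thesis .
qed

text \<open>At the first level that does not fail, \<open>\<bar>\<tau>\<bar>\<close> is at most
  \<open>past\<close> plus \<open>- T 0\<close>, and the latter is below \<open>T 1 - T 0\<close>.
  Unless this is the level \<open>r0\<close>, the preceding one failed, and its term of the series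
  pays for \<open>past\<close>.\<close>

lemma abs_tau_le:
  assumes r0: "G * L \<le> r0" and \<omega>: "\<omega> \<in> space M"
  shows "e2ennreal \<bar>tau C (\<lambda>n. T n \<omega>) (\<lambda>n. S n \<omega>)\<bar>
    \<le> ennreal (T 1 \<omega> - T 0 \<omega>) + ennreal (past r0 \<omega>)
      + (\<Sum>n. ennreal (past (r0 + n + 1) \<omega>) * indicator (fails (r0 + n)) \<omega>)"
    (is "_ \<le> _ + _ + ?sum")
proof (cases "\<exists>n. \<omega> \<notin> fails (r0 + n)")
  case True
  define n where "n = (LEAST n. \<omega> \<notin> fails (r0 + n))"
  have n: "\<omega> \<notin> fails (r0 + n)" unfolding n_def using True by (rule LeastI_ex)
  have "ereal (T (- (3 * int (r0 + n) * int (r0 + n))) \<omega>) \<le> tau C (\<lambda>n. T n \<omega>) (\<lambda>n. S n \<omega>)"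
    using r0 by (intro tau_ge_unless_fails \<omega> n) simp
  then have "\<bar>tau C (\<lambda>n. T n \<omega>) (\<lambda>n. S n \<omega>)\<bar> \<le> ereal (- T (- (3 * int (r0 + n) * int (r0 + n))) \<omega>)"
    using tau_le_0[of C "\<lambda>n. T n \<omega>" "\<lambda>n. S n \<omega>"]
    by (cases "tau C (\<lambda>n. T n \<omega>) (\<lambda>n. S n \<omega>)") auto
  also have "\<dots> \<le> ereal ((T 1 \<omega> - T 0 \<omega>) + past (r0 + n) \<omega>)"
    using T_1[OF \<omega>] by (simp add: past_def)
  finally have "e2ennreal \<bar>tau C (\<lambda>n. T n \<omega>) (\<lambda>n. S n \<omega>)\<bar> \<le> ennreal ((T 1 \<omega> - T 0 \<omega>) + past (r0 + n) \<omega>)"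
    using e2ennreal_mono by fastforce
  also have "\<dots> = ennreal (T 1 \<omega> - T 0 \<omega>) + ennreal (past (r0 + n) \<omega>)"
    using T_step[OF \<omega>, of 0] past_nonneg[OF \<omega>] by (intro ennreal_plus) auto
  also have "ennreal (past (r0 + n) \<omega>) \<le> ennreal (past r0 \<omega>) + ?sum"
  proof (cases n)
    case 0
    then show ?thesis by simp
  next
    case (Suc m)
    then have "\<omega> \<in> fails (r0 + m)"
      using not_less_Least[of m "\<lambda>n. \<omega> \<notin> fails (r0 + n)"] by (simp add: n_def)
    then have "ennreal (past (r0 + n) \<omega>) = (\<Sum>n\<in>{m}. ennreal (past (r0 + n + 1) \<omega>) * indicator (fails (r0 + n)) \<omega>)"
      using Suc by simp
    also have "\<dots> \<le> ?sum" by (rule sum_le_suminf) auto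
    finally show ?thesis by (simp add: add_increasing)
  qed
  finally show ?thesis by (simp add: add.assoc add_left_mono)
next
  case False
  \<comment> \<open>If every level fails, all terms are at least the positive number
    \<open>past 1\<close>. The series is infinite and also covers
    \<open>\<tau> = -\<infinity>\<close>.\<close>
  have "of_nat N * ennreal (past 1 \<omega>) \<le> ?sum" for N
  proof -
    have "of_nat N * ennreal (past 1 \<omega>) = (\<Sum>n<N. ennreal (past 1 \<omega>))" by simp
    also have "\<dots> \<le> (\<Sum>n<N. ennreal (past (r0 + n + 1) \<omega>) * indicator (fails (r0 + n)) \<omega>)"
      using False past_mono[OF \<omega>] by (intro sum_mono) (auto intro!: ennreal_leI)
    also have "\<dots> \<le> ?sum" by (rule sum_le_suminf) auto
    finally show ?thesis .
  qed
  then have "?sum = top"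
  proof (rule_tac ccontr)
    assume le: "\<And>N. of_nat N * ennreal (past 1 \<omega>) \<le> ?sum" and "?sum \<noteq> top"
    then obtain c where c: "?sum = ennreal c" "c \<ge> 0" by (cases ?sum) auto
    obtain N where "c < real N * past 1 \<omega>"
      using reals_Archimedean3[OF past_1_pos[OF \<omega>]] by blast
    then have "ennreal c < of_nat N * ennreal (past 1 \<omega>)"
      using c(2) by (simp add: ennreal_of_nat_eq_real_of_nat ennreal_mult'[symmetric] ennreal_less_iff)
    with le[of N] c show False by simp
  qed
  then show ?thesis by simp
qed

text \<open>\<open>past\<close> and \<open>fails\<close> are dependent, so on failure
  \<open>past\<close> is bounded by \<open>past^2 / (2 * r^6) + r^6 / 2\<close>. Its second moment
  has order \<open>r^4\<close> and failure has order \<open>r^(-8)\<close>; the weight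
  \<open>r^6\<close> balances both terms at the summable order \<open>r^(-2)\<close>.\<close>

lemma tau_mean_le:
  "(\<integral>\<^sup>+\<omega>. e2ennreal \<bar>tau C (\<lambda>n. T n \<omega>) (\<lambda>n. S n \<omega>)\<bar> \<partial>M)
     \<le> ennreal (m2 / \<mu> + 3 * real (G * L) ^ 2 * \<mu> + 144 * m2 + 8 ^ 8 / p_success ^ 8 + 1)"
proof -
  define r0 where "r0 = G * L"
  define B where "B = 8 ^ 8 / p_success ^ 8 + 1"
  have r0: "r0 > 0" using a_pos L_pos by (simp add: r0_def)
  have B: "B \<ge> 0" using p_success_bounds by (simp add: B_def)
  define f where "f n \<omega> = ennreal (past (r0 + n + 1) \<omega>) * indicator (fails (r0 + n)) \<omega>" for n \<omega>
  have f_meas[measurable]: "f n \<in> borel_measurable M" for n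
    unfolding f_def[abs_def] using fails_event[of "r0 + n"] by (simp add: r0_def)
  have f_le: "(\<integral>\<^sup>+\<omega>. f n \<omega> \<partial>M) \<le> ennreal ((72 * m2 + B / 2) * (1 / real (r0 + n) ^ 2))" for n
  proof -
    define r where "r = r0 + n"
    have r: "G * L \<le> r" "r > 0" using r0 by (simp_all add: r_def r0_def)
    have "(\<integral>\<^sup>+\<omega>. f n \<omega> \<partial>M) \<le> (\<integral>\<^sup>+\<omega>. ennreal (1 / (2 * real r ^ 6)) * ennreal ((past (r + 1) \<omega>)\<^sup>2)
        + ennreal (real r ^ 6 / 2) * indicator (fails r) \<omega> \<partial>M)"
    proof (rule nn_integral_mono)
      fix \<omega> assume \<omega>: "\<omega> \<in> space M"
      have "past (r + 1) \<omega> \<le> 1 / (2 * real r ^ 6) * (past (r + 1) \<omega>)\<^sup>2 + real r ^ 6 / 2"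
      proof -
        have "0 \<le> (past (r + 1) \<omega> - real r ^ 6)\<^sup>2" by simp
        then have "2 * real r ^ 6 * past (r + 1) \<omega> \<le> (past (r + 1) \<omega>)\<^sup>2 + (real r ^ 6)\<^sup>2"
          by (simp add: power2_diff mult_ac)
        then have "past (r + 1) \<omega> \<le> ((past (r + 1) \<omega>)\<^sup>2 + (real r ^ 6)\<^sup>2) / (2 * real r ^ 6)"
          using r by (simp add: field_simps)
        also have "\<dots> = 1 / (2 * real r ^ 6) * (past (r + 1) \<omega>)\<^sup>2 + real r ^ 6 / 2"
        proof -
          have eq: "(x + z\<^sup>2) / (2 * z) = 1 / (2 * z) * x + z / 2" if "z > 0" for z x :: real
            using that by (simp add: field_simps power2_eq_square)
          show ?thesis by (rule eq) (use r in simp)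
        qed
        finally show ?thesis .
      qed
      then have "ennreal (past (r + 1) \<omega>) \<le> ennreal (1 / (2 * real r ^ 6)) * ennreal ((past (r + 1) \<omega>)\<^sup>2) + ennreal (real r ^ 6 / 2)"
        by (simp add: ennreal_mult'[symmetric] flip: ennreal_plus)
      then show "f n \<omega> \<le> ennreal (1 / (2 * real r ^ 6)) * ennreal ((past (r + 1) \<omega>)\<^sup>2) + ennreal (real r ^ 6 / 2) * indicator (fails r) \<omega>"
        by (auto simp: f_def r_def[symmetric] split: split_indicator)
    qed
    also have "\<dots> = ennreal (1 / (2 * real r ^ 6)) * (\<integral>\<^sup>+\<omega>. ennreal ((past (r + 1) \<omega>)\<^sup>2) \<partial>M)
        + ennreal (real r ^ 6 / 2) * emeasure M (fails r)"
      using fails_event[OF r(1)] by (simp add: nn_integral_add nn_integral_cmult)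
    also have "\<dots> \<le> ennreal (1 / (2 * real r ^ 6)) * ennreal (9 * real (r + 1) ^ 4 * m2 / s\<^sup>2)
        + ennreal (real r ^ 6 / 2) * ennreal (B / real r ^ 8)"
      using fails_prob[OF r] unfolding emeasure_eq_measure B_def
      by (intro add_mono mult_left_mono past_square ennreal_leI) auto
    also have "\<dots> = ennreal (1 / (2 * real r ^ 6) * (9 * real (r + 1) ^ 4 * m2 / s\<^sup>2) + real r ^ 6 / 2 * (B / real r ^ 8))"
      using m2_pos B s by (simp add: ennreal_mult'[symmetric] flip: ennreal_plus)
    also have "\<dots> \<le> ennreal ((72 * m2 + B / 2) * (1 / real r ^ 2))"
    proof (rule ennreal_leI)
      \<comment> \<open>The constant 72 is \<open>9 * 2^4 / 2\<close>, after
        \<open>r + 1 \<le> 2 * r\<close>.\<close>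
      have "real (r + 1) ^ 4 \<le> (2 * real r) ^ 4"
        using r by (intro power_mono) auto
      then have "9 * real (r + 1) ^ 4 * m2 / s\<^sup>2 \<le> 9 * (2 * real r) ^ 4 * m2 / 1"
        using m2_pos s by (intro frac_le mult_right_mono mult_left_mono) auto
      then have "1 / (2 * real r ^ 6) * (9 * real (r + 1) ^ 4 * m2 / s\<^sup>2) \<le> 1 / (2 * real r ^ 6) * (9 * (2 * real r) ^ 4 * m2 / 1)"
        by (intro mult_left_mono) auto
      also have "\<dots> = 72 * m2 * (1 / real r ^ 2)"
        using r by (simp add: field_simps power_mult_distrib flip: power_add)
      finally have 1: "1 / (2 * real r ^ 6) * (9 * real (r + 1) ^ 4 * m2 / s\<^sup>2) \<le> 72 * m2 * (1 / real r ^ 2)" .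
      have 2: "real r ^ 6 / 2 * (B / real r ^ 8) = B / 2 * (1 / real r ^ 2)"
        using r by (simp add: field_simps flip: power_add)
      show "1 / (2 * real r ^ 6) * (9 * real (r + 1) ^ 4 * m2 / s\<^sup>2) + real r ^ 6 / 2 * (B / real r ^ 8)
          \<le> (72 * m2 + B / 2) * (1 / real r ^ 2)"
        using 1 2 unfolding distrib_right by linarith
    qed
    finally show ?thesis by (simp add: r_def)
  qed
  have sum_le: "(\<Sum>n<N. (72 * m2 + B / 2) * (1 / real (r0 + n) ^ 2)) \<le> 144 * m2 + B" for N
  proof -
    have "(\<Sum>n<N. 1 / real (r0 + n) ^ 2) \<le> (\<Sum>d\<in>{r0..r0 + N}. 1 / real d ^ 2)"
      by (rule order_trans[OF eq_refl[OF sum.reindex_bij_witness[of _ "\<lambda>d. d - r0" "\<lambda>n. r0 + n" "{r0..<r0 + N}"]] sum_mono2]) auto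
    also have "\<dots> \<le> 2 / r0" by (rule sum_inverse_squares_le[OF r0])
    also have "\<dots> \<le> 2" using r0 by (simp add: field_simps)
    finally have "(72 * m2 + B / 2) * (\<Sum>n<N. 1 / real (r0 + n) ^ 2) \<le> (72 * m2 + B / 2) * 2"
      using m2_pos B by (intro mult_left_mono) auto
    then show ?thesis by (simp add: sum_distrib_left)
  qed
  have "(\<integral>\<^sup>+\<omega>. e2ennreal \<bar>tau C (\<lambda>n. T n \<omega>) (\<lambda>n. S n \<omega>)\<bar> \<partial>M)
     \<le> (\<integral>\<^sup>+\<omega>. ennreal (T 1 \<omega> - T 0 \<omega>) + ennreal (past r0 \<omega>) + (\<Sum>n. f n \<omega>) \<partial>M)"
    unfolding f_def by (intro nn_integral_mono abs_tau_le) (simp_all add: r0_def)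
  also have "\<dots> = (\<integral>\<^sup>+\<omega>. ennreal (T 1 \<omega> - T 0 \<omega>) \<partial>M) + (\<integral>\<^sup>+\<omega>. ennreal (past r0 \<omega>) \<partial>M) + (\<integral>\<^sup>+\<omega>. (\<Sum>n. f n \<omega>) \<partial>M)"
    by (simp add: nn_integral_add)
  also have "(\<integral>\<^sup>+\<omega>. (\<Sum>n. f n \<omega>) \<partial>M) = (\<Sum>n. \<integral>\<^sup>+\<omega>. f n \<omega> \<partial>M)"
    by (rule nn_integral_suminf) simp
  also have "\<dots> \<le> ennreal (144 * m2 + B)"
  proof (rule suminf_le_const)
    fix N
    have "(\<Sum>n<N. \<integral>\<^sup>+\<omega>. f n \<omega> \<partial>M) \<le> (\<Sum>n<N. ennreal ((72 * m2 + B / 2) * (1 / real (r0 + n) ^ 2)))"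
      by (intro sum_mono f_le)
    also have "\<dots> = ennreal (\<Sum>n<N. (72 * m2 + B / 2) * (1 / real (r0 + n) ^ 2))"
      using m2_pos B by (intro sum_ennreal mult_nonneg_nonneg) auto
    also have "\<dots> \<le> ennreal (144 * m2 + B)"
      by (intro ennreal_leI sum_le)
    finally show "(\<Sum>n<N. \<integral>\<^sup>+\<omega>. f n \<omega> \<partial>M) \<le> ennreal (144 * m2 + B)" .
  qed simp
  also have "(\<integral>\<^sup>+\<omega>. ennreal (past r0 \<omega>) \<partial>M) = ennreal (3 * real r0 ^ 2 * \<mu> / s)"
    using past_nonneg by (subst nn_integral_eq_integral) (auto simp: past_mean intro!: AE_I2)
  also note Len_mean
  finally have "(\<integral>\<^sup>+\<omega>. e2ennreal \<bar>tau C (\<lambda>n. T n \<omega>) (\<lambda>n. S n \<omega>)\<bar> \<partial>M)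
     \<le> ennreal (m2 / (\<mu> * s)) + ennreal (3 * real r0 ^ 2 * \<mu> / s) + ennreal (144 * m2 + B)"
    by (simp add: add_mono)
  also have "\<dots> = ennreal (m2 / (\<mu> * s) + 3 * real r0 ^ 2 * \<mu> / s + (144 * m2 + B))"
    using m2_pos B mu_pos s by (simp flip: ennreal_plus)
  also have "\<dots> \<le> ennreal (m2 / \<mu> + 3 * real r0 ^ 2 * \<mu> + (144 * m2 + B))"
  proof (intro ennreal_leI add_mono order_refl)
    show "m2 / (\<mu> * s) \<le> m2 / \<mu>"
      using m2_pos mu_pos s by (intro divide_left_mono) (auto simp: mult_le_cancel_left1)
    have "3 * real r0 ^ 2 * \<mu> / s \<le> 3 * real r0 ^ 2 * \<mu> / 1"
      using mu_pos s by (intro divide_left_mono) auto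
    then show "3 * real r0 ^ 2 * \<mu> / s \<le> 3 * real r0 ^ 2 * \<mu>" by simp
  qed
  finally show ?thesis by (simp add: r0_def B_def add.assoc)
qed

end

subsection \<open>The lower bound\<close>

context GI_data
begin

text \<open>Such intervals exhaust the positive half-line, which has full mass. Later
  \<open>c\<close> keeps the interval around time 0 from being too short, and \<open>B\<close> lets
  one service outlast it.\<close>

lemma X_interval: obtains c B :: real where "0 < c" "0 < measure DX {c..B}"
proof -
  have "\<exists>n::nat. 0 < measure DX {1 / real (Suc n)..real (Suc n)}"
  proof (rule ccontr)
    assume "\<not> ?thesis"
    then have "measure DX {1 / real (Suc n)..real (Suc n)} = 0" for n
      by (auto simp: not_less intro!: antisym)
    then have null: "{1 / real (Suc n)..real (Suc n)} \<in> null_sets DX" for n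
      using DX(1) by (auto simp: null_sets_def X.emeasure_eq_measure)
    then have "(\<Union>n. {1 / real (Suc n)..real (Suc n)}) \<in> null_sets DX"
      by (intro null_sets_UN)
    moreover have "{0<..} \<subseteq> (\<Union>n. {1 / real (Suc n)..real (Suc n)})"
    proof
      fix x :: real assume x: "x \<in> {0<..}"
      obtain n where n: "x < real n" using reals_Archimedean2 by blast
      obtain m where m: "1 / x < real m" using reals_Archimedean2 by blast
      have "1 / real (Suc (max m n)) \<le> x"
      proof -
        have "1 / x < real (Suc (max m n))" using m by simp
        then show ?thesis using x by (simp add: field_simps del: of_nat_Suc)
      qed
      moreover have "x \<le> real (Suc (max m n))" using n by simp
      ultimately show "x \<in> (\<Union>n. {1 / real (Suc n)..real (Suc n)})" by auto
    qed
    ultimately have "AE x in DX. \<not> x > 0"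
      by (intro AE_not_in[THEN eventually_mono]) auto
    with DX(3) have "AE x in DX. False" by eventually_elim simp
    then show False using X.AE_False by simp
  qed
  then obtain n where "0 < measure DX {1 / real (Suc n)..real (Suc n)}" by blast
  then show ?thesis by (intro that[of "1 / real (Suc n)"]) auto
qed

text \<open>Otherwise services would vanish almost surely, contradicting their positive
  mean.\<close>

lemma V_positive: obtains v :: real where "0 < v" "0 < measure DV {v<..}"
proof -
  have "\<exists>n::nat. 0 < measure DV {1 / real (Suc n)<..}"
  proof (rule ccontr)
    assume "\<not> ?thesis"
    then have "measure DV {1 / real (Suc n)<..} = 0" for n
      by (auto simp: not_less intro!: antisym)
    then have null: "{1 / real (Suc n)<..} \<in> null_sets DV" for n
      using DV(1) by (auto simp: null_sets_def V.emeasure_eq_measure)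
    then have "(\<Union>n. {1 / real (Suc n)<..}) \<in> null_sets DV"
      by (intro null_sets_UN)
    moreover have "{0<..} \<subseteq> (\<Union>n. {1 / real (Suc n)<..})"
    proof
      fix x :: real assume "x \<in> {0<..}"
      then obtain n where "inverse (real (Suc n)) < x" using reals_Archimedean by auto
      then show "x \<in> (\<Union>n. {1 / real (Suc n)<..})" by (auto simp: inverse_eq_divide)
    qed
    ultimately have "AE x in DV. \<not> x > 0"
      by (intro AE_not_in[THEN eventually_mono]) auto
    with DV(3) have "AE x in DV. x = 0" by eventually_elim simp
    then have "integral\<^sup>L DV (\<lambda>v. v) = 0"
      by (subst integral_cong_AE[where g="\<lambda>_. 0"]) auto
    with V_mean mu_pos show False by simp
  qed
  then obtain n where "0 < measure DV {1 / real (Suc n)<..}" by blast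
  then show ?thesis by (intro that[of "1 / real (Suc n)"]) auto
qed

end

context GI_queue
begin

text \<open>Ask that the interval around 0 has length between \<open>c / s\<close> and
  \<open>B / s\<close>, that 0 lies in its right half, and that customer 0 needs more than
  \<open>v\<close>. These events are independent; together they give
  \<open>T 0 \<le> - c / (2 * s)\<close> with customer 0 still present at time 0.\<close>

lemma tau_mean_ge:
  assumes c: "0 < c" and v: "B / s \<le> v"
  shows "ennreal (c / (2 * s) * (1 / 2 * (c / \<mu> * measure DX {c..B}) * measure DV {v<..}))
    \<le> (\<integral>\<^sup>+\<omega>. e2ennreal \<bar>tau C (\<lambda>n. T n \<omega>) (\<lambda>n. S n \<omega>)\<bar> \<partial>M)"
proof -
  \<comment> \<open>The default branch is meant for \<open>Serv 0\<close>, the only other index in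
    \<open>?J\<close>.\<close>
  define A where "A i = (case i of Len \<Rightarrow> {c / s..B / s} | Pos \<Rightarrow> {1 / 2..} | _ \<Rightarrow> {v<..})" for i
  have A: "A i \<in> sets borel" for i by (auto simp: A_def split: ren_idx.split)
  let ?J = "{Len, Pos, Serv 0}"
  define E where "E = (\<Inter>i\<in>?J. W i -` A i \<inter> space M)"
  have W_meas: "W i \<in> borel_measurable M" if "i \<in> ?J" for i
    using that by (intro W_measurable) auto
  have E_ev: "E \<in> events"
    unfolding E_def using A W_meas by (intro sets.finite_INT measurable_sets[of _ _ borel]) auto
  have "measure (distr M borel (\<lambda>\<omega>. T 1 \<omega> - T 0 \<omega>)) {c / s..B / s} \<ge> c / \<mu> * measure DX {c..B}"
  proof -
    have "ennreal (c / \<mu> * measure DX {c..B}) = ennreal (c / \<mu>) * emeasure DX {c..B}"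
      using c mu_pos unfolding X.emeasure_eq_measure by (intro ennreal_mult) auto
    also have "\<dots> = (\<integral>\<^sup>+x. ennreal (c / \<mu>) * indicator {c..B} x \<partial>DX)"
      using DX(1) by (simp add: nn_integral_cmult_indicator)
    \<comment> \<open>On the interval the length-biased density \<open>x / \<mu>\<close> is at least
      \<open>c / \<mu>\<close>.\<close>
    also have "\<dots> \<le> (\<integral>\<^sup>+x. ennreal (x / s / (\<mu> / s)) * indicator {c / s..B / s} (x / s) \<partial>DX)"
      using s mu_pos by (intro nn_integral_mono)
        (auto simp: indicator_def divide_right_mono intro!: ennreal_leI)
    also have "\<dots> = emeasure (density (distr DX borel (\<lambda>x. x / s)) (\<lambda>x. ennreal (x / (\<mu> / s)))) {c / s..B / s}"
      by (subst emeasure_density) (auto simp: nn_integral_distr)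
    also have "\<dots> = emeasure (distr M borel (\<lambda>\<omega>. T 1 \<omega> - T 0 \<omega>)) {c / s..B / s}"
      by (simp add: len_distr)
    finally show ?thesis
      using finite_measure.emeasure_eq_measure[OF finite_measure_distr[of "\<lambda>\<omega>. T 1 \<omega> - T 0 \<omega>" borel]]
      by (simp add: measure_nonneg)
  qed
  then have Len: "c / \<mu> * measure DX {c..B} \<le> prob (W Len -` A Len \<inter> space M)"
    by (subst (asm) measure_distr) (auto simp: A_def W_def[abs_def])
  have Pos: "prob (W Pos -` A Pos \<inter> space M) = 1 / 2"
  proof -
    have "W Pos \<in> borel_measurable M" by (rule W_meas) simp
    then have "prob (W Pos -` A Pos \<inter> space M) = measure (distr M borel (W Pos)) {1 / 2..}"
      by (subst measure_distr) (auto simp: A_def)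
    also have "distr M borel (W Pos) = distr M borel (\<lambda>\<omega>. (0 - T 0 \<omega>) / (T 1 \<omega> - T 0 \<omega>))"
      by (simp add: W_def[abs_def])
    also have "measure (distr M borel (\<lambda>\<omega>. (0 - T 0 \<omega>) / (T 1 \<omega> - T 0 \<omega>))) {1 / 2..}
        = measure (uniform_measure lborel {0..1}) {1 / 2 :: real..}"
      by (simp only: pos_distr)
    also have "\<dots> = 1 / 2"
    proof -
      have "{0..1} \<inter> {1 / 2..} = {1 / 2..1 :: real}" by auto
      then show ?thesis by (subst measure_uniform_measure) auto
    qed
    finally show ?thesis .
  qed
  have Serv: "prob (W (Serv 0) -` A (Serv 0) \<inter> space M) = measure DV {v<..}"
    using S_prob[of "{v<..}" 0] by (simp add: W_def[abs_def] A_def vimage_def Int_def conj_commute)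
  have "prob E = (\<Prod>i\<in>?J. prob (W i -` A i \<inter> space M))"
    unfolding E_def by (rule indep_varsD[OF W_indep]) (use A in auto)
  also have "\<dots> = prob (W Len -` A Len \<inter> space M) * (1 / 2) * measure DV {v<..}"
    by (simp add: Pos Serv)
  also have "\<dots> \<ge> (c / \<mu> * measure DX {c..B}) * (1 / 2) * measure DV {v<..}"
    using Len by (intro mult_right_mono) auto
  finally have PE: "prob E \<ge> 1 / 2 * (c / \<mu> * measure DX {c..B}) * measure DV {v<..}"
    by (simp add: mult_ac)
  have "ennreal (c / (2 * s) * (1 / 2 * (c / \<mu> * measure DX {c..B}) * measure DV {v<..}))
      \<le> ennreal (c / (2 * s) * prob E)"
    using PE c s by (intro ennreal_leI mult_left_mono) auto
  also have "\<dots> = ennreal (c / (2 * s)) * emeasure M E"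
    unfolding emeasure_eq_measure using c s by (intro ennreal_mult) auto
  also have "\<dots> = (\<integral>\<^sup>+\<omega>. ennreal (c / (2 * s)) * indicator E \<omega> \<partial>M)"
    using E_ev by (simp add: nn_integral_cmult_indicator)
  also have "\<dots> \<le> (\<integral>\<^sup>+\<omega>. e2ennreal \<bar>tau C (\<lambda>n. T n \<omega>) (\<lambda>n. S n \<omega>)\<bar> \<partial>M)"
  proof (rule nn_integral_mono)
    fix \<omega> assume \<omega>: "\<omega> \<in> space M"
    show "ennreal (c / (2 * s)) * indicator E \<omega> \<le> e2ennreal \<bar>tau C (\<lambda>n. T n \<omega>) (\<lambda>n. S n \<omega>)\<bar>"
    proof (cases "\<omega> \<in> E")
      case True
      then have len: "c / s \<le> T 1 \<omega> - T 0 \<omega>" "T 1 \<omega> - T 0 \<omega> \<le> B / s"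
        and pos: "1 / 2 \<le> - T 0 \<omega> / (T 1 \<omega> - T 0 \<omega>)" and S: "v < S 0 \<omega>"
        by (auto simp: E_def A_def W_def)
      have len0: "0 < T 1 \<omega> - T 0 \<omega>" using T_step[OF \<omega>, of 0] by simp
      have "1 / 2 * (c / s) \<le> 1 / 2 * (T 1 \<omega> - T 0 \<omega>)" using len by simp
      also have "\<dots> \<le> - T 0 \<omega>"
        using pos by (simp only: pos_le_divide_eq[OF len0])
      finally have T0: "c / (2 * s) \<le> - T 0 \<omega>" by simp
      have "T 0 \<omega> + S 0 \<omega> > 0"
        using T_1[OF \<omega>] len(2) v S by linarith
      then have "tau C (\<lambda>n. T n \<omega>) (\<lambda>n. S n \<omega>) \<le> ereal (T 0 \<omega>)"
        by (rule tau_le_arrival_0)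
      also have "\<dots> \<le> ereal (- (c / (2 * s)))" using T0 by simp
      finally have "ereal (c / (2 * s)) \<le> \<bar>tau C (\<lambda>n. T n \<omega>) (\<lambda>n. S n \<omega>)\<bar>"
        by (cases "tau C (\<lambda>n. T n \<omega>) (\<lambda>n. S n \<omega>)") auto
      from e2ennreal_mono[OF this] show ?thesis using True by simp
    qed simp
  qed
  finally show ?thesis .
qed

end

subsection \<open>Choice of the scales\<close>

context GI_data
begin

text \<open>Chosen so that the tube width \<open>\<eta> = K / sqrt s\<close> makes the grid exponent
  \<open>2 * \<eta>^2 * \<mu> * s / m2\<close> equal to 2.\<close>

definition K where "K = sqrt (m2 / \<mu>)"
text \<open>Excess of the required capacity over \<open>s\<close>, in units of
  \<open>sqrt s\<close>: \<open>2 * K\<close> for the slope \<open>1 - \<eta>\<close>,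
  \<open>6 * K / \<mu>\<close> for the offset \<open>3 * \<eta>\<close>, five for fluctuations and
  one for rounding.\<close>

definition b0 where "b0 = 2 * K + 6 * K / \<mu> + 6"

lemma K_pos: "K > 0"
  using m2_pos mu_pos by (simp add: K_def)

text \<open>About \<open>s powr \<kappa>\<close> blocks make up \<open>s\<close> customers, that is,
  one mean service time.\<close>

definition blocks :: "real \<Rightarrow> real \<Rightarrow> nat" where "blocks \<kappa> s = nat \<lceil>s powr \<kappa>\<rceil>"
definition block_length :: "real \<Rightarrow> real \<Rightarrow> nat" where "block_length \<kappa> s = nat \<lceil>s / blocks \<kappa> s\<rceil>"

text \<open>In \<open>q\<close>, twelve powers produce the decay \<open>d^(-12)\<close> for old
  customers. The others act on \<open>a\<close>, and \<open>\<kappa> * (q - 12) \<ge> 13\<close>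
  turns them into \<open>s^13\<close>, which absorbs a factor \<open>s^12\<close> and leaves
  \<open>1 / s\<close>.\<close>

lemma large_scale_conditions:
  assumes \<kappa>: "0 < \<kappa>" "\<kappa> < 1"
  defines "q \<equiv> 12 + nat \<lceil>13 / \<kappa>\<rceil>"
  shows "\<forall>\<^sub>F s in at_top. 1 \<le> s \<and> b0 \<le> sqrt s \<and> K / sqrt s \<le> 1 / 2 \<and> 12 * (K / sqrt s) \<le> \<mu>
    \<and> 9 * s\<^sup>2 * exp (- (K\<^sup>2 / (4 * m2) * s powr \<kappa>)) \<le> 1 / 2
    \<and> 3 * s * exp (- (s powr \<kappa> / 4)) \<le> 1 / 4
    \<and> 9 * mv q * (4 / \<mu>) ^ q / s \<le> 1 / 2
    \<and> mv q * (2 / \<mu>) ^ 12 * (8 / \<mu>) ^ (q - 12) / s \<le> 1 / 16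
    \<and> (12 / (\<mu>\<^sup>2 / (8 * m2))) ^ 12 * exp (- (\<mu>\<^sup>2 / (16 * m2) * s)) \<le> 1 / 16
    \<and> 2 * s powr \<kappa> \<le> s"
proof -
  have *: "\<forall>\<^sub>F s in at_top. f s \<le> c" if "(f \<longlongrightarrow> 0) at_top" "0 < c" for f :: "real \<Rightarrow> real" and c
    using order_tendstoD(2)[OF that] by eventually_elim simp
  have lim1: "((\<lambda>s. 9 * s\<^sup>2 * exp (- (c * s powr \<kappa>))) \<longlongrightarrow> 0) at_top" if "0 < c" for c
    using that \<kappa> by real_asymp
  have lim2: "((\<lambda>s. c' * exp (- (c * s))) \<longlongrightarrow> 0) at_top" if "0 < c" for c c' :: real
    using that by real_asymp
  have c: "0 < K\<^sup>2 / (4 * m2)" "0 < \<mu>\<^sup>2 / (16 * m2)"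
    using K_pos m2_pos mu_pos by simp_all
  show ?thesis
  proof (intro eventually_conj)
    show "\<forall>\<^sub>F s in at_top. 1 \<le> (s :: real)" by real_asymp
    show "\<forall>\<^sub>F s in at_top. b0 \<le> sqrt s" by real_asymp
    show "\<forall>\<^sub>F s in at_top. K / sqrt s \<le> 1 / 2" by (rule *, real_asymp, simp)
    show "\<forall>\<^sub>F s in at_top. 12 * (K / sqrt s) \<le> \<mu>" by (rule *[OF _ mu_pos]) real_asymp
    show "\<forall>\<^sub>F s in at_top. 9 * s\<^sup>2 * exp (- (K\<^sup>2 / (4 * m2) * s powr \<kappa>)) \<le> 1 / 2"
      by (rule *[OF lim1[OF c(1)]]) simp
    show "\<forall>\<^sub>F s in at_top. 3 * s * exp (- (s powr \<kappa> / 4)) \<le> 1 / 4"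
      using \<kappa> by (intro *, real_asymp, simp)
    show "\<forall>\<^sub>F s in at_top. 9 * mv q * (4 / \<mu>) ^ q / s \<le> 1 / 2" by (rule *, real_asymp, simp)
    show "\<forall>\<^sub>F s in at_top. mv q * (2 / \<mu>) ^ 12 * (8 / \<mu>) ^ (q - 12) / s \<le> 1 / 16" by (rule *, real_asymp, simp)
    show "\<forall>\<^sub>F s in at_top. (12 / (\<mu>\<^sup>2 / (8 * m2))) ^ 12 * exp (- (\<mu>\<^sup>2 / (16 * m2) * s)) \<le> 1 / 16"
      by (rule *[OF lim2[OF c(2)]]) simp
    show "\<forall>\<^sub>F s in at_top. 2 * s powr \<kappa> \<le> s"
      using \<kappa> by real_asymp
  qed
qed

lemma blocks_bounds:
  assumes \<kappa>: "0 < \<kappa>" and s: "1 \<le> s" "2 * s powr \<kappa> \<le> s"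
  defines "a \<equiv> blocks \<kappa> s" and "L \<equiv> block_length \<kappa> s"
  shows "s powr \<kappa> \<le> a" "a \<le> 2 * s powr \<kappa>" "1 \<le> real a" "1 \<le> L" "s \<le> a * L" "real L \<le> 2 * s / a" "real L \<le> 2 * s"
proof -
  have p1: "1 \<le> s powr \<kappa>" using s \<kappa> by (simp add: ge_one_powr_ge_zero)
  show a1: "s powr \<kappa> \<le> a" unfolding a_def blocks_def by (rule of_nat_ceiling)
  show a2: "a \<le> 2 * s powr \<kappa>"
    unfolding a_def blocks_def using p1 by (simp; linarith)
  show a3: "1 \<le> real a" using a1 p1 by simp
  have L1: "s / a \<le> L" unfolding L_def block_length_def a_def[symmetric] by (rule of_nat_ceiling)
  then show "s \<le> a * L" using a3 by (simp add: field_simps)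
  have "0 < s / a" using s a3 by simp
  with L1 show "1 \<le> L" by linarith
  have sa: "1 \<le> s / a" using s a2 a3 by (simp add: le_divide_eq)
  have "L \<le> s / a + 1"
    unfolding L_def block_length_def a_def[symmetric] using sa by (simp; linarith)
  with sa show L2: "real L \<le> 2 * s / a" by simp
  also have "\<dots> \<le> 2 * s / 1" using a3 s by (intro divide_left_mono) auto
  finally show "real L \<le> 2 * s" by simp
qed

lemma window_if_large:
  assumes queue: "GI_queue DX DV M T S s"
    and \<kappa>: "0 < \<kappa>" and q: "q = 12 + nat \<lceil>13 / \<kappa>\<rceil>"
    and s: "1 \<le> s" "b0 \<le> sqrt s" and \<eta>: "K / sqrt s \<le> 1 / 2" "12 * (K / sqrt s) \<le> \<mu>"
    and e1: "9 * s\<^sup>2 * exp (- (K\<^sup>2 / (4 * m2) * s powr \<kappa>)) \<le> 1 / 2"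
    and e2: "3 * s * exp (- (s powr \<kappa> / 4)) \<le> 1 / 4"
    and e3: "9 * mv q * (4 / \<mu>) ^ q / s \<le> 1 / 2"
    and e4: "mv q * (2 / \<mu>) ^ 12 * (8 / \<mu>) ^ (q - 12) / s \<le> 1 / 16"
    and e5: "(12 / (\<mu>\<^sup>2 / (8 * m2))) ^ 12 * exp (- (\<mu>\<^sup>2 / (16 * m2) * s)) \<le> 1 / 16"
    and e6: "2 * s powr \<kappa> \<le> s"
    and b: "b0 \<le> b"
  shows "window DX DV M T S s (blocks \<kappa> s) (block_length \<kappa> s) q (K / sqrt s) (s + b * sqrt s)"
proof -
  define a where "a = blocks \<kappa> s"
  define L where "L = block_length \<kappa> s"
  note aL = blocks_bounds[OF \<kappa> s(1) e6, folded a_def L_def]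
  have s0: "0 < s" and sq0: "0 < sqrt s" using s by auto
  have a0: "0 < real a" and L0: "0 < real L" using aL by auto
  define \<eta>' where "\<eta>' = K / sqrt s"
  have \<eta>'0: "0 < \<eta>'" using K_pos sq0 by (simp add: \<eta>'_def)
  have \<eta>s: "\<eta>' * s = K * sqrt s"
    using sq0 by (simp add: \<eta>'_def field_simps flip: power2_eq_square)
  have \<eta>2s: "\<eta>'\<^sup>2 * s = K\<^sup>2"
    using s0 by (simp add: \<eta>'_def power_divide)
  have exp_le: "exp (- x) \<le> exp (- y)" if "y \<le> x" for x y :: real using that by simp
  \<comment> \<open>\<open>1 / (1 - \<eta>)\<close> is at most \<open>1 + 2 * \<eta>\<close>, and
    \<open>\<eta> * s = K * sqrt s\<close>, so every correction to \<open>s\<close> is a multiple of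
    \<open>sqrt s\<close>.\<close>
  have mean: "(\<mu> + 3 * \<eta>') / (\<mu> / s * (1 - \<eta>')) + 1 + 5 * sqrt s \<le> s + b0 * sqrt s"
  proof -
    have h: "\<eta>' \<le> 1 / 2" using \<eta> by (simp add: \<eta>'_def)
    have "1 \<le> (1 + 2 * \<eta>') * (1 - \<eta>')"
      using \<eta>'0 h by (simp add: algebra_simps)
    then have "1 / (1 - \<eta>') \<le> 1 + 2 * \<eta>'"
      using h by (simp add: divide_le_eq)
    then have "(1 + 3 * \<eta>' / \<mu>) * s * (1 / (1 - \<eta>')) \<le> (1 + 3 * \<eta>' / \<mu>) * s * (1 + 2 * \<eta>')"
      using \<eta>'0 mu_pos s0 by (intro mult_left_mono) auto
    also have "\<dots> = s + 2 * (\<eta>' * s) + (3 / \<mu>) * (\<eta>' * s) * (1 + 2 * \<eta>')"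
      by (simp add: algebra_simps)
    also have "\<dots> \<le> s + 2 * (\<eta>' * s) + (3 / \<mu>) * (\<eta>' * s) * 2"
      using \<eta>'0 mu_pos s0 h by (intro add_left_mono mult_left_mono) auto
    also have "\<dots> = s + (2 * K + 6 * K / \<mu>) * sqrt s"
      unfolding \<eta>s by (simp add: algebra_simps)
    finally have "(1 + 3 * \<eta>' / \<mu>) * s * (1 / (1 - \<eta>')) \<le> s + (2 * K + 6 * K / \<mu>) * sqrt s" .
    moreover have "(\<mu> + 3 * \<eta>') / (\<mu> / s * (1 - \<eta>')) = (1 + 3 * \<eta>' / \<mu>) * s * (1 / (1 - \<eta>'))"
      using mu_pos s0 h by (simp add: field_simps)
    moreover have "1 \<le> sqrt s" using s by simp
    moreover have "b0 * sqrt s = (2 * K + 6 * K / \<mu>) * sqrt s + 6 * sqrt s"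
      by (simp add: b0_def distrib_right)
    ultimately show ?thesis by linarith
  qed
  show ?thesis
    unfolding a_def[symmetric] L_def[symmetric] \<eta>'_def[symmetric]
  proof (rule window.intro[OF queue], unfold_locales)
    show "0 < L" "0 < a" using a0 L0 by simp_all
    show "s \<le> a * L" using aL by simp
    show "0 < \<eta>'" by fact
    show "\<eta>' \<le> 1 / 2" using \<eta> by (simp add: \<eta>'_def)
    show "12 * \<eta>' \<le> a * \<mu>"
    proof -
      have "12 * \<eta>' \<le> 1 * \<mu>" using \<eta> by (simp add: \<eta>'_def)
      also have "\<dots> \<le> a * \<mu>" using aL mu_pos by (intro mult_right_mono) auto
      finally show ?thesis .
    qed
    show "exp (- (2 * \<eta>'\<^sup>2 * \<mu> * s / m2)) \<le> 1 / 2"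
    proof -
      have "2 * \<eta>'\<^sup>2 * \<mu> * s / m2 = 2 * (\<eta>'\<^sup>2 * s) * \<mu> / m2" by simp
      also have "\<dots> = 2" using mu_pos m2_pos by (simp add: \<eta>2s K_def)
      finally have "exp (- (2 * \<eta>'\<^sup>2 * \<mu> * s / m2)) = 1 / exp 2" by (simp add: exp_minus inverse_eq_divide)
      also have "\<dots> \<le> 1 / 2"
        using exp_ge_add_one_self[of "2 :: real"] by (intro divide_left_mono) auto
      finally show ?thesis .
    qed
    show "(L + 1)\<^sup>2 * exp (- (\<eta>'\<^sup>2 * s\<^sup>2 / (2 * L * m2))) \<le> 1 / 2"
    proof -
      have "(real L + 1)\<^sup>2 \<le> (3 * s)\<^sup>2" using aL s by (intro power_mono) auto
      \<comment> \<open>The exponent is \<open>K^2 * s / (2 * L * m2)\<close>, and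
        \<open>L \<le> 2 * s / a\<close> makes it grow at least like
        \<open>s powr \<kappa>\<close>.\<close>
      moreover have "K\<^sup>2 / (4 * m2) * s powr \<kappa> \<le> \<eta>'\<^sup>2 * s\<^sup>2 / (2 * L * m2)"
      proof -
        have "K\<^sup>2 / (4 * m2) * s powr \<kappa> \<le> K\<^sup>2 / (4 * m2) * a"
          using aL m2_pos by (intro mult_left_mono) auto
        also have "\<dots> = K\<^sup>2 * s / (2 * (2 * s / a) * m2)"
          using s0 a0 by (simp add: field_simps)
        also have "\<dots> \<le> K\<^sup>2 * s / (2 * L * m2)"
          using aL L0 a0 s0 m2_pos by (intro divide_left_mono mult_right_mono mult_left_mono mult_pos_pos) auto
        also have "K\<^sup>2 * s = \<eta>'\<^sup>2 * s\<^sup>2" unfolding \<eta>2s[symmetric] by (simp add: power2_eq_square)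
        finally show ?thesis .
      qed
      ultimately have "(real L + 1)\<^sup>2 * exp (- (\<eta>'\<^sup>2 * s\<^sup>2 / (2 * L * m2)))
          \<le> (3 * s)\<^sup>2 * exp (- (K\<^sup>2 / (4 * m2) * s powr \<kappa>))"
        by (intro mult_mono exp_le) auto
      also have "\<dots> \<le> 1 / 2" using e1 by (simp add: power_mult_distrib)
      finally show ?thesis by (simp add: add.commute)
    qed
    show "(L + 1) * exp (- (s / (2 * L))) \<le> 1 / 4"
    proof -
      have "s powr \<kappa> / 4 \<le> a / 4" using aL by simp
      also have "\<dots> = s / (2 * (2 * s / a))" using s0 a0 by simp
      also have "\<dots> \<le> s / (2 * L)"
        using aL L0 a0 s0 by (intro divide_left_mono mult_left_mono mult_pos_pos) auto
      finally have "(real L + 1) * exp (- (s / (2 * L))) \<le> 3 * s * exp (- (s powr \<kappa> / 4))"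
        using aL s by (intro mult_mono exp_le) auto
      with e2 show ?thesis by (simp add: add.commute)
    qed
    show "(\<mu> + 3 * \<eta>') / (\<mu> / s * (1 - \<eta>')) + 1 \<le> 2 * s"
    proof -
      have "b0 * sqrt s \<le> sqrt s * sqrt s" using s by (intro mult_right_mono) auto
      moreover have "sqrt s * sqrt s = s" using s0 by simp
      ultimately show ?thesis using mean sq0 by linarith
    qed
    show "(\<mu> + 3 * \<eta>') / (\<mu> / s * (1 - \<eta>')) + 1 + 5 * sqrt s \<le> s + b * sqrt s"
    proof -
      have "b0 * sqrt s \<le> b * sqrt s" using b sq0 by (intro mult_right_mono) auto
      with mean show ?thesis by linarith
    qed
    have q13: "13 \<le> \<kappa> * real (q - 12)"
    proof -
      have "13 / \<kappa> \<le> real (q - 12)" unfolding q by simp linarith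
      then have "\<kappa> * (13 / \<kappa>) \<le> \<kappa> * real (q - 12)"
        using \<kappa> by (intro mult_left_mono) auto
      moreover have "\<kappa> * (13 / \<kappa>) = 13" using \<kappa> by simp
      ultimately show ?thesis by linarith
    qed
    have a_pow: "s ^ m \<le> real a ^ k" if "real m \<le> \<kappa> * real k" for m k
    proof -
      have "s ^ m = s powr real m" using s0 by (simp add: powr_realpow)
      also have "\<dots> \<le> s powr (\<kappa> * real k)" using that s by (intro powr_mono) auto
      also have "\<dots> = (s powr \<kappa>) ^ k" using s0 by (simp add: powr_powr[symmetric] powr_realpow)
      also have "\<dots> \<le> real a ^ k" using aL by (intro power_mono) auto
      finally show ?thesis .
    qed
    show "real (2 * a\<^sup>2 * L + 1) * (mv q / (a * \<mu> / 4) ^ q) \<le> 1 / 2"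
    proof -
      have "real a \<le> s" using aL e6 by simp
      have "real a * real L \<le> 2 * s" using aL(6) a0 by (simp add: field_simps)
      then have "2 * real a * (real a * real L) \<le> 2 * s * (2 * s)"
        using \<open>real a \<le> s\<close> s0 by (intro mult_mono[of "2 * real a" "2 * s"]) auto
      moreover have "1 \<le> s * s" using s mult_mono[of 1 s 1 s] by simp
      ultimately have "real (2 * a\<^sup>2 * L + 1) \<le> 9 * s\<^sup>2"
      proof -
        assume 1: "2 * real a * (real a * real L) \<le> 2 * s * (2 * s)" and 2: "1 \<le> s * s"
        have "real (2 * a\<^sup>2 * L + 1) = 2 * real a * (real a * real L) + 1"
          by (simp add: power2_eq_square)
        also have "\<dots> \<le> 2 * s * (2 * s) + s * s" using 1 2 by (rule add_mono)
        also have "\<dots> \<le> 9 * s\<^sup>2" by (simp add: power2_eq_square)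
        finally show ?thesis .
      qed
      \<comment> \<open>One power more than the order \<open>s^2\<close> of the number of services
        in the window.\<close>
      moreover have "s ^ 3 \<le> real a ^ q"
      proof (rule a_pow)
        have "\<kappa> * real (q - 12) \<le> \<kappa> * real q" using \<kappa> by (intro mult_left_mono) auto
        with q13 show "real 3 \<le> \<kappa> * real q" by linarith
      qed
      then have "mv q / (a * \<mu> / 4) ^ q \<le> mv q * (4 / \<mu>) ^ q / s ^ 3"
      proof -
        assume "s ^ 3 \<le> real a ^ q"
        have "mv q / (a * \<mu> / 4) ^ q = mv q * (4 / \<mu>) ^ q / real a ^ q"
          by (simp add: power_divide power_mult_distrib)
        also have "\<dots> \<le> mv q * (4 / \<mu>) ^ q / s ^ 3"
          using \<open>s ^ 3 \<le> real a ^ q\<close> mv_nonneg mu_pos s0 a0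
          by (intro divide_left_mono mult_nonneg_nonneg mult_pos_pos) auto
        finally show ?thesis .
      qed
      ultimately have "real (2 * a\<^sup>2 * L + 1) * (mv q / (a * \<mu> / 4) ^ q) \<le> 9 * s\<^sup>2 * (mv q * (4 / \<mu>) ^ q / s ^ 3)"
        using mv_nonneg mu_pos a0 by (intro mult_mono) auto
      also have "\<dots> = 9 * mv q * (4 / \<mu>) ^ q / s"
        using s0 by (simp add: power2_eq_square power3_eq_cube)
      finally show ?thesis using e3 by linarith
    qed
    fix d :: nat assume d: "0 < d"
    show "exp (- ((real d * (\<mu> / s) / 2 + a * \<mu> / 8)\<^sup>2 * s\<^sup>2 / (2 * real d * m2)))
        + mv q / (d * (\<mu> / s) / 2 + a * \<mu> / 8) ^ q \<le> 1 / (8 * real d ^ 12)"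
    proof -
      define x where "x = real d * (\<mu> / s) / 2"
      define y where "y = a * \<mu> / 8"
      define c where "c = \<mu>\<^sup>2 / (8 * m2)"
      have xy: "0 < x" "0 < y" using d mu_pos s0 a0 by (simp_all add: x_def y_def)
      have c0: "0 < c" using mu_pos m2_pos by (simp add: c_def)
      have "exp (- ((x + y)\<^sup>2 * s\<^sup>2 / (2 * real d * m2))) \<le> 1 / (16 * real d ^ 12)"
      proof -
        \<comment> \<open>The square gives a term linear in \<open>d\<close>, for decay in the age.
          The cross term does not depend on \<open>d\<close> and makes the bound small in
          \<open>s\<close>.\<close>
        have "x\<^sup>2 + 2 * x * y \<le> (x + y)\<^sup>2" by (simp add: power2_sum)
        then have "(x\<^sup>2 + 2 * x * y) * s\<^sup>2 / (2 * real d * m2) \<le> (x + y)\<^sup>2 * s\<^sup>2 / (2 * real d * m2)"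
          using m2_pos by (intro divide_right_mono mult_right_mono) auto
        also have "(x\<^sup>2 + 2 * x * y) * s\<^sup>2 / (2 * real d * m2) = c * d + \<mu>\<^sup>2 / (16 * m2) * (a * s)"
          using s0 d m2_pos by (simp add: x_def y_def c_def field_simps power2_eq_square)
        finally have "c * d + \<mu>\<^sup>2 / (16 * m2) * (a * s) \<le> (x + y)\<^sup>2 * s\<^sup>2 / (2 * real d * m2)" .
        moreover have "\<mu>\<^sup>2 / (16 * m2) * s \<le> \<mu>\<^sup>2 / (16 * m2) * (a * s)"
          using aL s0 m2_pos by (intro mult_left_mono) auto
        ultimately have "exp (- ((x + y)\<^sup>2 * s\<^sup>2 / (2 * real d * m2))) \<le> exp (- (c * d + \<mu>\<^sup>2 / (16 * m2) * s))"
          by (intro exp_le) linarith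
        also have "\<dots> = exp (- (c * d)) * exp (- (\<mu>\<^sup>2 / (16 * m2) * s))"
          by (simp flip: exp_add)
        also have "exp (- (c * d)) \<le> (12 / c) ^ 12 / real d ^ 12"
        proof -
          have "c * d / 12 \<le> exp (c * d / 12)"
            using exp_ge_add_one_self[of "c * d / 12"] by linarith
          then have "(c * d / 12) ^ 12 \<le> exp (c * d / 12) ^ 12"
            using c0 by (intro power_mono) auto
          also have "exp (c * d / 12) ^ 12 = exp (c * d)"
            by (simp flip: exp_of_nat_mult)
          finally have "1 / exp (c * d) \<le> 1 / (c * d / 12) ^ 12"
            using c0 d by (intro divide_left_mono) auto
          then show ?thesis by (simp add: exp_minus inverse_eq_divide power_divide power_mult_distrib)
        qed
        also have "(12 / c) ^ 12 / real d ^ 12 * exp (- (\<mu>\<^sup>2 / (16 * m2) * s))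
            = (12 / c) ^ 12 * exp (- (\<mu>\<^sup>2 / (16 * m2) * s)) / real d ^ 12" by simp
        also have "\<dots> \<le> 1 / 16 / real d ^ 12"
          using e5 unfolding c_def by (intro divide_right_mono) auto
        finally show ?thesis by (simp add: mult_right_mono)
      qed
      moreover have "mv q / (x + y) ^ q \<le> 1 / (16 * real d ^ 12)"
      proof -
        have ap: "s ^ 13 \<le> real a ^ (q - 12)"
          by (rule a_pow) (use q13 in \<open>simp only: of_nat_numeral\<close>)
        \<comment> \<open>Split the \<open>q\<close> powers: twelve on the part proportional to
          \<open>d\<close>, the remaining ones on the part proportional to \<open>a\<close>.\<close>
        have "x ^ 12 * y ^ (q - 12) \<le> (x + y) ^ 12 * (x + y) ^ (q - 12)"
          using xy by (intro mult_mono power_mono) auto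
        also have "\<dots> = (x + y) ^ q" unfolding q by (simp flip: power_add)
        finally have "mv q / (x + y) ^ q \<le> mv q / (x ^ 12 * y ^ (q - 12))"
          using xy mv_nonneg by (intro divide_left_mono) auto
        also have "\<dots> = mv q * (2 / \<mu>) ^ 12 * (8 / \<mu>) ^ (q - 12) * s ^ 12 / (real a ^ (q - 12) * real d ^ 12)"
          using s0 d mu_pos by (simp add: x_def y_def power_divide power_mult_distrib mult_ac)
        also have "\<dots> \<le> mv q * (2 / \<mu>) ^ 12 * (8 / \<mu>) ^ (q - 12) * s ^ 12 / (s ^ 13 * real d ^ 12)"
          using ap mv_nonneg mu_pos s0 a0 d
          by (intro divide_left_mono mult_right_mono mult_nonneg_nonneg mult_pos_pos) auto
        also have "\<dots> = mv q * (2 / \<mu>) ^ 12 * (8 / \<mu>) ^ (q - 12) / s / real d ^ 12"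
          using s0 by (simp add: eval_nat_numeral)
        also have "\<dots> \<le> 1 / 16 / real d ^ 12"
          using e4 by (intro divide_right_mono) auto
        finally show ?thesis by simp
      qed
      ultimately show ?thesis by (simp add: x_def y_def)
    qed
  qed
qed

end

context window
begin

text \<open>With \<open>G = 2 * a^2\<close> the success exponent is at most \<open>16 * a^4\<close>,
  hence at most \<open>256 * s powr (4 * \<kappa>)\<close>. The eighth power of
  \<open>1 / p_success\<close> turns 256 into 2048, and everything else is polynomial in
  \<open>s\<close>.\<close>

lemma tau_mean_le_powr:
  assumes a: "real a \<le> 2 * s powr \<kappa>" "2 * s powr \<kappa> \<le> s" and L: "real L \<le> 2 * s / a"
  shows "(\<integral>\<^sup>+\<omega>. e2ennreal \<bar>tau C (\<lambda>n. T n \<omega>) (\<lambda>n. S n \<omega>)\<bar> \<partial>M)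
    \<le> ennreal ((m2 / \<mu> + 48 * \<mu> + 144 * m2 + 8 ^ 8 + 1) * s ^ 4 * 2 powr (2048 * s powr (4 * \<kappa>)))"
proof -
  define N where "N = (G + 1)\<^sup>2 + 2 * G + 2"
  define P :: real where "P = 2 powr (2048 * s powr (4 * \<kappa>))"
  have a1: "1 \<le> real a" using a_pos by simp
  have s0: "0 < s" "1 \<le> s ^ 4" using s by simp_all
  have P1: "1 \<le> P" by (simp add: P_def ge_one_powr_ge_zero)
  have GL: "3 * real (G * L) ^ 2 * \<mu> \<le> 48 * \<mu> * s ^ 4"
  proof -
    have "real a * real L \<le> 2 * s" using L a1 by (simp add: field_simps)
    then have "2 * real a * (real a * real L) \<le> 2 * s * (2 * s)"
      using a s0 by (intro mult_mono[of "2 * real a" "2 * s"]) auto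
    then have "real (G * L) \<le> 4 * s\<^sup>2" by (simp add: power2_eq_square mult.assoc)
    then have "real (G * L) ^ 2 \<le> (4 * s\<^sup>2) ^ 2" by (intro power_mono) auto
    then have "3 * real (G * L) ^ 2 * \<mu> \<le> 3 * (4 * s\<^sup>2) ^ 2 * \<mu>"
      using mu_pos by (intro mult_right_mono mult_left_mono) auto
    also have "\<dots> = 48 * \<mu> * s ^ 4" by (simp add: power_mult_distrib)
    finally show ?thesis .
  qed
  have pi: "8 ^ 8 / p_success ^ 8 \<le> 8 ^ 8 * P"
  proof -
    have "real N \<le> 16 * real a ^ 4"
    proof -
      have "(2 * x + 1)\<^sup>2 + 2 * (2 * x) + 2 \<le> 16 * (x * x)" if "1 \<le> x" for x :: nat
      proof -
        have "x * 1 \<le> x * x" using that by (intro mult_left_mono) auto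
        moreover have "(2 * x + 1)\<^sup>2 + 2 * (2 * x) + 2 = 4 * (x * x) + 8 * x + 3"
          by (simp add: power2_eq_square algebra_simps)
        ultimately show ?thesis using that by linarith
      qed
      from this[of "a\<^sup>2"] a_pos have "N \<le> 16 * (a\<^sup>2 * a\<^sup>2)"
        by (simp add: N_def)
      then have "real N \<le> real (16 * (a\<^sup>2 * a\<^sup>2))" by (simp only: of_nat_le_iff)
      then show ?thesis by (simp flip: power_add)
    qed
    also have "\<dots> \<le> 16 * (2 * s powr \<kappa>) ^ 4"
      using a by (intro mult_left_mono power_mono) auto
    also have "\<dots> = 256 * (s powr \<kappa>) ^ 4" by (simp add: power_mult_distrib)
    also have "(s powr \<kappa>) ^ 4 = s powr (4 * \<kappa>)"
    proof -
      have "(s powr \<kappa>) ^ 4 = (s powr \<kappa>) powr real 4"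
        using s0 by (intro powr_realpow[symmetric]) simp
      then show ?thesis by (simp add: powr_powr mult.commute)
    qed
    finally have N: "real (N * 8) \<le> 2048 * s powr (4 * \<kappa>)" by simp
    have "1 / p_success ^ 8 = 2 ^ (N * 8)"
      unfolding p_success_def N_def[symmetric] by (simp add: power_one_over power_mult)
    also have "\<dots> = 2 powr real (N * 8)" by (rule powr_realpow[symmetric]) simp
    also have "\<dots> \<le> P" unfolding P_def using N by (intro powr_mono) auto
    finally show ?thesis by simp
  qed
  have "m2 / \<mu> + 3 * real (G * L) ^ 2 * \<mu> + 144 * m2 + 8 ^ 8 / p_success ^ 8 + 1
      \<le> m2 / \<mu> * (s ^ 4 * P) + 48 * \<mu> * (s ^ 4 * P) + 144 * m2 * (s ^ 4 * P) + 8 ^ 8 * (s ^ 4 * P) + 1 * (s ^ 4 * P)"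
  proof (intro add_mono)
    have sP: "1 \<le> s ^ 4 * P" using mult_mono[of 1 "s ^ 4" 1 P] s0 P1 by simp
    show "m2 / \<mu> \<le> m2 / \<mu> * (s ^ 4 * P)" "144 * m2 \<le> 144 * m2 * (s ^ 4 * P)" "1 \<le> 1 * (s ^ 4 * P)"
      using mult_left_mono[OF sP, of "m2 / \<mu>"] mult_left_mono[OF sP, of "144 * m2"] sP m2_pos mu_pos by auto
    have "s ^ 4 * 1 \<le> s ^ 4 * P" using P1 s0 by (intro mult_left_mono) auto
    then have "48 * \<mu> * s ^ 4 \<le> 48 * \<mu> * (s ^ 4 * P)" using mu_pos by simp
    with GL show "3 * real (G * L) ^ 2 * \<mu> \<le> 48 * \<mu> * (s ^ 4 * P)" by linarith
    have "1 * P \<le> s ^ 4 * P" using P1 s0 by (intro mult_right_mono) auto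
    then have "8 ^ 8 * P \<le> 8 ^ 8 * (s ^ 4 * P)" by simp
    with pi show "8 ^ 8 / p_success ^ 8 \<le> 8 ^ 8 * (s ^ 4 * P)" by (rule order_trans)
  qed
  also have "\<dots> = (m2 / \<mu> + 48 * \<mu> + 144 * m2 + 8 ^ 8 + 1) * s ^ 4 * P"
    by (simp add: distrib_right)
  finally show ?thesis
    using order_trans[OF tau_mean_le ennreal_leI] by (simp only: P_def)
qed

end

theorem theorem3:
  fixes DX DV :: "real measure"
  assumes "sets DX = sets borel" and "prob_space DX"
    and "AE x in DX. x > 0"
    and "integrable DX (\<lambda>x. x ^ 2)"
    and "sets DV = sets borel" and "prob_space DV"
    and "AE v in DV. v \<ge> 0"
    and "\<forall>q>0. integrable DV (\<lambda>v. v powr q)"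
    and "\<forall>x. isCont (cdf DV) x"
    and "integral\<^sup>L DV (\<lambda>v. v) / integral\<^sup>L DX (\<lambda>x. x) = 1"
  shows "\<exists>b0. \<forall>b. b > 0 \<and> b \<ge> b0 \<longrightarrow> (\<forall>\<delta>>0.
     \<forall>(M :: nat \<Rightarrow> 'a measure) T S.
       (\<forall>s\<ge>1. stationary_GG_inf (M s) (T s) (S s) (real s) DX DV) \<longrightarrow>
       (let E = (\<lambda>s. \<integral>\<^sup>+ \<omega>. e2ennreal \<bar>tau (real s + b * sqrt (real s)) (\<lambda>n. T s n \<omega>) (\<lambda>n. S s n \<omega>)\<bar> \<partial>M s)
        in eventually (\<lambda>s. E s < \<infinity>) sequentially \<and>
           (\<lambda>s. ln (enn2real (E s))) \<in> o(\<lambda>s. real s powr \<delta>)))"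
proof (intro exI allI impI)
  interpret GI_data DX DV
    using assms(1-8,10) by (intro GI_data.intro)
  fix b \<delta> :: real and M :: "nat \<Rightarrow> 'a measure" and T S
  \<comment> \<open>The witness is the constant \<open>b0\<close> of the interpreted locale. It
    depends on the two laws only, hence serves every \<delta>.\<close>
  assume b: "0 < b \<and> b0 \<le> b" and \<delta>: "0 < \<delta>"
    and stat: "\<forall>s\<ge>1. stationary_GG_inf (M s) (T s) (S s) (real s) DX DV"
  \<comment> \<open>This makes \<open>4 * \<kappa>\<close> at most \<open>\<delta> / 2\<close>, so
    \<open>s powr (4 * \<kappa>)\<close> is negligible against
    \<open>s powr \<delta>\<close>.\<close>
  define \<kappa> where "\<kappa> = min (1 / 8) (\<delta> / 8)"
  have \<kappa>: "0 < \<kappa>" "\<kappa> < 1" "4 * \<kappa> < \<delta>" using \<delta> by (auto simp: \<kappa>_def min_def)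
  define q where "q = 12 + nat \<lceil>13 / \<kappa>\<rceil>"
  obtain c B where c: "0 < c" "0 < measure DX {c..B}" by (rule X_interval)
  obtain v where v: "0 < v" "0 < measure DV {v<..}" by (rule V_positive)
  define lo where "lo = c / 2 * (1 / 2 * (c / \<mu> * measure DX {c..B}) * measure DV {v<..})"
  define hi where "hi = m2 / \<mu> + 48 * \<mu> + 144 * m2 + 8 ^ 8 + 1"
  have lo: "0 < lo" using c v mu_pos by (simp add: lo_def)
  have hi: "0 < hi" using m2_pos mu_pos by (simp add: hi_def add_pos_pos)
  define E where "E s = (\<integral>\<^sup>+ \<omega>. e2ennreal \<bar>tau (real s + b * sqrt (real s)) (\<lambda>n. T s n \<omega>) (\<lambda>n. S s n \<omega>)\<bar> \<partial>M s)" for s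
  define up where "up s = hi * s ^ 4 * 2 powr (2048 * s powr (4 * \<kappa>))" for s :: real
  \<comment> \<open>Dominates the logarithm on both sides: \<open>lo / s\<close> costs one
    \<open>ln s\<close> from below, while \<open>up\<close> costs \<open>4 * ln s\<close> and the
    power from above.\<close>
  define g where "g s = \<bar>ln lo\<bar> + \<bar>ln hi\<bar> + 4 * ln s + 2048 * ln 2 * s powr (4 * \<kappa>)" for s :: real
  have bounds: "\<forall>\<^sub>F s in sequentially. 1 \<le> s \<and> ennreal (lo / real s) \<le> E s \<and> E s \<le> ennreal (up (real s))"
  proof -
    have "\<forall>\<^sub>F s in at_top. B / s \<le> v" using v(1) by real_asymp
    from eventually_compose_filterlim[OF eventually_conj[OF large_scale_conditions[OF \<kappa>(1,2)] this] filterlim_real_sequentially]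
    show ?thesis
    proof eventually_elim
      case (elim s)
      then have s: "1 \<le> real s" by simp
      have queue: "GI_queue DX DV (M s) (T s) (S s) (real s)"
        using s stat by (intro GI_queue.intro GI_data_axioms GI_queue_axioms.intro) auto
      interpret window DX DV "M s" "T s" "S s" "real s" "blocks \<kappa> s" "block_length \<kappa> s" q "K / sqrt s" "s + b * sqrt s"
        using elim b by (intro window_if_large[OF queue \<kappa>(1) q_def]) (simp_all add: q_def)
      have e6: "2 * real s powr \<kappa> \<le> real s" using elim by simp
      have "E s \<le> ennreal (up (real s))"
        unfolding E_def up_def hi_def
        by (rule tau_mean_le_powr[OF _ e6]) (use blocks_bounds[OF \<kappa>(1) s e6] in auto)
      moreover have "ennreal (lo / real s) \<le> E s"
      proof -
        have "lo / real s = c / (2 * real s) * (1 / 2 * (c / \<mu> * measure DX {c..B}) * measure DV {v<..})"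
          by (simp add: lo_def)
        then show ?thesis
          unfolding E_def using tau_mean_ge[OF c(1), of B v] elim by simp
      qed
      ultimately show ?case using s by simp
    qed
  qed
  have "\<forall>\<^sub>F s in sequentially. E s < \<infinity>"
    using bounds by eventually_elim (auto simp: less_top[symmetric] top_unique)
  moreover have "(\<lambda>s. ln (enn2real (E s))) \<in> O(\<lambda>s. g (real s))"
  proof (rule bigoI[where c=1])
    show "\<forall>\<^sub>F s in sequentially. norm (ln (enn2real (E s))) \<le> 1 * norm (g (real s))"
      using bounds
    proof eventually_elim
      case (elim s)
      then have s: "1 \<le> real s" by simp
      define e where "e = enn2real (E s)"
      have up0: "0 \<le> up (real s)" using hi by (simp add: up_def)
      have "E s < top" using elim by (auto simp: less_top[symmetric] top_unique)
      then have e: "E s = ennreal e" "0 \<le> e" by (simp_all add: e_def)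
      have lo_e: "lo / real s \<le> e" and e_up: "e \<le> up (real s)"
        using elim e up0 by auto
      have e0: "0 < e" using lo_e lo s by (smt (verit) divide_pos_pos)
      have "ln lo - ln (real s) = ln (lo / real s)" using lo s by (simp add: ln_div)
      also have "\<dots> \<le> ln e" using lo_e lo s e0 by (subst ln_le_cancel_iff) auto
      finally have l: "ln lo - ln (real s) \<le> ln e" .
      have "ln e \<le> ln (up (real s))" using e_up e0 by (subst ln_le_cancel_iff) auto
      also have "\<dots> = ln hi + 4 * ln (real s) + 2048 * ln 2 * real s powr (4 * \<kappa>)"
        using hi s by (simp add: up_def ln_mult ln_realpow ln_powr)
      finally have u: "ln e \<le> ln hi + 4 * ln (real s) + 2048 * ln 2 * real s powr (4 * \<kappa>)" .
      have nn: "0 \<le> ln (real s)" "0 \<le> 2048 * ln 2 * real s powr (4 * \<kappa>)" using s by simp_all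
      have "\<bar>ln e\<bar> \<le> g (real s)" using l u nn unfolding g_def by linarith
      then show ?case by (simp add: e_def)
    qed
  qed
  moreover have "(\<lambda>s. g (real s)) \<in> o(\<lambda>s. real s powr \<delta>)"
    unfolding g_def using \<kappa> \<delta> by real_asymp
  ultimately show "let E = (\<lambda>s. \<integral>\<^sup>+ \<omega>. e2ennreal \<bar>tau (real s + b * sqrt (real s)) (\<lambda>n. T s n \<omega>) (\<lambda>n. S s n \<omega>)\<bar> \<partial>M s)
        in eventually (\<lambda>s. E s < \<infinity>) sequentially \<and>
           (\<lambda>s. ln (enn2real (E s))) \<in> o(\<lambda>s. real s powr \<delta>)"
    unfolding Let_def E_def[symmetric] by (blast intro: landau_o.big_small_trans)
qed

end
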